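(* Let $\alpha\ge0$, let $b_1<\dots<b_n$ be a buyer support, and let a seller have costs $s_1<\dots<s_m$ with masses $f_k>0$, $\sum_kf_k=1$, whose combined scores $d_k=s_k+\alpha\tau(s_k)$ are nondecreasing in $k$. Let $(C_\ell^r)_{1\le\ell\le n,\,0\le r\le m}$ be real numbers with $C_\ell^0=0$ and $0\le C_\ell^r\le C_\ell^{r+1}$ for all $\ell$ and all $0\le r<m$. The following are equivalent: (i) for every $1\le r\le m$ and every probability vector $g=(g_1,\dots,g_n)$ with all $g_\ell>0$, $F_rV_\alpha(g,S^{\le r})\ge\sum_{\ell}g_\ell C_\ell^r$; (ii) there are arrays $z^r\in\mathcal X_r$ ($1\le r\le m$) with $\mathcal D_\ell^r(z^r)\ge C_\ell^r$ for all $r,\ell$, and $z^r\le z^{r'}$ coordinatewise whenever $r\le r'$. For rational data (including $\alpha$) and rational targets satisfying these conditions, such a family $(z^r)$ is constructible in polynomial time in the explicit local input and output size.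
   Context: Notation: $F_0=0$, $F_r=\sum_{k\le r}f_k$, $\Delta_t=b_{t+1}-b_t$. The seller's virtual cost is $\tau(s_1)=s_1$ and $\tau(s_k)=s_k+(s_k-s_{k-1})F_{k-1}/f_k$ for $k\ge2$. $S^{\le r}$ is the seller distribution conditioned on its first $r$ types (probabilities $f_k/F_r$ for $k\le r$). $\mathcal X_r$ is the set of arrays $z=(z_{k\ell})\in[0,1]^{r\times n}$ that are nonincreasing in the seller index $k$ and nondecreasing in the buyer index $\ell$, extended by $z_{k\ell}=0$ for $k>r$. For $z\in\mathcal X_r$, $$\mathcal D_\ell^r(z)=\sum_{k\le r}f_k\bigl((1+\alpha)b_\ell-d_k\bigr)z_{k\ell}-\alpha\sum_{t<\ell}\Delta_t\sum_{k\le r}f_kz_{kt}.$$ $V_\alpha(g,S^{\le r})$ is the following quantity for the bilateral-trade instance with one buyer (value $v=b_\ell$ with probability $g_\ell$) and one independent seller with cost $c$ distributed as $S^{\le r}$: the maximum of $\mathbb E[(v-c)x]+\alpha\,\mathbb E[p_B+p_S]$ over mechanisms $(x,p_B,p_S)$, where $x(b,s)\in[0,1]$ is a trade probability and $p_B,p_S$ are real payments (of either sign) of buyer and seller to the mechanism as functions of reports in the supports, subject to BIC (for each agent and type, truthful reporting maximizes expected utility, which is $vx-p_B$ for the buyer and $-cx-p_S$ for the seller, when the other reports truthfully) and IIR (expected truthful utility of each type is nonnegative). No budget constraint is imposed. *)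

theory Defs
  imports Complex_Main "HOL-Computational_Algebra.Polynomial"
begin

text \<open>
  All indices are 1-based, as in the mathematics: buyer types \<open>l \<in> {1..n}\<close>, seller types
  \<open>k \<in> {1..m}\<close>, truncation levels \<open>r \<in> {1..m}\<close>.  Values of the index functions
  outside these ranges are irrelevant.
\<close>

section \<open>Bilateral trade\<close>

text \<open>
  A mechanism is a triple of tables \<open>x l k\<close>, \<open>pB l k\<close>, \<open>pS l k\<close>: trade probability and
  payments to the mechanism when the buyer reports her \<open>l\<close>-th and the seller his \<open>k\<close>-th type.
  The buyer has value \<open>v l\<close> with probability \<open>g l\<close> (\<open>l \<in> {1..n}\<close>), the seller has cost
  \<open>c k\<close> with probability \<open>h k\<close> (\<open>k \<in> {1..r}\<close>), independently.
\<close>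

definition buyer_utility ::
  "nat \<Rightarrow> (nat \<Rightarrow> real) \<Rightarrow> (nat \<Rightarrow> real) \<Rightarrow> (nat \<Rightarrow> nat \<Rightarrow> real) \<Rightarrow> (nat \<Rightarrow> nat \<Rightarrow> real) \<Rightarrow> nat \<Rightarrow> nat \<Rightarrow> real"
where \<comment> \<open>expected utility of true type \<open>l\<close> when reporting \<open>l'\<close>\<close>
  "buyer_utility r h v x pB l l' = (\<Sum>k=1..r. h k * (v l * x l' k - pB l' k))"

definition seller_utility ::
  "nat \<Rightarrow> (nat \<Rightarrow> real) \<Rightarrow> (nat \<Rightarrow> real) \<Rightarrow> (nat \<Rightarrow> nat \<Rightarrow> real) \<Rightarrow> (nat \<Rightarrow> nat \<Rightarrow> real) \<Rightarrow> nat \<Rightarrow> nat \<Rightarrow> real"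
where \<comment> \<open>expected utility of true type \<open>k\<close> when reporting \<open>k'\<close>\<close>
  "seller_utility n g c x pS k k' = (\<Sum>l=1..n. g l * (- c k * x l k' - pS l k'))"

definition BIC ::
  "nat \<Rightarrow> (nat \<Rightarrow> real) \<Rightarrow> (nat \<Rightarrow> real) \<Rightarrow> nat \<Rightarrow> (nat \<Rightarrow> real) \<Rightarrow> (nat \<Rightarrow> real) \<Rightarrow>
   (nat \<Rightarrow> nat \<Rightarrow> real) \<Rightarrow> (nat \<Rightarrow> nat \<Rightarrow> real) \<Rightarrow> (nat \<Rightarrow> nat \<Rightarrow> real) \<Rightarrow> bool"
where
  "BIC n v g r c h x pB pS \<longleftrightarrow>
     (\<forall>l\<in>{1..n}. \<forall>l'\<in>{1..n}. buyer_utility r h v x pB l l' \<le> buyer_utility r h v x pB l l) \<and>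
     (\<forall>k\<in>{1..r}. \<forall>k'\<in>{1..r}. seller_utility n g c x pS k k' \<le> seller_utility n g c x pS k k)"

definition IIR ::
  "nat \<Rightarrow> (nat \<Rightarrow> real) \<Rightarrow> (nat \<Rightarrow> real) \<Rightarrow> nat \<Rightarrow> (nat \<Rightarrow> real) \<Rightarrow> (nat \<Rightarrow> real) \<Rightarrow>
   (nat \<Rightarrow> nat \<Rightarrow> real) \<Rightarrow> (nat \<Rightarrow> nat \<Rightarrow> real) \<Rightarrow> (nat \<Rightarrow> nat \<Rightarrow> real) \<Rightarrow> bool"
where
  "IIR n v g r c h x pB pS \<longleftrightarrow>
     (\<forall>l\<in>{1..n}. 0 \<le> buyer_utility r h v x pB l l) \<and>
     (\<forall>k\<in>{1..r}. 0 \<le> seller_utility n g c x pS k k)"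

definition objective ::
  "real \<Rightarrow> nat \<Rightarrow> (nat \<Rightarrow> real) \<Rightarrow> (nat \<Rightarrow> real) \<Rightarrow> nat \<Rightarrow> (nat \<Rightarrow> real) \<Rightarrow> (nat \<Rightarrow> real) \<Rightarrow>
   (nat \<Rightarrow> nat \<Rightarrow> real) \<Rightarrow> (nat \<Rightarrow> nat \<Rightarrow> real) \<Rightarrow> (nat \<Rightarrow> nat \<Rightarrow> real) \<Rightarrow> real"
where
  "objective \<alpha> n v g r c h x pB pS =
     (\<Sum>l=1..n. \<Sum>k=1..r. g l * h k * ((v l - c k) * x l k)) +
     \<alpha> * (\<Sum>l=1..n. \<Sum>k=1..r. g l * h k * (pB l k + pS l k))"

definition mechanism_values ::
  "real \<Rightarrow> nat \<Rightarrow> (nat \<Rightarrow> real) \<Rightarrow> (nat \<Rightarrow> real) \<Rightarrow> nat \<Rightarrow> (nat \<Rightarrow> real) \<Rightarrow> (nat \<Rightarrow> real) \<Rightarrow> real set"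
where
  "mechanism_values \<alpha> n v g r c h =
     {objective \<alpha> n v g r c h x pB pS | x pB pS.
        (\<forall>l\<in>{1..n}. \<forall>k\<in>{1..r}. 0 \<le> x l k \<and> x l k \<le> 1) \<and>
        BIC n v g r c h x pB pS \<and> IIR n v g r c h x pB pS}"

definition bilateral_value ::
  "real \<Rightarrow> nat \<Rightarrow> (nat \<Rightarrow> real) \<Rightarrow> (nat \<Rightarrow> real) \<Rightarrow> nat \<Rightarrow> (nat \<Rightarrow> real) \<Rightarrow> (nat \<Rightarrow> real) \<Rightarrow> real"
where \<comment> \<open>a maximum, not merely a supremum\<close>
  "bilateral_value \<alpha> n v g r c h = (GREATEST y. y \<in> mechanism_values \<alpha> n v g r c h)"


section \<open>Truncated sellers, virtual costs and local arrays\<close>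

definition cum :: "(nat \<Rightarrow> real) \<Rightarrow> nat \<Rightarrow> real" where
  "cum f r = (\<Sum>k=1..r. f k)"

definition virtual_cost :: "(nat \<Rightarrow> real) \<Rightarrow> (nat \<Rightarrow> real) \<Rightarrow> nat \<Rightarrow> real" where
  "virtual_cost s f k =
     (if k = 1 then s 1 else s k + (s k - s (k - 1)) * cum f (k - 1) / f k)"

definition score :: "real \<Rightarrow> (nat \<Rightarrow> real) \<Rightarrow> (nat \<Rightarrow> real) \<Rightarrow> nat \<Rightarrow> real" where
  "score \<alpha> s f k = s k + \<alpha> * virtual_cost s f k"

definition V ::
  "real \<Rightarrow> nat \<Rightarrow> (nat \<Rightarrow> real) \<Rightarrow> (nat \<Rightarrow> real) \<Rightarrow> (nat \<Rightarrow> real) \<Rightarrow> (nat \<Rightarrow> real) \<Rightarrow> nat \<Rightarrow> real"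
where \<comment> \<open>\<open>V\<^sub>\<alpha>(g, S\<^sup>\<le>\<^sup>r)\<close>\<close>
  "V \<alpha> n b g s f r = bilateral_value \<alpha> n b g r s (\<lambda>k. f k / cum f r)"

definition market ::
  "real \<Rightarrow> nat \<Rightarrow> (nat \<Rightarrow> real) \<Rightarrow> nat \<Rightarrow> (nat \<Rightarrow> real) \<Rightarrow> (nat \<Rightarrow> real) \<Rightarrow> bool"
where
  "market \<alpha> n b m s f \<longleftrightarrow>
     0 \<le> \<alpha> \<and> 1 \<le> n \<and> strict_mono_on {1..n} b \<and> strict_mono_on {1..m} s \<and>
     (\<forall>k\<in>{1..m}. 0 < f k) \<and> (\<Sum>k=1..m. f k) = 1 \<and> mono_on {1..m} (score \<alpha> s f)"

definition targets :: "nat \<Rightarrow> nat \<Rightarrow> (nat \<Rightarrow> nat \<Rightarrow> real) \<Rightarrow> bool"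
where \<comment> \<open>\<open>C r l\<close> is \<open>C\<close> with upper index \<open>r\<close> and lower index \<open>l\<close>\<close>
  "targets n m C \<longleftrightarrow>
     (\<forall>l\<in>{1..n}. C 0 l = 0 \<and> (\<forall>r<m. 0 \<le> C r l \<and> C r l \<le> C (Suc r) l))"

definition arrays :: "nat \<Rightarrow> nat \<Rightarrow> (nat \<Rightarrow> nat \<Rightarrow> real) set"
where \<comment> \<open>\<open>\<X>\<^sub>r\<close>; first index seller, second index buyer\<close>
  "arrays n r = {z.
     (\<forall>k\<in>{1..r}. \<forall>l\<in>{1..n}. 0 \<le> z k l \<and> z k l \<le> 1) \<and>
     (\<forall>k\<in>{1..r}. \<forall>k'\<in>{1..r}. \<forall>l\<in>{1..n}. k \<le> k' \<longrightarrow> z k' l \<le> z k l) \<and>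
     (\<forall>k\<in>{1..r}. \<forall>l\<in>{1..n}. \<forall>l'\<in>{1..n}. l \<le> l' \<longrightarrow> z k l \<le> z k l') \<and>
     (\<forall>k>r. \<forall>l\<in>{1..n}. z k l = 0)}"

definition D ::
  "real \<Rightarrow> (nat \<Rightarrow> real) \<Rightarrow> (nat \<Rightarrow> real) \<Rightarrow> (nat \<Rightarrow> real) \<Rightarrow> nat \<Rightarrow> (nat \<Rightarrow> nat \<Rightarrow> real) \<Rightarrow> nat \<Rightarrow> real"
where
  "D \<alpha> b s f r z l =
     (\<Sum>k=1..r. f k * ((1 + \<alpha>) * b l - score \<alpha> s f k) * z k l) -
     \<alpha> * (\<Sum>t=1..<l. (b (Suc t) - b t) * (\<Sum>k=1..r. f k * z k t))"

definition value_condition ::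
  "real \<Rightarrow> nat \<Rightarrow> (nat \<Rightarrow> real) \<Rightarrow> nat \<Rightarrow> (nat \<Rightarrow> real) \<Rightarrow> (nat \<Rightarrow> real) \<Rightarrow> (nat \<Rightarrow> nat \<Rightarrow> real) \<Rightarrow> bool"
where
  "value_condition \<alpha> n b m s f C \<longleftrightarrow>
     (\<forall>r\<in>{1..m}. \<forall>g. (\<forall>l\<in>{1..n}. 0 < g l) \<and> (\<Sum>l=1..n. g l) = 1 \<longrightarrow>
        cum f r * V \<alpha> n b g s f r \<ge> (\<Sum>l=1..n. g l * C r l))"

definition nested_family ::
  "real \<Rightarrow> nat \<Rightarrow> (nat \<Rightarrow> real) \<Rightarrow> nat \<Rightarrow> (nat \<Rightarrow> real) \<Rightarrow> (nat \<Rightarrow> real) \<Rightarrow> (nat \<Rightarrow> nat \<Rightarrow> real) \<Rightarrow>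
   (nat \<Rightarrow> nat \<Rightarrow> nat \<Rightarrow> real) \<Rightarrow> bool"
where
  "nested_family \<alpha> n b m s f C z \<longleftrightarrow>
     (\<forall>r\<in>{1..m}. z r \<in> arrays n r) \<and>
     (\<forall>r\<in>{1..m}. \<forall>l\<in>{1..n}. D \<alpha> b s f r (z r) l \<ge> C r l) \<and>
     (\<forall>r\<in>{1..m}. \<forall>r'\<in>{1..m}. r \<le> r' \<longrightarrow>
        (\<forall>k\<in>{1..m}. \<forall>l\<in>{1..n}. z r k l \<le> z r' k l))"


section \<open>Polynomial-time computation\<close>

text \<open>
  The machine model is a one-variable WHILE language on binary trees (Lisp data with a single
  atom).  Every instruction is charged the full size of the tree it acts on, so copying is never
  free and the size of a result is bounded by the running time; hence running times are
  polynomially related to those of Turing machines.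
\<close>

datatype tree = Tip | Bin tree tree

primrec nodes :: "tree \<Rightarrow> nat" where
  "nodes Tip = 1"
| "nodes (Bin u v) = Suc (nodes u + nodes v)"

primrec left_subtree :: "tree \<Rightarrow> tree" where
  "left_subtree Tip = Tip"
| "left_subtree (Bin u v) = u"

primrec right_subtree :: "tree \<Rightarrow> tree" where
  "right_subtree Tip = Tip"
| "right_subtree (Bin u v) = v"

datatype prog =
    Ident
  | MkTip
  | GetLeft
  | GetRight
  | MkBin prog prog
  | Seq prog prog
  | Cond prog prog prog
  | Loop prog prog

text \<open>
  \<open>exec P t u T\<close>: on input \<open>t\<close> program \<open>P\<close> halts with result \<open>u\<close> after time \<open>T\<close>.
  In tests \<open>Tip\<close> means false.
\<close>

inductive exec :: "prog \<Rightarrow> tree \<Rightarrow> tree \<Rightarrow> nat \<Rightarrow> bool" where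
  Ident: "exec Ident t t (nodes t)"
| MkTip: "exec MkTip t Tip (nodes t)"
| GetLeft: "exec GetLeft t (left_subtree t) (nodes t)"
| GetRight: "exec GetRight t (right_subtree t) (nodes t)"
| MkBin: "exec P t u T \<Longrightarrow> exec Q t v T' \<Longrightarrow> exec (MkBin P Q) t (Bin u v) (nodes t + T + T')"
| Seq: "exec P t u T \<Longrightarrow> exec Q u v T' \<Longrightarrow> exec (Seq P Q) t v (nodes t + T + T')"
| CondTrue: "exec B t w T \<Longrightarrow> w \<noteq> Tip \<Longrightarrow> exec P t u T' \<Longrightarrow>
    exec (Cond B P Q) t u (nodes t + T + T')"
| CondFalse: "exec B t Tip T \<Longrightarrow> exec Q t u T' \<Longrightarrow>
    exec (Cond B P Q) t u (nodes t + T + T')"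
| LoopEnd: "exec B t Tip T \<Longrightarrow> exec (Loop B P) t t (nodes t + T)"
| LoopStep: "exec B t w T \<Longrightarrow> w \<noteq> Tip \<Longrightarrow> exec P t u T' \<Longrightarrow> exec (Loop B P) u v T'' \<Longrightarrow>
    exec (Loop B P) t v (nodes t + T + T' + T'')"

inductive_cases exec_IdentE: "exec Ident t u T"
inductive_cases exec_MkTipE: "exec MkTip t u T"
inductive_cases exec_GetLeftE: "exec GetLeft t u T"
inductive_cases exec_GetRightE: "exec GetRight t u T"
inductive_cases exec_MkBinE: "exec (MkBin P Q) t u T"
inductive_cases exec_SeqE: "exec (Seq P Q) t u T"
inductive_cases exec_CondE: "exec (Cond B P Q) t u T"
inductive_cases exec_LoopE: "exec (Loop B P) t u T"

lemma exec_deterministic: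
  "exec P t u T \<Longrightarrow> exec P t u' T' \<Longrightarrow> u = u' \<and> T = T'"
proof (induction arbitrary: u' T' rule: exec.induct)
  case Ident then show ?case by (auto elim: exec_IdentE)
next
  case MkTip then show ?case by (auto elim: exec_MkTipE)
next
  case GetLeft then show ?case by (auto elim: exec_GetLeftE)
next
  case GetRight then show ?case by (auto elim: exec_GetRightE)
next
  case MkBin then show ?case by (elim exec_MkBinE) blast
next
  case Seq then show ?case by (elim exec_SeqE) blast
next
  case CondTrue then show ?case by (elim exec_CondE) blast+
next
  case CondFalse then show ?case by (elim exec_CondE) blast+
next
  case LoopEnd
  from LoopEnd.prems show ?case by (cases rule: exec_LoopE) (use LoopEnd.IH in blast)+
next
  case LoopStep
  from LoopStep.prems show ?case
    by (cases rule: exec_LoopE) (use LoopStep.IH LoopStep.hyps in blast)+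
qed

lemma nodes_pos: "Suc 0 \<le> nodes t"
  by (cases t) auto

lemma exec_result_size: "exec P t u T \<Longrightarrow> nodes u \<le> T"
proof (induction rule: exec.induct)
  case (GetLeft t) then show ?case by (cases t) auto
next
  case (GetRight t) then show ?case by (cases t) auto
next
  case (MkBin P t u T Q v T')
  then show ?case by (cases t) auto
qed (auto simp: nodes_pos)


section \<open>Binary encodings\<close>

definition bool_code :: "bool \<Rightarrow> tree" where
  "bool_code a = (if a then Bin Tip Tip else Tip)"

fun nat_code :: "nat \<Rightarrow> tree" where \<comment> \<open>least significant bit first\<close>
  "nat_code a = (if a = 0 then Tip else Bin (bool_code (odd a)) (nat_code (a div 2)))"

declare nat_code.simps [simp del]

definition int_code :: "int \<Rightarrow> tree" where \<comment> \<open>sign and magnitude\<close>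
  "int_code a = Bin (bool_code (a < 0)) (nat_code (nat \<bar>a\<bar>))"

text \<open>
  A number is coded by any fraction representing it, not necessarily in lowest terms.  Exactly the
  rational numbers have codes, so ``coded'' data are in particular rational data.
\<close>

definition codes_rat :: "real \<Rightarrow> tree \<Rightarrow> bool" where
  "codes_rat q t \<longleftrightarrow>
     (\<exists>a c :: int. 0 < c \<and> q = of_int a / of_int c \<and> t = Bin (int_code a) (int_code c))"

lemma codes_rat_Rats: "(\<exists>t. codes_rat q t) \<longleftrightarrow> q \<in> \<rat>"
proof
  assume "\<exists>t. codes_rat q t"
  then show "q \<in> \<rat>" by (auto simp: codes_rat_def)
next
  assume "q \<in> \<rat>"
  then obtain a c :: int where "0 < c" "q = of_int a / of_int c"
    by (metis Rats_cases')
  then show "\<exists>t. codes_rat q t" by (auto simp: codes_rat_def)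
qed

primrec codes_list :: "('a \<Rightarrow> tree \<Rightarrow> bool) \<Rightarrow> 'a list \<Rightarrow> tree \<Rightarrow> bool" where
  "codes_list R [] t \<longleftrightarrow> t = Tip"
| "codes_list R (x # xs) t \<longleftrightarrow> (\<exists>u v. t = Bin u v \<and> R x u \<and> codes_list R xs v)"

definition codes_vector :: "nat \<Rightarrow> (nat \<Rightarrow> real) \<Rightarrow> tree \<Rightarrow> bool" where
  "codes_vector n x = codes_list codes_rat (map x [1..<Suc n])"

definition codes_input ::
  "real \<Rightarrow> nat \<Rightarrow> (nat \<Rightarrow> real) \<Rightarrow> nat \<Rightarrow> (nat \<Rightarrow> real) \<Rightarrow> (nat \<Rightarrow> real) \<Rightarrow> (nat \<Rightarrow> nat \<Rightarrow> real) \<Rightarrow> tree \<Rightarrow> bool"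
where
  "codes_input \<alpha> n b m s f C t \<longleftrightarrow>
     (\<exists>t\<^sub>\<alpha> t\<^sub>b t\<^sub>s t\<^sub>f t\<^sub>C. t = Bin t\<^sub>\<alpha> (Bin t\<^sub>b (Bin t\<^sub>s (Bin t\<^sub>f t\<^sub>C))) \<and>
        codes_rat \<alpha> t\<^sub>\<alpha> \<and> codes_vector n b t\<^sub>b \<and> codes_vector m s t\<^sub>s \<and> codes_vector m f t\<^sub>f \<and>
        codes_list (codes_vector n) (map C [0..<Suc m]) t\<^sub>C)"

definition codes_family :: "nat \<Rightarrow> nat \<Rightarrow> (nat \<Rightarrow> nat \<Rightarrow> nat \<Rightarrow> real) \<Rightarrow> tree \<Rightarrow> bool"
where \<comment> \<open>the list of the arrays \<open>z r\<close>, each written out as \<open>r\<close> rows of length \<open>n\<close>\<close>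
  "codes_family n m z =
     codes_list (\<lambda>r. codes_list (codes_vector n) (map (z r) [1..<Suc r])) [1..<Suc m]"

end

theory Submission
  imports Defs "HOL-Analysis.Function_Topology"
begin

text \<open>
  For a single level \<open>r\<close>, only the traded quantities \<open>q\<^sub>l = \<Sum>k. f\<^sub>k z\<^sub>k\<^sub>l\<close> matter: since scores are
  nondecreasing, filling each quantity with the sellers of lowest index is optimal, and then
  \<open>D l \<ge> C l\<close> says that \<open>(\<beta>\<^sub>l - d\<^sub>j) q\<^sub>l + K\<^sub>j \<ge> C\<^sub>l + \<alpha> \<Sum>t<l. \<Delta>\<^sub>t q\<^sub>t\<close> for all \<open>j \<le> r\<close>, where
  \<open>\<beta>\<^sub>l = (1 + \<alpha>) b\<^sub>l\<close> and \<open>K\<^sub>j = \<Sum>k<j. f\<^sub>k (d\<^sub>j - d\<^sub>k)\<close>.  The inequalities with \<open>\<beta>\<^sub>l > d\<^sub>j\<close>, together with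
  \<open>q\<^sub>l \<ge> q\<^sub>l\<^sub>-\<^sub>1\<close>, bound \<open>q\<^sub>l\<close> from below by increasing functions of the earlier quantities and hence have
  a least solution, computed buyer type by buyer type; all remaining constraints are upper bounds,
  easiest to satisfy by that least solution.  It is monotone in \<open>r\<close> and in the targets, which gives
  nestedness.  If it violates an upper bound, tracing the tight lower bounds backwards yields weights
  \<open>g\<close> for which no array reaches the weighted target; by Myerson's payment bounds this contradicts
  the value condition.
\<close>

section \<open>Greedy filling\<close>

text \<open>One explicit recursion replaces a linear programming algorithm: it provides the feasible
  point, its monotonicity gives nestedness, and running it is the algorithm. Three gaps separate it
  from the statement. Incentive compatibility makes only expected trade monotone, whereas members of
  \<open>arrays n r\<close> are monotone cell by cell; refilling the same expected quantities
  greedily repairs this without lowering any component of \<open>D\<close>. The value condition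
  speaks of strictly positive weights, whereas the weights traced back from a violated bound are
  merely nonnegative; a violation has positive size, so a small perturbation of the weights is
  affordable. And \<open>V\<close> is a greatest element, so a maximum has to exist, which comes
  from compactness of the arrays. For the running time the obstacle is the growth of numbers: a loop
  with polynomial time steps may still produce exponentially long data, so every loop needs a
  polynomial bound on its accumulator fixed in advance.\<close>

lemma cum_0 [simp]: "cum f 0 = 0"
  by (simp add: cum_def)

lemma cum_Suc [simp]: "cum f (Suc r) = cum f r + f (Suc r)"
  by (simp add: cum_def)

definition quantity :: "(nat \<Rightarrow> real) \<Rightarrow> nat \<Rightarrow> (nat \<Rightarrow> nat \<Rightarrow> real) \<Rightarrow> nat \<Rightarrow> real" where
  "quantity f r z l = (\<Sum>k=1..r. f k * z k l)"

text \<open>The share of type k that trades when the masses are stacked in the order of the index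
  and the stack is cut at height q.\<close>

definition fill :: "(nat \<Rightarrow> real) \<Rightarrow> real \<Rightarrow> nat \<Rightarrow> real" where
  "fill f q k = min 1 (max 0 ((q - cum f (k - 1)) / f k))"

text \<open>The intercept of a supporting line: the least total score of a traded quantity q is
  convex and piecewise linear, namely the maximum over j of d_j q - K_j.\<close>

definition excess :: "real \<Rightarrow> (nat \<Rightarrow> real) \<Rightarrow> (nat \<Rightarrow> real) \<Rightarrow> nat \<Rightarrow> real" where
  "excess \<alpha> s f j = (\<Sum>k=1..<j. f k * (score \<alpha> s f j - score \<alpha> s f k))"

lemma sum_split_at:
  fixes u :: "nat \<Rightarrow> real"
  assumes "1 \<le> j" "j \<le> Suc r"
  shows "(\<Sum>k=1..r. u k) = (\<Sum>k=1..<j. u k) + (\<Sum>k=j..r. u k)"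
proof -
  have "{1..r} = {1..<j} \<union> {j..r}" using assms by auto
  moreover have "{1..<j} \<inter> {j..r} = {}" by auto
  ultimately show ?thesis by (simp add: sum.union_disjoint)
qed

text \<open>The discrete envelope argument behind incentive compatibility.\<close>

lemma envelope:
  fixes w v :: "nat \<Rightarrow> real"
  assumes "\<And>t. t \<in> {i..j} \<Longrightarrow> t < j \<Longrightarrow> w t \<le> w (Suc t)"
    and "\<And>t t'. t \<in> {i..j} \<Longrightarrow> t' \<in> {i..j} \<Longrightarrow> t \<le> t' \<Longrightarrow> v t \<le> v t'"
    and "i \<le> j"
  shows "(w j - w i) * v i \<le> (\<Sum>t=i..<j. (w (Suc t) - w t) * v t)"
    and "(\<Sum>t=i..<j. (w (Suc t) - w t) * v t) \<le> (w j - w i) * v j"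
proof -
  have w: "(\<Sum>t=i..<j. w (Suc t) - w t) = w j - w i"
    using sum_Suc_diff'[OF assms(3), of w] .
  have "(w j - w i) * v i = (\<Sum>t=i..<j. (w (Suc t) - w t) * v i)"
    unfolding w[symmetric] sum_distrib_right ..
  also have "\<dots> \<le> (\<Sum>t=i..<j. (w (Suc t) - w t) * v t)"
    using assms by (intro sum_mono mult_left_mono) (auto simp: algebra_simps)
  finally show "(w j - w i) * v i \<le> (\<Sum>t=i..<j. (w (Suc t) - w t) * v t)" .
  have "(\<Sum>t=i..<j. (w (Suc t) - w t) * v t) \<le> (\<Sum>t=i..<j. (w (Suc t) - w t) * v j)"
    using assms by (intro sum_mono mult_left_mono) (auto simp: algebra_simps)
  also have "\<dots> = (w j - w i) * v j"
    unfolding w[symmetric] sum_distrib_right ..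
  finally show "(\<Sum>t=i..<j. (w (Suc t) - w t) * v t) \<le> (w j - w i) * v j" .
qed

lemma sum_Ico_split:
  fixes u :: "nat \<Rightarrow> real"
  assumes "a \<le> i" "i \<le> j"
  shows "(\<Sum>t=a..<j. u t) = (\<Sum>t=a..<i. u t) + (\<Sum>t=i..<j. u t)"
  using sum.atLeastLessThan_concat[OF assms, of u] by simp

text \<open>For values \<open>w\<close> and trade \<open>v\<close>, with the sum of the increments
  below a type as its rent, this compares the utility of type l posing as l' with the truthful one.
  Whether the lower or the upper envelope estimate applies depends on the order of l and l'.\<close>

lemma envelope_global:
  fixes w v :: "nat \<Rightarrow> real"
  assumes w: "\<And>t. t \<in> {1..n} \<Longrightarrow> t < n \<Longrightarrow> w t \<le> w (Suc t)"
    and v: "\<And>t t'. t \<in> {1..n} \<Longrightarrow> t' \<in> {1..n} \<Longrightarrow> t \<le> t' \<Longrightarrow> v t \<le> v t'"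
    and l: "l \<in> {1..n}" "l' \<in> {1..n}"
  shows "(w l - w l') * v l' + (\<Sum>t=1..<l'. (w (Suc t) - w t) * v t)
           \<le> (\<Sum>t=1..<l. (w (Suc t) - w t) * v t)"
proof (cases "l' \<le> l")
  case True
  have "(w l - w l') * v l' \<le> (\<Sum>t=l'..<l. (w (Suc t) - w t) * v t)"
    using l True by (intro envelope(1)) (auto intro!: w v)
  then show ?thesis
    using sum_Ico_split[of 1 l' l "\<lambda>t. (w (Suc t) - w t) * v t"] True l by simp
next
  case False
  have "(\<Sum>t=l..<l'. (w (Suc t) - w t) * v t) \<le> (w l' - w l) * v l'"
    using l False by (intro envelope(2)) (auto intro!: w v)
  then show ?thesis
    using sum_Ico_split[of 1 l l' "\<lambda>t. (w (Suc t) - w t) * v t"] False l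
    by (simp add: algebra_simps)
qed

section \<open>The market and the quantities traded under greedy filling\<close>

locale trade =
  fixes \<alpha> :: real and n :: nat and b :: "nat \<Rightarrow> real" and m :: nat and s f :: "nat \<Rightarrow> real"
  assumes market: "market \<alpha> n b m s f"
begin

abbreviation "d \<equiv> score \<alpha> s f"
abbreviation "\<beta> l \<equiv> (1 + \<alpha>) * b l"
abbreviation "K \<equiv> excess \<alpha> s f"
abbreviation "F \<equiv> cum f"
abbreviation "Dr \<equiv> D \<alpha> b s f"

lemma alpha: "0 \<le> \<alpha>" and n1: "1 \<le> n"
  and f_pos: "k \<in> {1..m} \<Longrightarrow> 0 < f k"
  using market by (auto simp: market_def)

lemma b_mono: "l \<in> {1..n} \<Longrightarrow> l' \<in> {1..n} \<Longrightarrow> l \<le> l' \<Longrightarrow> b l \<le> b l'"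
  using market strict_mono_on_leD[of "{1..n}" b] by (auto simp: market_def)

lemma s_mono: "l \<in> {1..m} \<Longrightarrow> l' \<in> {1..m} \<Longrightarrow> l \<le> l' \<Longrightarrow> s l \<le> s l'"
  using market strict_mono_on_leD[of "{1..m}" s] by (auto simp: market_def)

lemma d_mono: "l \<in> {1..m} \<Longrightarrow> l' \<in> {1..m} \<Longrightarrow> l \<le> l' \<Longrightarrow> d l \<le> d l'"
  using market by (auto simp: market_def mono_on_def)

lemma F_mono: "i \<le> j \<Longrightarrow> j \<le> m \<Longrightarrow> F i \<le> F j"
proof (induction rule: dec_induct)
  case (step i') then show ?case using f_pos[of "Suc i'"] by simp
qed simp

lemma F_pos: "r \<in> {1..m} \<Longrightarrow> 0 < F r"
  using F_mono[of 1 r] f_pos[of 1] cum_Suc[of f 0] by auto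

lemma F_nonneg: "r \<le> m \<Longrightarrow> 0 \<le> F r"
  using F_mono[of 0 r] by simp

text \<open>Subtracting one reference score d_j from all scores separates the total quantity from
  the deviations of the scores. The index j is free, so each choice later yields one affine
  bound.\<close>

lemma D_quantity:
  "Dr r y l = (\<beta> l - d j) * quantity f r y l + (\<Sum>k=1..r. f k * (d j - d k) * y k l)
     - \<alpha> * (\<Sum>t=1..<l. (b (Suc t) - b t) * quantity f r y t)"
proof -
  have "(\<beta> l - d j) * quantity f r y l + (\<Sum>k=1..r. f k * (d j - d k) * y k l)
      = (\<Sum>k=1..r. f k * (\<beta> l - d k) * y k l)"
    unfolding quantity_def sum_distrib_left sum.distrib[symmetric]
    by (intro sum.cong) (auto simp: algebra_simps)
  then show ?thesis by (simp add: D_def quantity_def)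
qed

text \<open>The coefficients d_j - d_k are nonnegative for k < j, where y = 1 is extremal, and
  nonpositive from j on, where y = 0 is.\<close>

lemma excess_bound:
  assumes "j \<in> {1..r}" "r \<le> m" "\<And>k. k \<in> {1..r} \<Longrightarrow> 0 \<le> y k \<and> y k \<le> 1"
  shows "(\<Sum>k=1..r. f k * (d j - d k) * y k) \<le> K j"
proof -
  have "(\<Sum>k=1..r. f k * (d j - d k) * y k)
      = (\<Sum>k=1..<j. f k * (d j - d k) * y k) + (\<Sum>k=j..r. f k * (d j - d k) * y k)"
    using assms by (intro sum_split_at) auto
  also have "(\<Sum>k=1..<j. f k * (d j - d k) * y k) \<le> K j"
    unfolding excess_def
  proof (intro sum_mono mult_right_le_one_le mult_nonneg_nonneg)
    fix k assume k: "k \<in> {1..<j}"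
    then show "0 \<le> f k" "0 \<le> y k" "y k \<le> 1" "0 \<le> d j - d k"
      using f_pos[of k] assms d_mono[of k j] by (auto intro: less_imp_le)
  qed
  also have "(\<Sum>k=j..r. f k * (d j - d k) * y k) \<le> 0"
  proof (intro sum_nonpos)
    fix k assume k: "k \<in> {j..r}"
    then have "0 \<le> f k" "0 \<le> y k" "d j - d k \<le> 0"
      using f_pos[of k] assms d_mono[of j k] by (auto intro: less_imp_le)
    then show "f k * (d j - d k) * y k \<le> 0" by (intro mult_nonpos_nonneg mult_nonneg_nonpos)
  qed
  finally show ?thesis by simp
qed

lemma D_le:
  assumes "j \<in> {1..r}" "r \<le> m" "\<And>k. k \<in> {1..r} \<Longrightarrow> 0 \<le> y k l \<and> y k l \<le> 1"
  shows "Dr r y l \<le> (\<beta> l - d j) * quantity f r y l + K j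
     - \<alpha> * (\<Sum>t=1..<l. (b (Suc t) - b t) * quantity f r y t)"
  unfolding D_quantity[of r y l j] using excess_bound[of j r "\<lambda>k. y k l"] assms by simp

lemma fill_bounds: "0 \<le> fill f q k" "fill f q k \<le> 1"
  by (auto simp: fill_def)

lemma fill_eq_1: "k \<in> {1..m} \<Longrightarrow> F k \<le> q \<Longrightarrow> fill f q k = 1"
  using f_pos[of k] cum_Suc[of f "k - 1"] by (auto simp: fill_def min_def max_def field_simps)

lemma fill_eq_0: "k \<in> {1..m} \<Longrightarrow> q \<le> F (k - 1) \<Longrightarrow> fill f q k = 0"
  using f_pos[of k] by (auto simp: fill_def min_def max_def divide_le_0_iff field_simps)

lemma fill_mono: "k \<in> {1..m} \<Longrightarrow> q \<le> q' \<Longrightarrow> fill f q k \<le> fill f q' k"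
  unfolding fill_def using f_pos[of k]
  by (intro min.mono max.mono order_refl divide_right_mono) auto

lemma fill_antimono:
  assumes "k \<in> {1..m}" "k' \<in> {1..m}" "k \<le> k'"
  shows "fill f q k' \<le> fill f q k"
proof (cases "k = k' \<or> q \<le> F (k' - 1)")
  case True
  then show ?thesis using fill_eq_0[of k' q] assms fill_bounds by auto
next
  case False
  then have "F k \<le> F (k' - 1)" using assms by (intro F_mono) auto
  with False have "F k \<le> q" by auto
  then show ?thesis using fill_eq_1[of k q] assms fill_bounds by simp
qed

lemma sum_fill:
  assumes "0 \<le> q" "r \<le> m"
  shows "(\<Sum>k=1..r. f k * fill f q k) = min q (F r)"
  using assms(2)
proof (induction r)
  case 0 then show ?case using assms by simp
next
  case (Suc r)
  have *: "f (Suc r) * fill f q (Suc r) = min (f (Suc r)) (max 0 (q - F r))"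
    using f_pos[of "Suc r"] Suc.prems
    by (auto simp: fill_def min_def max_def field_simps)
  show ?case using Suc f_pos[of "Suc r"] by (auto simp: * min_def max_def)
qed

lemma segment:
  assumes "0 \<le> q" "q \<le> F r" "1 \<le> r"
  shows "\<exists>j\<in>{1..r}. F (j - 1) \<le> q \<and> q \<le> F j"
proof -
  define j where "j = (LEAST j. 1 \<le> j \<and> q \<le> F j)"
  have j: "1 \<le> j \<and> q \<le> F j" unfolding j_def by (rule LeastI[of _ r]) (use assms in auto)
  have "j \<le> r" unfolding j_def by (rule Least_le) (use assms in auto)
  moreover have "F (j - 1) \<le> q"
  proof (cases "j = 1")
    case False
    then have "\<not> (1 \<le> j - 1 \<and> q \<le> F (j - 1))"
      using j unfolding j_def by (intro not_less_Least) auto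
    then show ?thesis using False j by auto
  qed (use assms in simp)
  ultimately show ?thesis using j by auto
qed

definition fill_array :: "nat \<Rightarrow> (nat \<Rightarrow> real) \<Rightarrow> nat \<Rightarrow> nat \<Rightarrow> real" where
  "fill_array r q k l = (if k \<le> r then fill f (q l) k else 0)"

lemma quantity_fill_array:
  assumes "0 \<le> q l" "q l \<le> F r" "r \<le> m"
  shows "quantity f r (fill_array r q) l = q l"
  using sum_fill[of "q l" r] assms by (simp add: quantity_def fill_array_def)

lemma fill_array_arrays:
  assumes "\<And>l l'. l \<in> {1..n} \<Longrightarrow> l' \<in> {1..n} \<Longrightarrow> l \<le> l' \<Longrightarrow> q l \<le> q l'" "r \<le> m"
  shows "fill_array r q \<in> arrays n r"
  using assms fill_bounds fill_antimono fill_mono by (auto simp: arrays_def fill_array_def)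

text \<open>Choose j as the seller at whose mass the stack is cut at height q_l. Lower sellers are
  full, higher ones empty, and the partially filled seller j drops out because its coefficient d_j -
  d_j is 0; so the affine bound of \<open>D_le\<close> is attained at this j.\<close>

lemma D_fill_array:
  assumes "\<And>t. t \<in> {1..l} \<Longrightarrow> 0 \<le> q t \<and> q t \<le> F r" "r \<in> {1..m}" "1 \<le> l"
  shows "\<exists>j\<in>{1..r}. Dr r (fill_array r q) l = (\<beta> l - d j) * q l + K j
     - \<alpha> * (\<Sum>t=1..<l. (b (Suc t) - b t) * q t)"
proof -
  obtain j where j: "j \<in> {1..r}" "F (j - 1) \<le> q l" "q l \<le> F j"
    using segment[of "q l" r] assms by auto
  have "(\<Sum>k=1..r. f k * (d j - d k) * fill_array r q k l)
      = (\<Sum>k=1..<j. f k * (d j - d k) * fill f (q l) k)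
        + (\<Sum>k=j..r. f k * (d j - d k) * fill f (q l) k)"
    using j by (subst sum_split_at[of j]) (auto simp: fill_array_def)
  also have "(\<Sum>k=1..<j. f k * (d j - d k) * fill f (q l) k) = K j"
    unfolding excess_def
  proof (intro sum.cong refl)
    fix k assume "k \<in> {1..<j}"
    then have "F k \<le> F (j - 1)" using j assms by (intro F_mono) auto
    then have "fill f (q l) k = 1"
      using j assms \<open>k \<in> {1..<j}\<close> by (intro fill_eq_1) auto
    then show "f k * (d j - d k) * fill f (q l) k = f k * (d j - d k)" by simp
  qed
  also have "(\<Sum>k=j..r. f k * (d j - d k) * fill f (q l) k) = 0"
  proof (intro sum.neutral ballI)
    fix k assume k: "k \<in> {j..r}"
    show "f k * (d j - d k) * fill f (q l) k = 0"
    proof (cases "k = j")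
      case False
      then have "F j \<le> F (k - 1)" using j k assms by (intro F_mono) auto
      then have "fill f (q l) k = 0"
        using j k assms by (intro fill_eq_0) auto
      then show ?thesis by simp
    qed simp
  qed
  finally show ?thesis
    using j assms by (intro bexI[of _ j]) (auto simp: D_quantity[of r _ l j] quantity_fill_array)
qed

lemma quantity_bounds:
  assumes "r \<le> m" "\<And>k. k \<in> {1..r} \<Longrightarrow> 0 \<le> y k l \<and> y k l \<le> 1"
  shows "0 \<le> quantity f r y l" "quantity f r y l \<le> F r"
proof -
  have f: "0 \<le> f k" if "k \<in> {1..r}" for k using f_pos[of k] that assms(1) by (auto intro: less_imp_le)
  show "0 \<le> quantity f r y l" unfolding quantity_def using f assms(2) by (intro sum_nonneg mult_nonneg_nonneg) auto
  show "quantity f r y l \<le> F r" unfolding quantity_def cum_def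
    using f assms(2) by (intro sum_mono mult_left_le) auto
qed

lemma quantity_mono:
  assumes "r \<le> m" "z \<in> arrays n r" "l \<in> {1..n}" "l' \<in> {1..n}" "l \<le> l'"
  shows "quantity f r z l \<le> quantity f r z l'"
  unfolding quantity_def
proof (intro sum_mono mult_left_mono)
  fix k assume k: "k \<in> {1..r}"
  show "z k l \<le> z k l'" using assms k by (auto simp: arrays_def)
  show "0 \<le> f k" using f_pos[of k] k assms by auto
qed

text \<open>All affine bounds depend on \<open>y\<close> only through its quantities, and filling
  attains one of them. Here \<open>y\<close> is any table with entries in [0, 1], such as the trade
  table of a mechanism that is monotone only in expectation.\<close>

lemma D_le_fill:
  assumes "r \<in> {1..m}" "\<And>k t. k \<in> {1..r} \<Longrightarrow> t \<in> {1..l} \<Longrightarrow> 0 \<le> y k t \<and> y k t \<le> 1" "1 \<le> l"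
  shows "Dr r y l \<le> Dr r (fill_array r (quantity f r y)) l"
proof -
  have "0 \<le> quantity f r y t \<and> quantity f r y t \<le> F r" if "t \<in> {1..l}" for t
    using quantity_bounds[of r y t] assms that by auto
  with D_fill_array[of l "quantity f r y" r] assms(1,3) obtain j where "j \<in> {1..r}"
      "Dr r (fill_array r (quantity f r y)) l = (\<beta> l - d j) * quantity f r y l + K j
     - \<alpha> * (\<Sum>t=1..<l. (b (Suc t) - b t) * quantity f r y t)" by auto
  then show ?thesis using D_le[of j r y l] assms by auto
qed

end

section \<open>Reduction to virtual surplus\<close>

context trade
begin

text \<open>The expected objective when every buyer and seller rent is as small as incentive
  compatibility permits.\<close>

lemma virtual_surplus:
  fixes x :: "nat \<Rightarrow> nat \<Rightarrow> real" and g :: "nat \<Rightarrow> real"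
  assumes r: "r \<in> {1..m}"
  defines "h \<equiv> \<lambda>k. f k / F r"
  defines "Q \<equiv> \<lambda>l. \<Sum>k=1..r. h k * x l k" and "X \<equiv> \<lambda>k. \<Sum>l=1..n. g l * x l k"
  shows "(\<Sum>l=1..n. \<Sum>k=1..r. g l * h k * ((b l - s k) * x l k))
      + \<alpha> * ((\<Sum>l=1..n. g l * (b l * Q l - (\<Sum>t=1..<l. (b (Suc t) - b t) * Q t)))
             - (\<Sum>k=1..r. h k * (virtual_cost s f k * X k)))
    = (\<Sum>l=1..n. g l * Dr r (\<lambda>k l. x l k) l) / F r"
proof -
  have gen: "(\<Sum>l=1..n. g l * (A l + \<alpha> * B l - \<alpha> * C l))
    = (\<Sum>l=1..n. g l * A l) + \<alpha> * ((\<Sum>l=1..n. g l * B l) - (\<Sum>l=1..n. g l * C l))" for A B C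
    by (simp add: sum.distrib sum_subtractf sum_distrib_left algebra_simps)
  have F: "F r > 0" using F_pos r by simp
  have Q: "quantity f r (\<lambda>k l. x l k) l = F r * Q l" for l
    using F by (simp add: quantity_def Q_def h_def sum_distrib_left)
  have D: "Dr r (\<lambda>k l. x l k) l = F r * ((\<Sum>k=1..r. h k * ((b l - s k) * x l k))
      + \<alpha> * (b l * Q l - (\<Sum>t=1..<l. (b (Suc t) - b t) * Q t))
      - \<alpha> * (\<Sum>k=1..r. h k * (virtual_cost s f k * x l k)))" for l
  proof -
    have "(\<Sum>k=1..r. f k * ((1 + \<alpha>) * b l - d k) * x l k)
       = F r * ((\<Sum>k=1..r. h k * ((b l - s k) * x l k)) + \<alpha> * (b l * Q l)
         - \<alpha> * (\<Sum>k=1..r. h k * (virtual_cost s f k * x l k)))"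
      unfolding Q_def sum_distrib_left sum.distrib[symmetric] sum_subtractf[symmetric]
      using F by (intro sum.cong refl) (simp add: h_def score_def field_simps)
    moreover have "(\<Sum>t=1..<l. (b (Suc t) - b t) * quantity f r (\<lambda>k l. x l k) t)
       = F r * (\<Sum>t=1..<l. (b (Suc t) - b t) * Q t)"
      by (simp add: Q sum_distrib_left mult_ac)
    ultimately show ?thesis
      by (simp add: D_def quantity_def algebra_simps)
  qed
  have X: "(\<Sum>k=1..r. h k * (virtual_cost s f k * X k))
      = (\<Sum>l=1..n. g l * (\<Sum>k=1..r. h k * (virtual_cost s f k * x l k)))"
    unfolding X_def sum_distrib_left by (subst sum.swap) (simp add: mult_ac)
  have "(\<Sum>l=1..n. g l * Dr r (\<lambda>k l. x l k) l) / F r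
      = (\<Sum>l=1..n. g l * ((\<Sum>k=1..r. h k * ((b l - s k) * x l k))
      + \<alpha> * (b l * Q l - (\<Sum>t=1..<l. (b (Suc t) - b t) * Q t))
      - \<alpha> * (\<Sum>k=1..r. h k * (virtual_cost s f k * x l k))))"
    unfolding D sum_divide_distrib using F by (intro sum.cong) auto
  also have "\<dots> = (\<Sum>l=1..n. g l * (\<Sum>k=1..r. h k * ((b l - s k) * x l k)))
      + \<alpha> * ((\<Sum>l=1..n. g l * (b l * Q l - (\<Sum>t=1..<l. (b (Suc t) - b t) * Q t)))
             - (\<Sum>l=1..n. g l * (\<Sum>k=1..r. h k * (virtual_cost s f k * x l k))))"
    by (rule gen)
  finally show ?thesis
    unfolding X by (simp add: sum_distrib_left mult_ac)
qed

text \<open>Admitting seller r + 1 pays the increment s_{r+1} - s_r, weighted by X_{r+1}, to all r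
  cheaper sellers, whose total mass is F_r. Charged to the mass f_{r+1}, this is the surcharge in
  the virtual cost.\<close>

lemma seller_rent_sum:
  assumes "r \<le> m"
  shows "(\<Sum>k=1..r. f k * (s k * X k + (\<Sum>j=Suc k..r. (s j - s (j - 1)) * X j)))
       = (\<Sum>k=1..r. f k * (virtual_cost s f k * X k))"
  using assms
proof (induction r)
  case (Suc r)
  have "(\<Sum>k=1..Suc r. f k * (s k * X k + (\<Sum>j=Suc k..Suc r. (s j - s (j - 1)) * X j)))
    = (\<Sum>k=1..r. f k * (s k * X k + (\<Sum>j=Suc k..r. (s j - s (j - 1)) * X j)))
      + (\<Sum>k=1..r. f k * ((s (Suc r) - s r) * X (Suc r))) + f (Suc r) * (s (Suc r) * X (Suc r))"
    by (simp add: sum.distrib[symmetric] algebra_simps)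
  also have "(\<Sum>k=1..r. f k * ((s (Suc r) - s r) * X (Suc r))) = F r * ((s (Suc r) - s r) * X (Suc r))"
    by (simp add: cum_def sum_distrib_right)
  also have "(\<Sum>k=1..r. f k * (s k * X k + (\<Sum>j=Suc k..r. (s j - s (j - 1)) * X j)))
      = (\<Sum>k=1..r. f k * (virtual_cost s f k * X k))"
    using Suc by simp
  also have "f (Suc r) * (s (Suc r) * X (Suc r)) = f (Suc r) * (virtual_cost s f (Suc r) * X (Suc r))
      - F r * ((s (Suc r) - s r) * X (Suc r))"
    using f_pos[of "Suc r"] Suc.prems by (cases "r = 0") (auto simp: virtual_cost_def field_simps)
  finally show ?case by simp
qed simp

text \<open>Conditioning on the first r types rescales \<open>F (k - 1)\<close> and
  \<open>f k\<close> alike, so the virtual cost of the full distribution remains the right one at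
  every level.\<close>

lemma seller_payment_sum:
  assumes "r \<le> m"
  shows "(\<Sum>k=1..r. f k / F r * - (s k * X k + (\<Sum>j=Suc k..r. (s j - s (j - 1)) * X j)))
       = - (\<Sum>k=1..r. f k / F r * (virtual_cost s f k * X k))"
proof -
  have "(\<Sum>k=1..r. f k / F r * - (s k * X k + (\<Sum>j=Suc k..r. (s j - s (j - 1)) * X j)))
      = - ((\<Sum>k=1..r. f k * (s k * X k + (\<Sum>j=Suc k..r. (s j - s (j - 1)) * X j))) / F r)"
    unfolding sum_divide_distrib sum_negf[symmetric] by (intro sum.cong refl) (simp del: minus_add_distrib)
  also have "\<dots> = - (\<Sum>k=1..r. f k / F r * (virtual_cost s f k * X k))"
    unfolding seller_rent_sum[OF assms] by (simp add: sum_divide_distrib)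
  finally show ?thesis .
qed

text \<open>Adjacent constraints suffice for the payments: buyer l + 1 does not pose as l, starting
  from participation of buyer 1, and seller k does not pose as k + 1, starting from participation of
  the costliest seller r.\<close>

lemma mechanism_bound:
  assumes r: "r \<in> {1..m}" and g: "\<And>l. l \<in> {1..n} \<Longrightarrow> 0 < g l"
    and bic: "BIC n b g r s (\<lambda>k. f k / F r) x pB pS"
    and iir: "IIR n b g r s (\<lambda>k. f k / F r) x pB pS"
  shows "objective \<alpha> n b g r s (\<lambda>k. f k / F r) x pB pS
           \<le> (\<Sum>l=1..n. g l * Dr r (\<lambda>k l. x l k) l) / F r" (is ?bound)
    and "\<And>l l'. l \<in> {1..n} \<Longrightarrow> l' \<in> {1..n} \<Longrightarrow> l \<le> l' \<Longrightarrow>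
           quantity f r (\<lambda>k l. x l k) l \<le> quantity f r (\<lambda>k l. x l k) l'"
proof -
  define h where "h = (\<lambda>k. f k / F r)"
  have F: "F r > 0" using F_pos r by simp
  have h: "0 < h k" if "k \<in> {1..r}" for k using that r f_pos[of k] F by (auto simp: h_def)
  define Q where "Q = (\<lambda>l. \<Sum>k=1..r. h k * x l k)"
  define P where "P = (\<lambda>l. \<Sum>k=1..r. h k * pB l k)"
  define X where "X = (\<lambda>k. \<Sum>l=1..n. g l * x l k)"
  define R where "R = (\<lambda>k. \<Sum>l=1..n. g l * pS l k)"
  have U: "buyer_utility r h b x pB l l' = b l * Q l' - P l'" for l l'
    by (simp add: buyer_utility_def Q_def P_def sum_distrib_left algebra_simps sum_subtractf)
  have W: "seller_utility n g s x pS k k' = - s k * X k' - R k'" for k k'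
    by (simp add: seller_utility_def X_def R_def sum_distrib_left algebra_simps sum_subtractf sum_negf)
  have bicB: "b l * Q l' - P l' \<le> b l * Q l - P l" if "l \<in> {1..n}" "l' \<in> {1..n}" for l l'
    using bic that by (auto simp: BIC_def h_def[symmetric] U)
  have bicS: "- s k * X k' - R k' \<le> - s k * X k - R k" if "k \<in> {1..r}" "k' \<in> {1..r}" for k k'
    using bic that by (auto simp: BIC_def h_def[symmetric] W)
  have iirB: "0 \<le> b l * Q l - P l" if "l \<in> {1..n}" for l
    using iir that by (auto simp: IIR_def h_def[symmetric] U)
  have iirS: "0 \<le> - s k * X k - R k" if "k \<in> {1..r}" for k
    using iir that by (auto simp: IIR_def h_def[symmetric] W)
  have P: "P l \<le> b l * Q l - (\<Sum>t=1..<l. (b (Suc t) - b t) * Q t)" if "1 \<le> l" "l \<le> n" for l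
    using that
  proof (induction rule: dec_induct)
    case base then show ?case using iirB[of 1] n1 by auto
  next
    case (step l)
    have "P l \<le> b l * Q l - (\<Sum>t=1..<l. (b (Suc t) - b t) * Q t)" using step by auto
    moreover have "b (Suc l) * Q l - P l \<le> b (Suc l) * Q (Suc l) - P (Suc l)"
      using step by (intro bicB) auto
    ultimately show ?case using step by (simp add: algebra_simps)
  qed
  have R: "R k \<le> - (s k * X k + (\<Sum>j=Suc k..r. (s j - s (j - 1)) * X j))" if "k \<le> r" "1 \<le> k" for k
    using that
  proof (induction rule: inc_induct)
    case base then show ?case using iirS[of r] r by auto
  next
    case (step k)
    have "R (Suc k) \<le> - (s (Suc k) * X (Suc k) + (\<Sum>j=Suc (Suc k)..r. (s j - s (j - 1)) * X j))"
      using step by auto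
    moreover have "- s k * X (Suc k) - R (Suc k) \<le> - s k * X k - R k"
      using step by (intro bicS) auto
    moreover have "(\<Sum>j=Suc k..r. (s j - s (j - 1)) * X j)
       = (s (Suc k) - s k) * X (Suc k) + (\<Sum>j=Suc (Suc k)..r. (s j - s (j - 1)) * X j)"
      using step by (subst sum.atLeast_Suc_atMost) auto
    ultimately show ?case by (simp add: algebra_simps)
  qed
  have "objective \<alpha> n b g r s h x pB pS
      = (\<Sum>l=1..n. \<Sum>k=1..r. g l * h k * ((b l - s k) * x l k))
        + \<alpha> * ((\<Sum>l=1..n. g l * P l) + (\<Sum>k=1..r. h k * R k))"
  proof -
    have "(\<Sum>l=1..n. \<Sum>k=1..r. g l * h k * (pB l k + pS l k))
       = (\<Sum>l=1..n. \<Sum>k=1..r. g l * h k * pB l k) + (\<Sum>l=1..n. \<Sum>k=1..r. g l * h k * pS l k)"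
      by (simp add: distrib_left sum.distrib)
    also have "(\<Sum>l=1..n. \<Sum>k=1..r. g l * h k * pS l k) = (\<Sum>k=1..r. h k * R k)"
      unfolding R_def sum_distrib_left by (subst sum.swap) (simp add: mult_ac)
    also have "(\<Sum>l=1..n. \<Sum>k=1..r. g l * h k * pB l k) = (\<Sum>l=1..n. g l * P l)"
      unfolding P_def sum_distrib_left by (simp add: mult_ac)
    finally show ?thesis by (simp add: objective_def)
  qed
  also have "(\<Sum>l=1..n. g l * P l)
      \<le> (\<Sum>l=1..n. g l * (b l * Q l - (\<Sum>t=1..<l. (b (Suc t) - b t) * Q t)))"
    using g P by (intro sum_mono mult_left_mono) (auto intro: less_imp_le)
  also have "(\<Sum>k=1..r. h k * R k)
      \<le> (\<Sum>k=1..r. h k * - (s k * X k + (\<Sum>j=Suc k..r. (s j - s (j - 1)) * X j)))"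
    using h R by (intro sum_mono mult_left_mono) (auto intro: less_imp_le)
  also have "\<dots> = - (\<Sum>k=1..r. h k * (virtual_cost s f k * X k))"
    using seller_payment_sum[of r X] r by (simp only: h_def atLeastAtMost_iff)
  finally have "objective \<alpha> n b g r s h x pB pS
      \<le> (\<Sum>l=1..n. \<Sum>k=1..r. g l * h k * ((b l - s k) * x l k))
      + \<alpha> * ((\<Sum>l=1..n. g l * (b l * Q l - (\<Sum>t=1..<l. (b (Suc t) - b t) * Q t)))
             - (\<Sum>k=1..r. h k * (virtual_cost s f k * X k)))"
    using alpha by (simp add: mult_left_mono)
  then show ?bound
    using virtual_surplus[OF r, of g x] by (simp add: h_def Q_def X_def)
  \<comment> \<open>Adding the two constraints between l and l' cancels the payments; strictness of
    \<open>b\<close> allows division by b_l' - b_l.\<close>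
  have Qm: "Q l \<le> Q l'" if "l \<in> {1..n}" "l' \<in> {1..n}" "l \<le> l'" for l l'
  proof (cases "l = l'")
    case False
    then have "b l < b l'" using that market strict_mono_onD[of "{1..n}" b l l'] by (auto simp: market_def)
    moreover have "(b l' - b l) * Q l \<le> (b l' - b l) * Q l'"
      using bicB[of l l'] bicB[of l' l] that by (simp add: algebra_simps)
    ultimately show ?thesis by simp
  qed simp
  have "quantity f r (\<lambda>k l. x l k) l = F r * Q l" for l
    using F by (simp add: quantity_def Q_def h_def sum_distrib_left)
  then show "quantity f r (\<lambda>k l. x l k) l \<le> quantity f r (\<lambda>k l. x l k) l'"
    if "l \<in> {1..n}" "l' \<in> {1..n}" "l \<le> l'" for l l'
    using Qm[OF that] F by simp
qed

text \<open>The payments leave every type exactly the envelope rent for each single report of the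
  other side. Cellwise monotonicity of \<open>z\<close> makes both incentive constraints hold report
  by report, hence in expectation.\<close>

lemma mechanism_attains:
  assumes r: "r \<in> {1..m}" and g: "\<And>l. l \<in> {1..n} \<Longrightarrow> 0 < g l" and z: "z \<in> arrays n r"
  shows "(\<Sum>l=1..n. g l * Dr r z l) / F r \<in> mechanism_values \<alpha> n b g r s (\<lambda>k. f k / F r)"
proof -
  define h where "h = (\<lambda>k. f k / F r)"
  have F: "F r > 0" using F_pos r by simp
  have h: "0 \<le> h k" if "k \<in> {1..r}" for k
    using that r f_pos[of k] F by (auto simp: h_def intro: less_imp_le)
  have z01: "0 \<le> z k l \<and> z k l \<le> 1" if "k \<in> {1..r}" "l \<in> {1..n}" for k l
    using z that by (auto simp: arrays_def)
  have zl: "z k l \<le> z k l'" if "k \<in> {1..r}" "l \<in> {1..n}" "l' \<in> {1..n}" "l \<le> l'" for k l l'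
    using z that by (auto simp: arrays_def)
  have zk: "z k' l \<le> z k l" if "k \<in> {1..r}" "k' \<in> {1..r}" "l \<in> {1..n}" "k \<le> k'" for k k' l
    using z that by (auto simp: arrays_def)
  define x where "x = (\<lambda>l k. z k l)"
  define pB where "pB = (\<lambda>l k. b l * z k l - (\<Sum>t=1..<l. (b (Suc t) - b t) * z k t))"
  define pS where "pS = (\<lambda>l k. - (s k * z k l + (\<Sum>j=Suc k..r. (s j - s (j - 1)) * z j l)))"
  have buyer: "b l * x l' k - pB l' k \<le> b l * x l k - pB l k" "0 \<le> b l * x l k - pB l k"
    if "k \<in> {1..r}" "l \<in> {1..n}" "l' \<in> {1..n}" for k l l'
  proof -
    have "(b l - b l') * z k l' + (\<Sum>t=1..<l'. (b (Suc t) - b t) * z k t)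
        \<le> (\<Sum>t=1..<l. (b (Suc t) - b t) * z k t)"
      using that by (intro envelope_global[where n = n]) (auto intro!: b_mono zl)
    then show "b l * x l' k - pB l' k \<le> b l * x l k - pB l k"
      by (simp add: x_def pB_def algebra_simps)
    have "0 \<le> (\<Sum>t=1..<l. (b (Suc t) - b t) * z k t)"
      using that by (intro sum_nonneg mult_nonneg_nonneg) (auto simp: b_mono z01)
    then show "0 \<le> b l * x l k - pB l k" by (simp add: x_def pB_def)
  qed
  have rent: "(\<Sum>j=Suc k..r. (s j - s (j - 1)) * z j l)
      = (\<Sum>j=Suc k'..r. (s j - s (j - 1)) * z j l) + (\<Sum>t=k..<k'. (s (Suc t) - s t) * z (Suc t) l)"
    if "k \<le> k'" "k' \<le> r" for k k' l
    using that
  proof (induction rule: inc_induct)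
    case (step k)
    then show ?case
      by (subst sum.atLeast_Suc_atMost) (auto simp: sum.atLeast_Suc_lessThan)
  qed simp
  have seller: "- s k * x l k' - pS l k' \<le> - s k * x l k - pS l k" "0 \<le> - s k * x l k - pS l k"
    if k: "k \<in> {1..r}" "k' \<in> {1..r}" and l: "l \<in> {1..n}" for k k' l
  proof -
    \<comment> \<open>The cost increment from t to t + 1 is weighted by the trade of the higher cost
      t + 1, and trade falls in the index. So each summand compares with \<open>z k' l\<close>, from
      above if k \<le> k' and from below otherwise.\<close>
    have "(s k' - s k) * z k' l + (\<Sum>j=Suc k'..r. (s j - s (j - 1)) * z j l)
        \<le> (\<Sum>j=Suc k..r. (s j - s (j - 1)) * z j l)"
    proof (cases "k \<le> k'")
      case True
      have "(s k' - s k) * z k' l = (\<Sum>t=k..<k'. (s (Suc t) - s t) * z k' l)"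
        using sum_Suc_diff'[OF True, of s] by (simp flip: sum_distrib_right)
      also have "\<dots> \<le> (\<Sum>t=k..<k'. (s (Suc t) - s t) * z (Suc t) l)"
        using k l r by (intro sum_mono mult_left_mono) (auto intro!: zk s_mono)
      finally show ?thesis using rent[OF True] k by simp
    next
      case False
      have "(\<Sum>t=k'..<k. (s (Suc t) - s t) * z (Suc t) l) \<le> (\<Sum>t=k'..<k. (s (Suc t) - s t) * z k' l)"
        using k l r by (intro sum_mono mult_left_mono) (auto intro!: zk s_mono)
      also have "\<dots> = (s k - s k') * z k' l"
        using sum_Suc_diff'[of k' k s] False by (simp flip: sum_distrib_right)
      finally show ?thesis using rent[of k' k] False k by (simp add: algebra_simps)
    qed
    then show "- s k * x l k' - pS l k' \<le> - s k * x l k - pS l k"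
      by (simp add: x_def pS_def algebra_simps)
    have "0 \<le> (\<Sum>j=Suc k..r. (s j - s (j - 1)) * z j l)"
    proof (intro sum_nonneg mult_nonneg_nonneg)
      fix j assume "j \<in> {Suc k..r}"
      then have "s (j - 1) \<le> s j" "0 \<le> z j l"
        using r k l z01[of j l] by (auto intro!: s_mono)
      then show "0 \<le> s j - s (j - 1)" "0 \<le> z j l" by auto
    qed
    then show "0 \<le> - s k * x l k - pS l k" by (simp add: x_def pS_def)
  qed
  have "BIC n b g r s h x pB pS" "IIR n b g r s h x pB pS"
    unfolding BIC_def IIR_def buyer_utility_def seller_utility_def
    using h g
    by (auto intro!: sum_mono sum_nonneg mult_left_mono mult_nonneg_nonneg buyer[simplified] seller[simplified]
       intro: less_imp_le simp: buyer[simplified] seller[simplified])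
  moreover have "objective \<alpha> n b g r s h x pB pS = (\<Sum>l=1..n. g l * Dr r z l) / F r"
  proof -
    define Q where "Q = (\<lambda>l. \<Sum>k=1..r. h k * x l k)"
    define X where "X = (\<lambda>k. \<Sum>l=1..n. g l * x l k)"
    have 1: "(\<Sum>l=1..n. \<Sum>k=1..r. g l * h k * pB l k)
       = (\<Sum>l=1..n. g l * (b l * Q l - (\<Sum>t=1..<l. (b (Suc t) - b t) * Q t)))"
    proof (intro sum.cong refl)
      fix l
      have "(\<Sum>k=1..r. h k * (\<Sum>t=1..<l. (b (Suc t) - b t) * z k t))
          = (\<Sum>t=1..<l. (b (Suc t) - b t) * Q t)"
        unfolding Q_def sum_distrib_left x_def by (subst sum.swap) (simp add: mult_ac)
      moreover have "(\<Sum>k=1..r. h k * (b l * z k l)) = b l * Q l"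
        by (simp add: Q_def x_def sum_distrib_left mult_ac)
      ultimately have "(\<Sum>k=1..r. h k * pB l k) = b l * Q l - (\<Sum>t=1..<l. (b (Suc t) - b t) * Q t)"
        unfolding pB_def right_diff_distrib[of "h _"] sum_subtractf by simp
      then show "(\<Sum>k=1..r. g l * h k * pB l k) = g l * (b l * Q l - (\<Sum>t=1..<l. (b (Suc t) - b t) * Q t))"
        by (simp only: mult.assoc sum_distrib_left[symmetric])
    qed
    have 2: "(\<Sum>l=1..n. \<Sum>k=1..r. g l * h k * pS l k) = - (\<Sum>k=1..r. h k * (virtual_cost s f k * X k))"
    proof -
      have *: "(\<Sum>l=1..n. g l * pS l k) = - (s k * X k + (\<Sum>j=Suc k..r. (s j - s (j - 1)) * X j))" for k
      proof -
        have "(\<Sum>l=1..n. g l * (\<Sum>j=Suc k..r. (s j - s (j - 1)) * z j l))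
            = (\<Sum>j=Suc k..r. (s j - s (j - 1)) * X j)"
          unfolding X_def sum_distrib_left x_def by (subst sum.swap) (simp add: mult_ac)
        moreover have "(\<Sum>l=1..n. g l * (s k * z k l)) = s k * X k"
          by (simp add: X_def x_def sum_distrib_left mult_ac)
        ultimately show ?thesis
          unfolding pS_def mult_minus_right sum_negf distrib_left[of "g _"] sum.distrib by simp
      qed
      have "(\<Sum>l=1..n. \<Sum>k=1..r. g l * h k * pS l k) = (\<Sum>k=1..r. h k * (\<Sum>l=1..n. g l * pS l k))"
        unfolding sum_distrib_left by (subst sum.swap) (simp add: mult_ac)
      also have "\<dots> = - (\<Sum>k=1..r. h k * (virtual_cost s f k * X k))"
        using seller_payment_sum[of r X] r by (simp only: * h_def atLeastAtMost_iff)
      finally show ?thesis .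
    qed
    show ?thesis
      using virtual_surplus[OF r, of g x] 1 2
      by (simp add: objective_def distrib_left sum.distrib h_def Q_def X_def x_def)
  qed
  ultimately show ?thesis
    unfolding mechanism_values_def h_def[symmetric] using z01
    by (intro CollectI exI[of _ x] exI[of _ pB] exI[of _ pS]) (auto simp: x_def)
qed

section \<open>Attainment of the maximum by compactness\<close>

lemma arrays_attain_max:
  assumes "r \<in> {1..m}"
  obtains z where "z \<in> arrays n r"
    "\<And>z'. z' \<in> arrays n r \<Longrightarrow> (\<Sum>l=1..n. g l * Dr r z' l) \<le> (\<Sum>l=1..n. g l * Dr r z l)"
proof -
  \<comment> \<open>Arrays are total functions with free values outside the index ranges. Confining
    all coordinates to [0, 1] makes the product compact, while membership in
    \<open>arrays n r\<close> is a closed condition.\<close>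
  define B where "B = {z :: nat \<Rightarrow> nat \<Rightarrow> real. \<forall>k l. z k l \<in> {0..1}}"
  have row: "compact {u :: nat \<Rightarrow> real. \<forall>l. u l \<in> {0..1}}"
    using compactin_PiE[of "\<lambda>_. euclidean" UNIV "\<lambda>_. {0..1::real}"]
    by (simp add: euclidean_product_topology PiE_UNIV_domain Pi_def)
  have "compact B"
    using compactin_PiE[of "\<lambda>_. euclidean" UNIV "\<lambda>_::nat. {u :: nat \<Rightarrow> real. \<forall>l. u l \<in> {0..1}}"] row
    by (simp add: euclidean_product_topology PiE_UNIV_domain Pi_def B_def)
  have cont: "continuous_on UNIV (\<lambda>z :: nat \<Rightarrow> nat \<Rightarrow> real. z k l)" for k l
    using continuous_on_compose2[OF continuous_on_product_coordinates[of l]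
        continuous_on_product_coordinates[of k]] by auto
  have "arrays n r = (\<Inter>k\<in>{1..r}. \<Inter>l\<in>{1..n}. {z. 0 \<le> z k l} \<inter> {z. z k l \<le> 1}) \<inter>
     (\<Inter>k\<in>{1..r}. \<Inter>k'\<in>{1..r}. \<Inter>l\<in>{1..n}. {z. k \<le> k' \<longrightarrow> z k' l \<le> z k l}) \<inter>
     (\<Inter>k\<in>{1..r}. \<Inter>l\<in>{1..n}. \<Inter>l'\<in>{1..n}. {z. l \<le> l' \<longrightarrow> z k l \<le> z k l'}) \<inter>
     (\<Inter>k\<in>{r<..}. \<Inter>l\<in>{1..n}. {z. z k l = 0})"
    by (auto simp: arrays_def)
  also have "closed \<dots>"
    by (intro closed_Int closed_INT ballI closed_Collect_imp closed_Collect_le closed_Collect_eq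
        cont continuous_on_const) auto
  finally have "closed (arrays n r)" .
  then have comp: "compact (B \<inter> arrays n r)" using \<open>compact B\<close> by (intro compact_Int_closed)
  have cD: "continuous_on (B \<inter> arrays n r) (\<lambda>z. \<Sum>l=1..n. g l * Dr r z l)"
    unfolding D_def
    by (intro continuous_intros continuous_on_subset[OF cont]) auto
  have "(\<lambda>_ _. 0) \<in> B \<inter> arrays n r" by (auto simp: B_def arrays_def)
  then have "B \<inter> arrays n r \<noteq> {}" by blast
  from continuous_attains_sup[OF comp this cD] obtain z where z: "z \<in> B \<inter> arrays n r"
    "\<And>z'. z' \<in> B \<inter> arrays n r \<Longrightarrow> (\<Sum>l=1..n. g l * Dr r z' l) \<le> (\<Sum>l=1..n. g l * Dr r z l)"
    by auto
  show ?thesis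
  proof (rule that[of z])
    fix z' assume z': "z' \<in> arrays n r"
    \<comment> \<open>Resetting the free coordinates to 0 moves an arbitrary array into the compact
      set without changing the objective.\<close>
    define z'' where "z'' = (\<lambda>k l. if k \<in> {1..r} \<and> l \<in> {1..n} then z' k l else 0)"
    have "z'' \<in> B \<inter> arrays n r" using z' by (auto simp: z''_def B_def arrays_def)
    moreover have "(\<Sum>l=1..n. g l * Dr r z'' l) = (\<Sum>l=1..n. g l * Dr r z' l)"
      unfolding D_def by (intro sum.cong refl arg_cong2[where f = "(*)"] arg_cong2[where f = "(-)"])
        (auto simp: z''_def)
    ultimately show "(\<Sum>l=1..n. g l * Dr r z' l) \<le> (\<Sum>l=1..n. g l * Dr r z l)"
      using z(2)[of z''] by simp
  qed (use z in auto)
qed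

text \<open>From above, the trade table of a mechanism is replaced by the filling of its monotone
  expected quantities, which is an array. From below, a maximizing array is implemented by a
  mechanism. Together they also show that the greatest value exists.\<close>

lemma V_attained:
  assumes r: "r \<in> {1..m}" and g: "\<And>l. l \<in> {1..n} \<Longrightarrow> 0 < g l"
  obtains z where "z \<in> arrays n r" "F r * V \<alpha> n b g s f r = (\<Sum>l=1..n. g l * Dr r z l)"
    "\<And>z'. z' \<in> arrays n r \<Longrightarrow> (\<Sum>l=1..n. g l * Dr r z' l) \<le> F r * V \<alpha> n b g s f r"
proof -
  obtain z where z: "z \<in> arrays n r"
    "\<And>z'. z' \<in> arrays n r \<Longrightarrow> (\<Sum>l=1..n. g l * Dr r z' l) \<le> (\<Sum>l=1..n. g l * Dr r z l)"
    using arrays_attain_max[OF r] by metis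
  have F: "F r > 0" using F_pos r by simp
  have "V \<alpha> n b g s f r = (\<Sum>l=1..n. g l * Dr r z l) / F r"
    unfolding V_def bilateral_value_def
  proof (rule Greatest_equality)
    show "(\<Sum>l=1..n. g l * Dr r z l) / F r \<in> mechanism_values \<alpha> n b g r s (\<lambda>k. f k / F r)"
      by (intro mechanism_attains r g z)
    fix y assume "y \<in> mechanism_values \<alpha> n b g r s (\<lambda>k. f k / F r)"
    then obtain x pB pS where y: "y = objective \<alpha> n b g r s (\<lambda>k. f k / F r) x pB pS"
      "\<forall>l\<in>{1..n}. \<forall>k\<in>{1..r}. 0 \<le> x l k \<and> x l k \<le> 1"
      "BIC n b g r s (\<lambda>k. f k / F r) x pB pS" "IIR n b g r s (\<lambda>k. f k / F r) x pB pS"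
      by (auto simp: mechanism_values_def)
    let ?q = "quantity f r (\<lambda>k l. x l k)"
    note bound = mechanism_bound[OF r g y(3,4)]
    have "(\<Sum>l=1..n. g l * Dr r (\<lambda>k l. x l k) l) \<le> (\<Sum>l=1..n. g l * Dr r (fill_array r ?q) l)"
      using r g y(2) by (intro sum_mono mult_left_mono D_le_fill) (auto intro: less_imp_le)
    also have "\<dots> \<le> (\<Sum>l=1..n. g l * Dr r z l)"
      using r bound(2) by (intro z(2) fill_array_arrays) auto
    finally show "y \<le> (\<Sum>l=1..n. g l * Dr r z l) / F r"
      using bound(1) y(1) F by (meson divide_right_mono less_imp_le order_trans)
  qed
  then have "F r * V \<alpha> n b g s f r = (\<Sum>l=1..n. g l * Dr r z l)" using F by simp
  then show ?thesis using that z by metis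
qed

end

section \<open>The least chain of levels\<close>

context trade
begin

definition lower_bounds :: "nat \<Rightarrow> (nat \<Rightarrow> real) \<Rightarrow> real \<Rightarrow> nat \<Rightarrow> real set" where
  "lower_bounds r c S l = (\<lambda>j. (c l - K j + S) / (\<beta> l - d j)) ` {j \<in> {1..r}. d j < \<beta> l}"

text \<open>The first component accumulates the rent term of the inequalities, the second is the
  level. Stage 0 is a dummy type of level 0: it supplies q_1 \<ge> 0, and it multiplies the
  meaningless increment \<open>b 1 - b 0\<close> by 0.\<close>

primrec chain :: "nat \<Rightarrow> (nat \<Rightarrow> real) \<Rightarrow> nat \<Rightarrow> real \<times> real" where
  "chain r c 0 = (0, 0)"
| "chain r c (Suc l) =
    (let S = fst (chain r c l) + \<alpha> * ((b (Suc l) - b l) * snd (chain r c l))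
     in (S, Max (insert (snd (chain r c l)) (lower_bounds r c S (Suc l)))))"

abbreviation "level r c l \<equiv> snd (chain r c l)"

lemma finite_lower_bounds [simp]: "finite (lower_bounds r c S l)"
  by (simp add: lower_bounds_def)

lemma fst_chain: "fst (chain r c l) = \<alpha> * (\<Sum>t=1..<l. (b (Suc t) - b t) * level r c t)"
proof (induction l)
  case (Suc l)
  then show ?case by (cases l) (auto simp: Let_def algebra_simps)
qed simp

lemma level_mono_Suc: "level r c l \<le> level r c (Suc l)"
  by (simp add: Let_def)

lemma level_mono: "l \<le> l' \<Longrightarrow> level r c l \<le> level r c l'"
  using lift_Suc_mono_le[of "level r c"] level_mono_Suc by blast

lemma level_nonneg: "0 \<le> level r c l"
  using level_mono[of 0 l r c] by simp

lemma level_lower_bound: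
  assumes "1 \<le> l" "j \<in> {1..r}" "d j < \<beta> l"
  shows "(c l - K j + fst (chain r c l)) / (\<beta> l - d j) \<le> level r c l"
proof -
  obtain l' where l: "l = Suc l'" using assms by (cases l) auto
  have "(c l - K j + fst (chain r c l)) / (\<beta> l - d j) \<in> lower_bounds r c (fst (chain r c l)) l"
    using assms by (auto simp: lower_bounds_def)
  then show ?thesis unfolding l by (simp add: Let_def)
qed

lemma level_cases:
  obtains "level r c (Suc l) = level r c l"
  | j where "j \<in> {1..r}" "d j < \<beta> (Suc l)"
    "level r c (Suc l) = (c (Suc l) - K j + fst (chain r c (Suc l))) / (\<beta> (Suc l) - d j)"
proof -
  let ?B = "insert (level r c l) (lower_bounds r c (fst (chain r c (Suc l))) (Suc l))"
  have "level r c (Suc l) = Max ?B" by (simp add: Let_def)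
  moreover have "Max ?B \<in> ?B" by (intro Max_in) auto
  ultimately show ?thesis using that by (auto simp: lower_bounds_def)
qed

declare chain.simps(2) [simp del]

text \<open>Linear programming duality for the chain, made explicit: every price vector \<open>w\<close> on the
  quantities is passed backwards, from a tight lower bound to the multiplier of that target, and
  from a tie with the previous buyer type to the price of that type.\<close>

lemma certificate:
  assumes r: "r \<in> {1..m}" and "l \<le> n" and "\<And>i. i \<in> {1..l} \<Longrightarrow> 0 \<le> w i"
  shows "\<exists>g. (\<forall>i. 0 \<le> g i) \<and> (\<forall>y\<in>arrays n r.
     (\<Sum>i=1..l. g i * (Dr r y i - c i)) \<le> (\<Sum>i=1..l. w i * (quantity f r y i - level r c i)))"
  using assms(2,3)
proof (induction l arbitrary: w)
  case 0
  show ?case by (intro exI[of _ "\<lambda>_. 0"]) auto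
next
  case (Suc l)
  note w = Suc.prems(2)
  consider "level r c (Suc l) = level r c l" "l = 0" | "level r c (Suc l) = level r c l" "1 \<le> l"
    | j where "j \<in> {1..r}" "d j < \<beta> (Suc l)"
      "level r c (Suc l) = (c (Suc l) - K j + fst (chain r c (Suc l))) / (\<beta> (Suc l) - d j)"
  proof (cases rule: level_cases[of r c l])
    case 1
    then show ?thesis using that(1,2) by (cases "l = 0") auto
  next
    case (2 j)
    then show ?thesis by (rule that(3))
  qed
  then show ?case
  proof cases
    case 1
    \<comment> \<open>A tie with the dummy stage: the level is 0, and nonnegativity of the quantity
      replaces a target, so all weights are 0.\<close>
    have "0 \<le> quantity f r y 1" if "y \<in> arrays n r" for y
      using that r n1 by (intro quantity_bounds) (auto simp: arrays_def)
    with 1 w[of 1] show ?thesis by (intro exI[of _ "\<lambda>_. 0"]) auto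
  next
    case 2
    define w' where "w' = w(l := w l + w (Suc l))"
    have "\<And>i. i \<in> {1..l} \<Longrightarrow> 0 \<le> w' i" using w by (auto simp: w'_def)
    then obtain g where g: "\<forall>i. 0 \<le> g i" and gy: "\<And>y. y \<in> arrays n r \<Longrightarrow>
       (\<Sum>i=1..l. g i * (Dr r y i - c i)) \<le> (\<Sum>i=1..l. w' i * (quantity f r y i - level r c i))"
      using Suc.IH[of w'] Suc.prems by auto
    show ?thesis
    proof (intro exI[of _ "g(Suc l := 0)"] conjI ballI)
      show "\<forall>i. 0 \<le> (g(Suc l := 0)) i" using g by simp
      fix y assume y: "y \<in> arrays n r"
      have "(\<Sum>i=1..Suc l. (g(Suc l := 0)) i * (Dr r y i - c i)) = (\<Sum>i=1..l. g i * (Dr r y i - c i))"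
        by simp
      also have "\<dots> \<le> (\<Sum>i=1..l. w' i * (quantity f r y i - level r c i))"
        using gy[OF y] .
      also have "\<dots> = (\<Sum>i=1..l. w i * (quantity f r y i - level r c i)
          + (if i = l then w (Suc l) * (quantity f r y l - level r c l) else 0))"
        by (intro sum.cong) (auto simp: w'_def algebra_simps)
      also have "\<dots> = (\<Sum>i=1..l. w i * (quantity f r y i - level r c i))
          + w (Suc l) * (quantity f r y l - level r c l)"
        using 2 by (simp add: sum.distrib)
      also have "w (Suc l) * (quantity f r y l - level r c l)
          \<le> w (Suc l) * (quantity f r y (Suc l) - level r c (Suc l))"
        using 2 quantity_mono[OF _ y, of l "Suc l"] r Suc.prems by (intro mult_left_mono) auto
      finally show "(\<Sum>i=1..Suc l. (g(Suc l := 0)) i * (Dr r y i - c i))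
          \<le> (\<Sum>i=1..Suc l. w i * (quantity f r y i - level r c i))"
        by simp
    qed
  next
    case (3 j)
    \<comment> \<open>G is the multiplier of target l + 1 for which the slope of the tight bound
      reproduces the price \<open>w (Suc l)\<close>. The rent term of that bound then adds G
      \<alpha> \<Delta>_i to the price of each earlier type i.\<close>
    define G where "G = w (Suc l) / (\<beta> (Suc l) - d j)"
    have G: "0 \<le> G" "G * (\<beta> (Suc l) - d j) = w (Suc l)" using w[of "Suc l"] 3 by (auto simp: G_def)
    define w' where "w' = (\<lambda>i. w i + G * \<alpha> * (b (Suc i) - b i))"
    have "0 \<le> w' i" if "i \<in> {1..l}" for i
      using that w[of i] G alpha b_mono[of i "Suc i"] Suc.prems by (auto simp: w'_def)
    then obtain g where g: "\<forall>i. 0 \<le> g i" and gy: "\<And>y. y \<in> arrays n r \<Longrightarrow>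
       (\<Sum>i=1..l. g i * (Dr r y i - c i)) \<le> (\<Sum>i=1..l. w' i * (quantity f r y i - level r c i))"
      using Suc.IH[of w'] Suc.prems by auto
    show ?thesis
    proof (intro exI[of _ "g(Suc l := G)"] conjI ballI)
      show "\<forall>i. 0 \<le> (g(Suc l := G)) i" using g G by simp
      fix y assume y: "y \<in> arrays n r"
      let ?p = "quantity f r y" and ?q = "level r c"
      have D: "Dr r y (Suc l) \<le> (\<beta> (Suc l) - d j) * ?p (Suc l) + K j
         - \<alpha> * (\<Sum>t=1..<Suc l. (b (Suc t) - b t) * ?p t)"
        using y r 3 Suc.prems by (intro D_le) (auto simp: arrays_def)
      have c: "c (Suc l) = (\<beta> (Suc l) - d j) * ?q (Suc l) + K j
         - \<alpha> * (\<Sum>t=1..<Suc l. (b (Suc t) - b t) * ?q t)"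
        using 3 unfolding fst_chain by (simp add: field_simps del: sum.op_ivl_Suc)
      have *: "Dr r y (Suc l) - c (Suc l) \<le> (\<beta> (Suc l) - d j) * (?p (Suc l) - ?q (Suc l))
         - \<alpha> * (\<Sum>t=1..<Suc l. (b (Suc t) - b t) * (?p t - ?q t))"
        using D c by (simp add: right_diff_distrib sum_subtractf del: sum.op_ivl_Suc)
      have aux: "G * (A * x - Y) = G * A * x - G * Y" for A x Y :: real
        by (simp add: algebra_simps)
      from * have "G * (Dr r y (Suc l) - c (Suc l)) \<le> G * ((\<beta> (Suc l) - d j) * (?p (Suc l) - ?q (Suc l))
         - \<alpha> * (\<Sum>t=1..<Suc l. (b (Suc t) - b t) * (?p t - ?q t)))"
        using G by (intro mult_left_mono)
      also have "\<dots> = w (Suc l) * (?p (Suc l) - ?q (Suc l))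
         - (\<Sum>t=1..l. G * \<alpha> * (b (Suc t) - b t) * (?p t - ?q t))"
        unfolding G(2)[symmetric] aux[of "\<beta> (Suc l) - d j"]
        by (simp add: sum_distrib_left atLeastLessThanSuc_atLeastAtMost mult.assoc)
      finally have "G * (Dr r y (Suc l) - c (Suc l)) \<le> \<dots>" .
      moreover have "(\<Sum>i=1..l. w' i * (?p i - ?q i)) = (\<Sum>i=1..l. w i * (?p i - ?q i))
         + (\<Sum>t=1..l. G * \<alpha> * (b (Suc t) - b t) * (?p t - ?q t))"
        by (simp add: w'_def algebra_simps flip: sum.distrib)
      ultimately show "(\<Sum>i=1..Suc l. (g(Suc l := G)) i * (Dr r y i - c i))
          \<le> (\<Sum>i=1..Suc l. w i * (?p i - ?q i))"
        using gy[OF y] by simp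
    qed
  qed
qed

text \<open>Adding \<delta> to every weight and normalizing makes the weights admissible for the
  value condition. Since \<open>B\<close> bounds the sum of all gaps D_l - c_l over all arrays, the
  choice \<delta> = e / (2 (B + 1)) costs less than the margin e.\<close>

lemma no_certificate:
  assumes r: "r \<in> {1..m}"
    and val: "\<And>g. (\<And>l. l \<in> {1..n} \<Longrightarrow> 0 < g l) \<Longrightarrow> (\<Sum>l=1..n. g l) = 1 \<Longrightarrow>
      \<exists>y\<in>arrays n r. (\<Sum>l=1..n. g l * c l) \<le> (\<Sum>l=1..n. g l * Dr r y l)"
    and g: "\<And>l. 0 \<le> g l" and e: "0 < e"
    and neg: "\<And>y. y \<in> arrays n r \<Longrightarrow> (\<Sum>l=1..n. g l * (Dr r y l - c l)) \<le> - e"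
  shows False
proof -
  define B where "B = (\<Sum>l=1..n. \<bar>\<beta> l - d 1\<bar> * F r + \<bar>K 1\<bar> + \<bar>c l\<bar>)"
  have F: "F r > 0" using F_pos r by simp
  have B0: "0 \<le> B" unfolding B_def using F by (intro sum_nonneg) auto
  have B: "(\<Sum>l=1..n. Dr r y l - c l) \<le> B" if y: "y \<in> arrays n r" for y
    unfolding B_def
  proof (intro sum_mono)
    fix l assume l: "l \<in> {1..n}"
    have p: "0 \<le> quantity f r y t \<and> quantity f r y t \<le> F r" if "t \<in> {1..l}" for t
      using that l y r by (intro conjI quantity_bounds) (auto simp: arrays_def)
    have "Dr r y l \<le> (\<beta> l - d 1) * quantity f r y l + K 1
        - \<alpha> * (\<Sum>t=1..<l. (b (Suc t) - b t) * quantity f r y t)"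
      using y r l by (intro D_le) (auto simp: arrays_def)
    moreover have "0 \<le> \<alpha> * (\<Sum>t=1..<l. (b (Suc t) - b t) * quantity f r y t)"
      using alpha p l by (intro mult_nonneg_nonneg sum_nonneg) (auto simp: b_mono)
    moreover have "(\<beta> l - d 1) * quantity f r y l \<le> \<bar>\<beta> l - d 1\<bar> * F r"
      using p[of l] l by (intro mult_mono) auto
    ultimately show "Dr r y l - c l \<le> \<bar>\<beta> l - d 1\<bar> * F r + \<bar>K 1\<bar> + \<bar>c l\<bar>" by linarith
  qed
  define \<delta> where "\<delta> = e / (2 * (B + 1))"
  have \<delta>: "0 < \<delta>" "\<delta> * B < e" using e B0 by (auto simp: \<delta>_def field_simps add_nonneg_pos)
  define T where "T = (\<Sum>l=1..n. g l + \<delta>)"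
  have T: "0 < T" unfolding T_def using n1 \<delta> g by (intro sum_pos) (auto intro: add_nonneg_pos)
  have "\<exists>y\<in>arrays n r. (\<Sum>l=1..n. (g l + \<delta>) / T * c l) \<le> (\<Sum>l=1..n. (g l + \<delta>) / T * Dr r y l)"
  proof (rule val)
    show "0 < (g l + \<delta>) / T" for l using T \<delta> g[of l] by (intro divide_pos_pos add_nonneg_pos)
    have "(\<Sum>l=1..n. (g l + \<delta>) / T) = T / T" unfolding T_def sum_divide_distrib ..
    then show "(\<Sum>l=1..n. (g l + \<delta>) / T) = 1" using T by simp
  qed
  then obtain y where y: "y \<in> arrays n r"
    "(\<Sum>l=1..n. (g l + \<delta>) / T * c l) \<le> (\<Sum>l=1..n. (g l + \<delta>) / T * Dr r y l)" by blast
  then have "0 \<le> (\<Sum>l=1..n. (g l + \<delta>) / T * (Dr r y l - c l))"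
    by (simp add: right_diff_distrib sum_subtractf)
  also have "\<dots> = (\<Sum>l=1..n. (g l + \<delta>) * (Dr r y l - c l)) / T"
    by (simp add: sum_divide_distrib)
  finally have "0 \<le> (\<Sum>l=1..n. (g l + \<delta>) * (Dr r y l - c l))"
    using T by (simp add: zero_le_divide_iff)
  also have "\<dots> = (\<Sum>l=1..n. g l * (Dr r y l - c l)) + \<delta> * (\<Sum>l=1..n. Dr r y l - c l)"
    unfolding sum_distrib_left sum.distrib[symmetric] by (intro sum.cong) (auto simp: distrib_right)
  also have "\<dots> \<le> - e + \<delta> * B"
    using neg[OF y(1)] B[OF y(1)] \<delta> by (intro add_mono mult_left_mono) auto
  finally show False using \<delta> by simp
qed

text \<open>Inequalities of positive slope hold by construction of the levels. A violation of the
  capacity F_r or of an inequality of nonpositive slope is turned into prices \<open>w\<close> whose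
  certificate falls short by the size of the violation.\<close>

lemma chain_feasible:
  assumes r: "r \<in> {1..m}"
    and val: "\<And>g. (\<And>l. l \<in> {1..n} \<Longrightarrow> 0 < g l) \<Longrightarrow> (\<Sum>l=1..n. g l) = 1 \<Longrightarrow>
      \<exists>y\<in>arrays n r. (\<Sum>l=1..n. g l * c l) \<le> (\<Sum>l=1..n. g l * Dr r y l)"
    and l: "l \<in> {1..n}"
  shows "level r c l \<le> F r"
    and "j \<in> {1..r} \<Longrightarrow> c l \<le> (\<beta> l - d j) * level r c l + K j - fst (chain r c l)"
proof -
  have extend: "(\<Sum>i=1..n. (if i \<le> l then u i else 0) * v i) = (\<Sum>i=1..l. u i * v i)" for u v :: "nat \<Rightarrow> real"
    using l by (intro sum.mono_neutral_cong_right) auto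
  show "level r c l \<le> F r"
  proof (rule ccontr)
    assume neg: "\<not> level r c l \<le> F r"
    define w where "w = (\<lambda>i. if i = l then 1 else (0::real))"
    have "\<And>i. i \<in> {1..l} \<Longrightarrow> 0 \<le> w i" by (simp add: w_def)
    then obtain g where g: "\<forall>i. 0 \<le> g i" and gy: "\<And>y. y \<in> arrays n r \<Longrightarrow>
       (\<Sum>i=1..l. g i * (Dr r y i - c i)) \<le> (\<Sum>i=1..l. w i * (quantity f r y i - level r c i))"
      using certificate[OF r, of l w c] l by auto
    show False
    proof (rule no_certificate[OF r val, of "\<lambda>i. if i \<le> l then g i else 0" "level r c l - F r"])
      fix y assume y: "y \<in> arrays n r"
      have "quantity f r y l \<le> F r" using y r l by (intro quantity_bounds) (auto simp: arrays_def)
      moreover have "(\<Sum>i=1..l. w i * (quantity f r y i - level r c i)) = quantity f r y l - level r c l"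
        using l by (simp add: w_def if_distrib[of "\<lambda>x. x * _"] cong: if_cong)
      ultimately show "(\<Sum>i=1..n. (if i \<le> l then g i else 0) * (Dr r y i - c i)) \<le> - (level r c l - F r)"
        using gy[OF y] unfolding extend by linarith
    qed (use g neg in auto)
  qed
  assume j: "j \<in> {1..r}"
  show "c l \<le> (\<beta> l - d j) * level r c l + K j - fst (chain r c l)"
  proof (cases "d j < \<beta> l")
    case True
    then show ?thesis using level_lower_bound[of l j r c] l j by (auto simp: field_simps)
  next
    case False
    show ?thesis
    proof (rule ccontr)
      assume neg: "\<not> c l \<le> (\<beta> l - d j) * level r c l + K j - fst (chain r c l)"
      \<comment> \<open>The prices are the coefficients with which the quantities enter the violated
        inequality, with reversed sign. Target l itself then gets additional weight 1, and in the
        sum with the bound on \<open>Dr r y l\<close> all quantities of \<open>y\<close>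
        cancel.\<close>
      define w where "w = (\<lambda>i. if i = l then d j - \<beta> l else \<alpha> * (b (Suc i) - b i))"
      have "0 \<le> w i" if "i \<in> {1..l}" for i
        using that False alpha b_mono[of i "Suc i"] l by (auto simp: w_def)
      then obtain g where g: "\<forall>i. 0 \<le> g i" and gy: "\<And>y. y \<in> arrays n r \<Longrightarrow>
         (\<Sum>i=1..l. g i * (Dr r y i - c i)) \<le> (\<Sum>i=1..l. w i * (quantity f r y i - level r c i))"
        using certificate[OF r, of l w c] l by auto
      define g' where "g' = (\<lambda>i. if i = l then g i + 1 else g i)"
      show False
      proof (rule no_certificate[OF r val, of "\<lambda>i. if i \<le> l then g' i else 0"
            "c l - ((\<beta> l - d j) * level r c l + K j - fst (chain r c l))"])
        fix y assume y: "y \<in> arrays n r"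
        let ?p = "quantity f r y" and ?q = "level r c"
        have D: "Dr r y l \<le> (\<beta> l - d j) * ?p l + K j - \<alpha> * (\<Sum>t=1..<l. (b (Suc t) - b t) * ?p t)"
          using y r j l by (intro D_le) (auto simp: arrays_def)
        have 1: "(\<Sum>i=1..l. g' i * (Dr r y i - c i)) = (\<Sum>i=1..l. g i * (Dr r y i - c i)) + (Dr r y l - c l)"
        proof -
          have "(\<Sum>i=1..l. g' i * (Dr r y i - c i))
             = (\<Sum>i=1..l. g i * (Dr r y i - c i) + (if i = l then Dr r y l - c l else 0))"
            by (intro sum.cong) (auto simp: g'_def algebra_simps)
          then show ?thesis using l by (simp add: sum.distrib)
        qed
        have 2: "(\<Sum>i=1..l. w i * (?p i - ?q i))
            = (\<Sum>i=1..<l. \<alpha> * (b (Suc i) - b i) * (?p i - ?q i)) + (d j - \<beta> l) * (?p l - ?q l)"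
        proof -
          obtain l' where l': "l = Suc l'" using l by (cases l) auto
          show ?thesis unfolding l' atLeastLessThanSuc_atLeastAtMost by (simp add: w_def l')
        qed
        have 3: "(\<Sum>i=1..<l. \<alpha> * (b (Suc i) - b i) * (?p i - ?q i))
            = \<alpha> * (\<Sum>t=1..<l. (b (Suc t) - b t) * ?p t) - fst (chain r c l)"
          unfolding fst_chain
          by (simp add: sum_distrib_left right_diff_distrib[symmetric] mult.assoc flip: sum_subtractf)
        have "(\<Sum>i=1..l. g' i * (Dr r y i - c i))
            \<le> (\<Sum>i=1..l. w i * (?p i - ?q i)) + (Dr r y l - c l)"
          unfolding 1 using gy[OF y] by simp
        also have "\<dots> \<le> - (c l - ((\<beta> l - d j) * ?q l + K j - fst (chain r c l)))"
          unfolding 2 3 using D by (simp add: algebra_simps)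
        finally show "(\<Sum>i=1..n. (if i \<le> l then g' i else 0) * (Dr r y i - c i))
            \<le> - (c l - ((\<beta> l - d j) * ?q l + K j - fst (chain r c l)))"
          unfolding extend .
      qed (use g neg in \<open>auto simp: g'_def\<close>)
    qed
  qed
qed

text \<open>Raising r only adds candidates to the maximum, and every candidate increases with its
  target and with the accumulated rent. So it suffices to compare the tight candidate j at r with
  the same j at r'.\<close>

lemma chain_mono:
  assumes "r \<le> r'" "\<And>l. l \<in> {1..n} \<Longrightarrow> c l \<le> c' l" "l \<le> n"
  shows "fst (chain r c l) \<le> fst (chain r' c' l) \<and> level r c l \<le> level r' c' l"
  using assms(3)
proof (induction l)
  case 0 then show ?case by simp
next
  case (Suc l)
  have S: "fst (chain r c (Suc l)) \<le> fst (chain r' c' (Suc l))"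
  proof (cases "l = 0")
    case False
    then have "b l \<le> b (Suc l)" using Suc.prems by (intro b_mono) auto
    then show ?thesis using Suc alpha
      by (auto simp: Let_def chain.simps(2) intro!: add_mono mult_left_mono)
  qed (simp add: chain.simps(2))
  have "level r c (Suc l) \<le> level r' c' (Suc l)"
  proof (cases rule: level_cases[of r c l])
    case 1
    then show ?thesis using Suc level_mono_Suc[of r' c' l] by simp
  next
    case (2 j)
    have "level r c (Suc l) \<le> (c' (Suc l) - K j + fst (chain r' c' (Suc l))) / (\<beta> (Suc l) - d j)"
      unfolding 2(3) using S assms(2)[of "Suc l"] Suc.prems 2(2)
      by (intro divide_right_mono) auto
    also have "\<dots> \<le> level r' c' (Suc l)"
      using 2 assms(1) by (intro level_lower_bound) auto
    finally show ?thesis .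
  qed
  with S show ?case by simp
qed

section \<open>The two implications of the equivalence\<close>

lemma targets_mono:
  assumes "targets n m C" "l \<in> {1..n}" "r \<le> r'" "r' \<le> m"
  shows "C r l \<le> C r' l"
  using assms(3,4)
proof (induction rule: dec_induct)
  case (step i)
  then have "C i l \<le> C (Suc i) l" using assms by (auto simp: targets_def)
  then show ?case using step by simp
qed simp

theorem value_condition_imp_nested_family:
  assumes C: "targets n m C" and V: "value_condition \<alpha> n b m s f C"
  shows "nested_family \<alpha> n b m s f C (\<lambda>r. fill_array r (level r (C r)))"
proof -
  have val: "\<exists>y\<in>arrays n r. (\<Sum>l=1..n. g l * C r l) \<le> (\<Sum>l=1..n. g l * Dr r y l)"
    if g: "r \<in> {1..m}" "\<And>l. l \<in> {1..n} \<Longrightarrow> 0 < g l" "(\<Sum>l=1..n. g l) = 1" for r and g :: "nat \<Rightarrow> real"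
  proof -
    obtain z where "z \<in> arrays n r" "F r * V \<alpha> n b g s f r = (\<Sum>l=1..n. g l * Dr r z l)"
      by (rule V_attained[OF g(1,2)])
    moreover have "(\<Sum>l=1..n. g l * C r l) \<le> F r * V \<alpha> n b g s f r"
      using V g unfolding value_condition_def by blast
    ultimately show ?thesis by (intro bexI[of _ z]) simp
  qed
  have le_F: "level r (C r) l \<le> F r" if "r \<in> {1..m}" "l \<in> {1..n}" for r l
    using chain_feasible(1)[of r "C r", OF that(1) val[OF that(1)] that(2)] by blast
  have le_D: "C r l \<le> (\<beta> l - d j) * level r (C r) l + K j - fst (chain r (C r) l)"
    if "r \<in> {1..m}" "l \<in> {1..n}" "j \<in> {1..r}" for r l j
    using chain_feasible(2)[of r "C r", OF that(1) val[OF that(1)] that(2,3)] by blast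
  show ?thesis
    unfolding nested_family_def
  proof (intro conjI ballI impI)
    fix r assume r: "r \<in> {1..m}"
    then show "fill_array r (level r (C r)) \<in> arrays n r"
      by (intro fill_array_arrays level_mono) auto
    fix l assume l: "l \<in> {1..n}"
    have "\<exists>j\<in>{1..r}. Dr r (fill_array r (level r (C r))) l = (\<beta> l - d j) * level r (C r) l + K j
        - \<alpha> * (\<Sum>t=1..<l. (b (Suc t) - b t) * level r (C r) t)"
      using r l by (intro D_fill_array) (auto intro!: level_nonneg le_F)
    then show "C r l \<le> Dr r (fill_array r (level r (C r))) l"
      using le_D[OF r l] by (auto simp: fst_chain)
  next
    fix r r' k l assume r: "r \<in> {1..m}" "r' \<in> {1..m}" "r \<le> r'" "k \<in> {1..m}" "l \<in> {1..n}"
    have "level r (C r) l \<le> level r' (C r') l"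
      using chain_mono[of r r' "C r" "C r'" l] targets_mono[OF C] r by auto
    then show "fill_array r (level r (C r)) k l \<le> fill_array r' (level r' (C r')) k l"
      using r by (auto simp: fill_array_def fill_bounds intro: fill_mono)
  qed
qed

theorem nested_family_imp_value_condition:
  assumes "nested_family \<alpha> n b m s f C z"
  shows "value_condition \<alpha> n b m s f C"
  unfolding value_condition_def
proof (intro ballI allI impI)
  fix r and g :: "nat \<Rightarrow> real"
  assume r: "r \<in> {1..m}" and g: "(\<forall>l\<in>{1..n}. 0 < g l) \<and> (\<Sum>l=1..n. g l) = 1"
  have z: "z r \<in> arrays n r" "\<forall>l\<in>{1..n}. C r l \<le> Dr r (z r) l"
    using assms r by (auto simp: nested_family_def)
  have "(\<Sum>l=1..n. g l * C r l) \<le> (\<Sum>l=1..n. g l * Dr r (z r) l)"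
    using z g by (intro sum_mono mult_left_mono) (auto intro: less_imp_le)
  also have "\<dots> \<le> F r * V \<alpha> n b g s f r"
    using V_attained[of r g] g r z(1) by metis
  finally show "(\<Sum>l=1..n. g l * C r l) \<le> F r * V \<alpha> n b g s f r" .
qed

end

section \<open>Polynomial-time functions\<close>

text \<open>Fixing one code per type turns polynomial time into a property of functions, provable by
  following the syntax of their definitions instead of writing programs.\<close>

class enc =
  fixes enc :: "'a \<Rightarrow> tree"

abbreviation sz :: "'a :: enc \<Rightarrow> nat" where
  "sz x \<equiv> nodes (enc x)"

instantiation unit :: enc
begin
definition enc_unit :: "unit \<Rightarrow> tree" where "enc_unit _ = Tip"
instance ..
end

instantiation bool :: enc
begin
definition enc_bool :: "bool \<Rightarrow> tree" where "enc_bool = bool_code"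
instance ..
end

instantiation nat :: enc
begin
definition enc_nat :: "nat \<Rightarrow> tree" where "enc_nat = nat_code"
instance ..
end

instantiation int :: enc
begin
definition enc_int :: "int \<Rightarrow> tree" where "enc_int = int_code"
instance ..
end

instantiation prod :: (enc, enc) enc
begin
definition enc_prod :: "'a \<times> 'b \<Rightarrow> tree" where "enc_prod x = Bin (enc (fst x)) (enc (snd x))"
instance ..
end

instantiation list :: (enc) enc
begin
primrec enc_list :: "'a list \<Rightarrow> tree" where
  "enc_list [] = Tip"
| "enc_list (x # xs) = Bin (enc x) (enc_list xs)"
instance ..
end

lemma enc_Pair [simp]: "enc (x, y) = Bin (enc x) (enc y)"
  by (simp add: enc_prod_def)

lemma enc_bool_simps [simp]: "enc True = Bin Tip Tip" "enc False = Tip"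
  by (simp_all add: enc_bool_def bool_code_def)

text \<open>The bound ranges over all elements of the type, so closure under composition is
  unconditional; invalid data must be handled in polynomial time as well, with default
  results.\<close>

definition ptime :: "('a :: enc \<Rightarrow> 'b :: enc) \<Rightarrow> bool" where
  "ptime f \<longleftrightarrow> (\<exists>P p. \<forall>x. \<exists>T. exec P (enc x) (enc (f x)) T \<and> T \<le> poly p (sz x))"

definition pbounded :: "('a :: enc \<Rightarrow> nat) \<Rightarrow> bool" where
  "pbounded B \<longleftrightarrow> (\<exists>p. \<forall>x. B x \<le> poly p (sz x))"

named_theorems ptime

section \<open>Polynomial bounds, composition and branching\<close>

lemma poly_nat_mono: "x \<le> y \<Longrightarrow> poly (p :: nat poly) x \<le> poly p y"
  by (induction p) (auto intro: add_mono mult_mono)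

lemma pbounded_mono: "pbounded B \<Longrightarrow> (\<And>x. A x \<le> B x) \<Longrightarrow> pbounded A"
  unfolding pbounded_def by (meson order_trans)

lemma pbounded_const [ptime]: "pbounded (\<lambda>_. c)"
  unfolding pbounded_def by (intro exI[of _ "[:c:]"]) simp

lemma pbounded_sz [ptime]: "pbounded sz"
  unfolding pbounded_def by (intro exI[of _ "[:0, 1:]"]) simp

lemma pbounded_add [ptime]:
  assumes "pbounded A" "pbounded B" shows "pbounded (\<lambda>x. A x + B x)"
proof -
  obtain p q where "\<And>x. A x \<le> poly p (sz x)" "\<And>x. B x \<le> poly q (sz x)"
    using assms unfolding pbounded_def by blast
  then have "A x + B x \<le> poly (p + q) (sz x)" for x by (simp add: add_mono)
  then show ?thesis unfolding pbounded_def by blast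
qed

lemma pbounded_mult [ptime]:
  assumes "pbounded A" "pbounded B" shows "pbounded (\<lambda>x. A x * B x)"
proof -
  obtain p q where "\<And>x. A x \<le> poly p (sz x)" "\<And>x. B x \<le> poly q (sz x)"
    using assms unfolding pbounded_def by blast
  then have "A x * B x \<le> poly (p * q) (sz x)" for x by (simp add: mult_le_mono)
  then show ?thesis unfolding pbounded_def by blast
qed

lemma pbounded_Suc [ptime]: "pbounded A \<Longrightarrow> pbounded (\<lambda>x. Suc (A x))"
  using pbounded_add[OF pbounded_const[of 1], of A] by simp

lemma pbounded_poly: "pbounded A \<Longrightarrow> pbounded (\<lambda>x. poly p (A x))"
proof -
  assume "pbounded A"
  then obtain q where "\<And>x. A x \<le> poly q (sz x)" by (auto simp: pbounded_def)
  then have "poly p (A x) \<le> poly (pcompose p q) (sz x)" for x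
    by (simp add: poly_pcompose poly_nat_mono)
  then show ?thesis unfolding pbounded_def by blast
qed

lemma ptimeI:
  assumes "\<And>x. exec P (enc x) (enc (f x)) (T x)" "pbounded T"
  shows "ptime f"
  using assms unfolding ptime_def pbounded_def by metis

lemma ptimeE:
  assumes "ptime f"
  obtains P T where "\<And>x. exec P (enc x) (enc (f x)) (T x)" "pbounded T"
proof -
  obtain P p where "\<forall>x. \<exists>T. exec P (enc x) (enc (f x)) T \<and> T \<le> poly p (sz x)"
    using assms by (auto simp: ptime_def)
  then obtain T where "\<And>x. exec P (enc x) (enc (f x)) (T x) \<and> T x \<le> poly p (sz x)"
    by metis
  then show ?thesis using that[of P T] unfolding pbounded_def by metis
qed

lemma pbounded_sz_ptime:
  assumes "ptime f" shows "pbounded (\<lambda>x. sz (f x))"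
proof -
  obtain P T where "\<And>x. exec P (enc x) (enc (f x)) (T x)" "pbounded T" using ptimeE[OF assms] by metis
  then show ?thesis using exec_result_size pbounded_mono by metis
qed

lemma pbounded_comp:
  assumes "pbounded B" "ptime f" shows "pbounded (\<lambda>x. B (f x))"
proof -
  obtain p where "\<And>x. B x \<le> poly p (sz x)" using assms(1) unfolding pbounded_def by blast
  then show ?thesis by (rule pbounded_mono[OF pbounded_poly[OF pbounded_sz_ptime[OF assms(2)]]])
qed

lemma ptime_id [ptime]: "ptime (\<lambda>x. x)"
  by (rule ptimeI[where P = Ident]) (rule exec.Ident pbounded_sz)+

lemma ptime_comp: "ptime g \<Longrightarrow> ptime f \<Longrightarrow> ptime (\<lambda>x. g (f x))"
proof -
  assume g: "ptime g" and f: "ptime f"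
  obtain P T where P: "\<And>x. exec P (enc x) (enc (f x)) (T x)" "pbounded T" using ptimeE[OF f] by metis
  obtain Q T' where Q: "\<And>x. exec Q (enc x) (enc (g x)) (T' x)" "pbounded T'" using ptimeE[OF g] by metis
  show ?thesis
    by (rule ptimeI[OF exec.Seq[OF P(1) Q(1)]]) (intro ptime P(2) pbounded_comp[OF Q(2) f])
qed

text \<open>A program sees only trees, so values with equal codes can be exchanged. This lets
  numbers be handled as bit lists and integers as pairs.\<close>

lemma ptime_retype: "ptime f \<Longrightarrow> (\<And>x. enc (g x) = enc (f x)) \<Longrightarrow> ptime g"
  by (simp add: ptime_def)

lemma ptime_Pair [ptime]: "ptime f \<Longrightarrow> ptime g \<Longrightarrow> ptime (\<lambda>x. (f x, g x))"
proof -
  assume g: "ptime g" and f: "ptime f"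
  obtain P T where P: "\<And>x. exec P (enc x) (enc (f x)) (T x)" "pbounded T" using ptimeE[OF f] by metis
  obtain Q T' where Q: "\<And>x. exec Q (enc x) (enc (g x)) (T' x)" "pbounded T'" using ptimeE[OF g] by metis
  show ?thesis
    by (rule ptimeI[where P = "MkBin P Q"], unfold enc_Pair, rule exec.MkBin[OF P(1) Q(1)])
      (intro ptime P(2) Q(2))
qed

lemma ptime_fst': "ptime (fst :: 'a :: enc \<times> 'b :: enc \<Rightarrow> 'a)"
proof (rule ptimeI[where P = GetLeft])
  show "exec GetLeft (enc p) (enc (fst p)) (sz p)" for p :: "'a \<times> 'b"
    using exec.GetLeft[of "enc p"] by (simp add: enc_prod_def)
qed (rule pbounded_sz)

lemma ptime_snd': "ptime (snd :: 'a :: enc \<times> 'b :: enc \<Rightarrow> 'b)"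
proof (rule ptimeI[where P = GetRight])
  show "exec GetRight (enc p) (enc (snd p)) (sz p)" for p :: "'a \<times> 'b"
    using exec.GetRight[of "enc p"] by (simp add: enc_prod_def)
qed (rule pbounded_sz)

lemmas ptime_fst [ptime] = ptime_comp[OF ptime_fst']
lemmas ptime_snd [ptime] = ptime_comp[OF ptime_snd']

lemma ptime_comp2:
  assumes "ptime (\<lambda>p. g (fst p) (snd p))" "ptime f1" "ptime f2"
  shows "ptime (\<lambda>x. g (f1 x) (f2 x))"
  using ptime_comp[OF assms(1) ptime_Pair[OF assms(2,3)]] by simp

lemma ptime_comp3:
  assumes "ptime (\<lambda>p. g (fst p) (fst (snd p)) (snd (snd p)))" "ptime f1" "ptime f2" "ptime f3"
  shows "ptime (\<lambda>x. g (f1 x) (f2 x) (f3 x))"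
  using ptime_comp[OF assms(1) ptime_Pair[OF assms(2) ptime_Pair[OF assms(3,4)]]] by simp

primrec const_prog :: "tree \<Rightarrow> prog" where
  "const_prog Tip = MkTip"
| "const_prog (Bin u v) = MkBin (const_prog u) (const_prog v)"

lemma exec_const_prog: "exec (const_prog t) x t (nodes t * nodes x)"
proof (induction t)
  case Tip then show ?case using exec.MkTip by simp
next
  case (Bin u v)
  from exec.MkBin[OF this] show ?case by (simp add: algebra_simps)
qed

lemma ptime_const [ptime]: "ptime (\<lambda>_. c)"
  by (rule ptimeI) (rule exec_const_prog ptime)+

lemma exec_Cond:
  "exec B t w T \<Longrightarrow> exec P t u Tu \<Longrightarrow> exec Q t v Tv \<Longrightarrow>
    exec (Cond B P Q) t (if w = Tip then v else u) (nodes t + T + (if w = Tip then Tv else Tu))"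
  using exec.CondTrue exec.CondFalse by auto

lemma ptime_branch:
  assumes "ptime b" "ptime f" "ptime g" "\<And>x. c x \<longleftrightarrow> enc (b x) \<noteq> Tip"
  shows "ptime (\<lambda>x. if c x then f x else g x)"
proof -
  obtain B T where B: "\<And>x. exec B (enc x) (enc (b x)) (T x)" "pbounded T" using ptimeE[OF assms(1)] by metis
  obtain P Tf where P: "\<And>x. exec P (enc x) (enc (f x)) (Tf x)" "pbounded Tf" using ptimeE[OF assms(2)] by metis
  obtain Q Tg where Q: "\<And>x. exec Q (enc x) (enc (g x)) (Tg x)" "pbounded Tg" using ptimeE[OF assms(3)] by metis
  have "pbounded (\<lambda>x. sz x + T x + (if enc (b x) = Tip then Tg x else Tf x))"
    by (rule pbounded_mono[of "\<lambda>x. sz x + T x + (Tg x + Tf x)"]) (intro ptime B P Q, simp)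
  moreover have "exec (Cond B P Q) (enc x) (enc (if c x then f x else g x))
      (sz x + T x + (if enc (b x) = Tip then Tg x else Tf x))" for x
    using exec_Cond[OF B(1) P(1) Q(1), of x] by (simp add: assms(4) if_distrib[of enc] split: if_splits)
  ultimately show ?thesis by (rule ptimeI[rotated])
qed

lemma ptime_if [ptime]: "ptime b \<Longrightarrow> ptime f \<Longrightarrow> ptime g \<Longrightarrow> ptime (\<lambda>x. if b x then f x else g x)"
  by (rule ptime_branch[of b]) (auto simp: enc_bool_def bool_code_def)

text \<open>Branching on a boolean tabulates the dependence on it, so arbitrary truth tables, such
  as the transition function of an automaton, come for free.\<close>

lemma ptime_bool_fun:
  fixes b :: "_ \<Rightarrow> bool"
  assumes "ptime b" "\<And>c. ptime (f c)"
  shows "ptime (\<lambda>x. f (b x) x)"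
proof -
  have "(\<lambda>x. f (b x) x) = (\<lambda>x. if b x then f True x else f False x)" by auto
  then show ?thesis using assms by (auto intro: ptime)
qed

lemma ptime_not [ptime]: "ptime b \<Longrightarrow> ptime (\<lambda>x. \<not> b x)"
  by (rule ptime_bool_fun[where f = "\<lambda>c _. \<not> c"]) (auto intro: ptime)

lemma ptime_bool_eq [ptime]:
  assumes "ptime b" "ptime (c :: _ \<Rightarrow> bool)" shows "ptime (\<lambda>x. b x = c x)"
proof (rule ptime_bool_fun[where b = b and f = "\<lambda>d x. d = c x"])
  fix d show "ptime (\<lambda>x. d = c x)" using assms by (cases d) (auto intro: ptime)
qed fact

section \<open>Lists and bounded iteration\<close>

lemma ptime_Cons [ptime]: "ptime f \<Longrightarrow> ptime g \<Longrightarrow> ptime (\<lambda>x. f x # g x)"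
  by (rule ptime_retype[OF ptime_Pair[of f g]]) auto

lemma enc_list_eq_Tip [simp]: "enc (xs :: 'a :: enc list) = Tip \<longleftrightarrow> xs = []"
  by (cases xs) auto

lemma ptime_Nil [ptime]:
  assumes "ptime xs" shows "ptime (\<lambda>x. xs x = [])"
proof -
  have "(\<lambda>x. xs x = []) = (\<lambda>x. if xs x \<noteq> [] then False else True)" by auto
  then show ?thesis
    using ptime_branch[OF assms ptime_const[of False] ptime_const[of True], of "\<lambda>x. xs x \<noteq> []"] by simp
qed

lemma ptime_tl' : "ptime tl"
proof (rule ptimeI[where P = GetRight and T = sz])
  show "exec GetRight (enc xs) (enc (tl xs)) (sz xs)" for xs :: "'a list"
    using exec.GetRight[of "enc xs"] by (cases xs) auto
qed (rule pbounded_sz)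

lemmas ptime_tl [ptime] = ptime_comp[OF ptime_tl']

text \<open>\<open>hd []\<close> is unspecified but is one fixed element, so in the empty case the
  program can write out its code as a constant.\<close>

lemma ptime_hd': "ptime (hd :: 'a :: enc list \<Rightarrow> 'a)"
proof -
  have "exec (Cond Ident GetLeft (const_prog (enc (hd [] :: 'a)))) (enc xs) (enc (hd xs))
      (sz xs + sz xs + (if enc xs = Tip then sz (hd [] :: 'a) * sz xs else sz xs))" for xs :: "'a list"
    using exec_Cond[OF exec.Ident[of "enc xs"] exec.GetLeft exec_const_prog[of "enc (hd [] :: 'a)"]]
    by (cases xs) auto
  moreover have "pbounded (\<lambda>xs :: 'a list. sz xs + sz xs + (if enc xs = Tip then sz (hd [] :: 'a) * sz xs else sz xs))"
    by (rule pbounded_mono[of "\<lambda>xs. sz xs + sz xs + (sz (hd [] :: 'a) * sz xs + sz xs)"]) (intro ptime, simp)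
  ultimately show ?thesis by (rule ptimeI)
qed

lemmas ptime_hd [ptime] = ptime_comp[OF ptime_hd']

lemma sz_append: "Suc (sz (xs @ ys :: 'a :: enc list)) = sz xs + sz ys"
  by (induction xs) auto

lemma sz_pos: "Suc 0 \<le> sz x"
  by (rule nodes_pos)

lemma length_le_sz: "length xs \<le> sz (xs :: 'a :: enc list)"
  by (induction xs) auto

lemma sz_mem: "x \<in> set xs \<Longrightarrow> sz x < sz (xs :: 'a :: enc list)"
  by (induction xs) auto

lemma sz_list_le: "(\<And>x. x \<in> set xs \<Longrightarrow> sz x \<le> M) \<Longrightarrow> sz (xs :: 'a :: enc list) \<le> Suc (length xs * Suc M)"
proof (induction xs)
  case (Cons a xs)
  then have "sz a \<le> M" "sz xs \<le> Suc (length xs * Suc M)" by auto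
  then show ?case by simp
qed simp

text \<open>The loop state consists of parameters, accumulator and remaining list, and the test
  reads the list. \<open>M\<close> bounds one round at every reachable state: \<open>T\<close> pays
  for the body, the multiple of the state size for the test and the loop itself.\<close>

lemma exec_foldl:
  fixes step :: "'x :: enc \<Rightarrow> 'a :: enc \<Rightarrow> 'y :: enc \<Rightarrow> 'a"
  assumes body: "\<And>x a ys. exec P (enc (x, a, ys)) (enc (x, step x a (hd ys), tl ys)) (T (x, a, ys))"
    and M: "\<And>us vs. ys = us @ vs \<Longrightarrow> T (x, foldl (step x) a us, vs) + 5 * sz (x, foldl (step x) a us, vs) \<le> M"
  shows "\<exists>T'. exec (Loop (Seq GetRight GetRight) P) (enc (x, a, ys)) (enc (x, foldl (step x) a ys, [] :: 'y list)) T'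
      \<and> T' \<le> Suc (length ys) * M"
  using M
proof (induction ys arbitrary: a)
  case Nil
  have "exec (Seq GetRight GetRight) (enc (x, a, [] :: 'y list)) Tip
      (sz (x, a, [] :: 'y list) + sz (x, a, [] :: 'y list) + nodes (enc (a, [] :: 'y list)))"
    using exec.Seq[OF exec.GetRight exec.GetRight, of "enc (x, a, [] :: 'y list)"] by simp
  from exec.LoopEnd[OF this, of P] have "exec (Loop (Seq GetRight GetRight) P)
      (enc (x, a, [] :: 'y list)) (enc (x, foldl (step x) a [], [] :: 'y list))
      (sz (x, a, [] :: 'y list) + (sz (x, a, [] :: 'y list) + sz (x, a, [] :: 'y list) + nodes (enc (a, [] :: 'y list))))"
    by simp
  then show ?case using Nil[of "[]" "[]"] by (intro exI conjI) (assumption, simp)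
next
  case (Cons y ys)
  let ?s = "(x, a, y # ys)"
  have 1: "exec (Seq GetRight GetRight) (enc ?s) (enc (y # ys)) (sz ?s + sz ?s + sz (a, y # ys))"
    using exec.Seq[OF exec.GetRight exec.GetRight, of "enc ?s"] by simp
  have 2: "exec P (enc ?s) (enc (x, step x a y, ys)) (T ?s)" using body[of x a "y # ys"] by simp
  obtain T' where T': "exec (Loop (Seq GetRight GetRight) P) (enc (x, step x a y, ys))
       (enc (x, foldl (step x) (step x a y) ys, [] :: 'y list)) T'" "T' \<le> Suc (length ys) * M"
    using Cons.IH[of "step x a y"] Cons.prems[of "y # _"] by auto
  have "exec (Loop (Seq GetRight GetRight) P) (enc ?s) (enc (x, foldl (step x) a (y # ys), [] :: 'y list))
     (sz ?s + (sz ?s + sz ?s + sz (a, y # ys)) + T ?s + T')"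
    using exec.LoopStep[OF 1 _ 2 T'(1)] by simp
  moreover have "sz ?s + (sz ?s + sz ?s + sz (a, y # ys)) + T ?s \<le> M"
    using Cons.prems[of "[]" "y # ys"] by simp
  ultimately show ?case using T'(2) by (intro exI conjI) auto
qed

text \<open>A polynomial time step may double the accumulator in each round, so closure under folds
  fails in general. The bound \<open>B\<close>, valid after every prefix of the list, is the extra
  ingredient that each use has to provide.\<close>

lemma ptime_foldl:
  fixes step :: "'x :: enc \<Rightarrow> 'a :: enc \<Rightarrow> 'y :: enc \<Rightarrow> 'a"
  assumes step: "ptime (\<lambda>p. step (fst p) (fst (snd p)) (snd (snd p)))"
    and init: "ptime init" and xs: "ptime xs" and B: "pbounded B"
    and size: "\<And>x us vs. xs x = us @ vs \<Longrightarrow> sz (foldl (step x) (init x) us) \<le> B x"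
  shows "ptime (\<lambda>x. foldl (step x) (init x) (xs x))"
proof -
  have body: "ptime (\<lambda>p :: 'x \<times> 'a \<times> 'y list. (fst p, step (fst p) (fst (snd p)) (hd (snd (snd p))), tl (snd (snd p))))"
    by (intro ptime ptime_comp3[OF step])
  obtain P T where P: "\<And>p. exec P (enc p) (enc (fst p, step (fst p) (fst (snd p)) (hd (snd (snd p))), tl (snd (snd p)))) (T p)"
    and T: "pbounded T" using ptimeE[OF body] by metis
  obtain t where t: "\<And>p. T p \<le> poly t (sz p)" using T unfolding pbounded_def by metis
  define S where "S = (\<lambda>x. sz x + B x + sz (xs x) + 2)"
  define M where "M = (\<lambda>x. poly t (S x) + 5 * S x)"
  have S: "pbounded S" unfolding S_def by (intro ptime pbounded_sz_ptime[OF xs] B)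
  have M: "pbounded M" unfolding M_def by (intro ptime pbounded_poly S)
  have M': "T (x, foldl (step x) (init x) us, vs) + 5 * sz (x, foldl (step x) (init x) us, vs) \<le> M x"
    if "xs x = us @ vs" for x us vs
  proof -
    have "sz (x, foldl (step x) (init x) us, vs) \<le> S x"
      using size[OF that] sz_append[of us vs] sz_pos[of us] that by (simp add: S_def)
    then show ?thesis
      unfolding M_def by (intro add_mono mult_left_mono order_trans[OF t poly_nat_mono]) auto
  qed
  have loop: "\<exists>T'. exec (Loop (Seq GetRight GetRight) P) (enc (x, init x, xs x))
      (enc (x, foldl (step x) (init x) (xs x), [] :: 'y list)) T' \<and> T' \<le> Suc (length (xs x)) * M x" for x
  proof (rule exec_foldl[OF _ M'])
    show "exec P (enc (x, a, ys)) (enc (x, step x a (hd ys), tl ys)) (T (x, a, ys))" for x a ys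
      using P[of "(x, a, ys)"] by (simp only: fst_conv snd_conv)
  qed
  then have "\<forall>x. \<exists>T'. exec (Loop (Seq GetRight GetRight) P) (enc (x, init x, xs x))
      (enc (x, foldl (step x) (init x) (xs x), [] :: 'y list)) T' \<and> T' \<le> Suc (length (xs x)) * M x" ..
  then obtain T' where "\<forall>x. exec (Loop (Seq GetRight GetRight) P) (enc (x, init x, xs x))
      (enc (x, foldl (step x) (init x) (xs x), [] :: 'y list)) (T' x) \<and> T' x \<le> Suc (length (xs x)) * M x"
    by (rule choice[THEN exE])
  then have T': "exec (Loop (Seq GetRight GetRight) P) (enc (x, init x, xs x))
      (enc (x, foldl (step x) (init x) (xs x), [] :: 'y list)) (T' x)" "T' x \<le> Suc (length (xs x)) * M x" for x
    by blast+
  have "pbounded T'"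
  proof (rule pbounded_mono)
    show "pbounded (\<lambda>x. Suc (sz (xs x)) * M x)" by (intro ptime pbounded_sz_ptime[OF xs] M)
    show "T' x \<le> Suc (sz (xs x)) * M x" for x
      using T'(2)[of x] length_le_sz[of "xs x"] by (meson Suc_le_mono le_trans mult_le_mono1)
  qed
  moreover have start: "ptime (\<lambda>x. (x, init x, xs x))" by (intro ptime init xs)
  obtain Q TQ where Q: "\<And>x. exec Q (enc x) (enc (x, init x, xs x)) (TQ x)" "pbounded TQ"
    using ptimeE[OF start] by metis
  ultimately have "pbounded (\<lambda>x. sz x + TQ x + T' x)" by (intro pbounded_add pbounded_sz)
  then have "ptime (\<lambda>x. (x, foldl (step x) (init x) (xs x), [] :: 'y list))"
    by (rule ptimeI[OF exec.Seq[OF Q(1) T'(1)]])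
  from ptime_fst[OF ptime_snd[OF this]] show ?thesis by simp
qed

lemma ptime_rev [ptime]:
  assumes "ptime xs" shows "ptime (\<lambda>x. rev (xs x :: 'a :: enc list))"
proof -
  have rev: "foldl (\<lambda>a y. y # a) [] ys = rev ys" for ys :: "'a list"
    using foldl_conv_fold[of "\<lambda>a y. y # a"] rev_conv_fold by metis
  have snoc: "sz (ys @ [y]) = Suc (sz ys + sz y)" for ys and y :: 'a
    using sz_append[of ys "[y]"] by simp
  have sz_rev: "sz (rev ys) = sz ys" for ys :: "'a list"
    by (induction ys) (auto simp: snoc)
  have "ptime (\<lambda>x. foldl (\<lambda>a y. y # a) [] (xs x))"
  proof (rule ptime_foldl)
    show "pbounded (\<lambda>x. sz (xs x))" by (rule pbounded_sz_ptime[OF assms])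
    show "sz (foldl (\<lambda>a y. y # a) [] us) \<le> sz (xs x)" if "xs x = us @ vs" for x us vs
      using sz_append[of us vs] sz_pos[of vs] that by (simp add: rev sz_rev)
  qed (intro ptime assms)+
  then show ?thesis by (simp add: rev)
qed

lemma ptime_map [ptime]:
  assumes "ptime (\<lambda>p. g (fst p) (snd p))" "ptime xs"
  shows "ptime (\<lambda>x. map (g x) (xs x :: 'a :: enc list) :: 'b :: enc list)"
proof -
  have map: "foldl (\<lambda>a y. g x y # a) [] ys = rev (map (g x) ys)" for x ys
    by (induction ys rule: rev_induct) auto
  obtain p where p: "\<And>x y. sz (g x y) \<le> poly p (sz (x, y))"
    using pbounded_sz_ptime[OF assms(1)] by (auto simp: pbounded_def)
  define M where "M = (\<lambda>x. poly p (Suc (sz x + sz (xs x))))"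
  have "ptime (\<lambda>x. foldl (\<lambda>a y. g x y # a) [] (xs x))"
  proof (rule ptime_foldl)
    show "pbounded (\<lambda>x. Suc (sz (xs x) * Suc (M x)))"
      unfolding M_def by (intro ptime pbounded_poly pbounded_sz_ptime assms)
    show "sz (foldl (\<lambda>a y. g x y # a) [] us) \<le> Suc (sz (xs x) * Suc (M x))" if "xs x = us @ vs" for x us vs
    proof -
      have "sz (g x y) \<le> M x" if "y \<in> set us" for y
      proof -
        have "sz y \<le> sz (xs x)" using sz_mem[of y "xs x"] that \<open>xs x = us @ vs\<close> by simp
        then have "poly p (sz (x, y)) \<le> M x" unfolding M_def by (intro poly_nat_mono) simp
        with p[of x y] show ?thesis by simp
      qed
      then have "sz (rev (map (g x) us)) \<le> Suc (length (rev (map (g x) us)) * Suc (M x))"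
        by (intro sz_list_le) auto
      also have "\<dots> \<le> Suc (sz (xs x) * Suc (M x))"
      proof -
        have "length us \<le> sz (xs x)" using length_le_sz[of "xs x"] that by simp
        then show ?thesis by (simp add: mult_le_mono1 del: mult_Suc_right)
      qed
      finally show ?thesis unfolding map .
    qed
  qed (intro ptime assms ptime_comp2[OF assms(1)])+
  from ptime_rev[OF this] show ?thesis by (simp add: map)
qed

lemma ptime_append [ptime]:
  assumes "ptime xs" "ptime ys" shows "ptime (\<lambda>x. xs x @ ys x :: 'a :: enc list)"
proof -
  have app: "foldl (\<lambda>a y. y # a) ys (rev xs) = xs @ ys" for xs ys :: "'a list"
    by (simp add: foldl_conv_fold fold_Cons_rev)
  have "ptime (\<lambda>x. foldl (\<lambda>a y. y # a) (ys x) (rev (xs x)))"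
  proof (rule ptime_foldl)
    show "pbounded (\<lambda>x. sz (xs x) + sz (ys x))" by (intro ptime pbounded_sz_ptime assms)
    show "sz (foldl (\<lambda>a y. y # a) (ys x) us) \<le> sz (xs x) + sz (ys x)" if "rev (xs x) = us @ vs" for x us vs
    proof -
      have "xs x = rev vs @ rev us" using that by (metis rev_append rev_rev_ident)
      then show ?thesis
        using app[of "ys x" "rev us"] sz_append[of "rev us" "ys x"] sz_append[of "rev vs" "rev us"] sz_pos[of "rev vs"]
        by simp
    qed
  qed (intro ptime assms)+
  then show ?thesis by (simp add: app)
qed

text \<open>The count is the length of a list, that is a unary number, which keeps the number of
  rounds below the input size.\<close>

lemma ptime_drop:
  assumes "ptime i" "ptime xs"
  shows "ptime (\<lambda>x. drop (length (i x :: 'b :: enc list)) (xs x :: 'a :: enc list))"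
proof -
  have drop: "foldl (\<lambda>a _. tl a) ys i = drop (length i) ys" for ys :: "'a list" and i :: "'b list"
  proof (induction i arbitrary: ys)
    case (Cons a i)
    then show ?case by (simp only: foldl.simps list.size drop_Suc add_Suc_right add_0_right)
  qed simp
  have "ptime (\<lambda>x. foldl (\<lambda>a _. tl a) (xs x) (i x))"
  proof (rule ptime_foldl)
    show "pbounded (\<lambda>x. sz (xs x))" by (rule pbounded_sz_ptime[OF assms(2)])
    show "sz (foldl (\<lambda>a _. tl a) (xs x) us) \<le> sz (xs x)" for x and us :: "'b list"
      using sz_append[of "take (length us) (xs x)" "drop (length us) (xs x)"]
        sz_pos[of "take (length us) (xs x)"] by (simp add: drop)
  qed (intro ptime assms)+
  then show ?thesis by (simp add: drop)
qed

lemma sz_tl: "sz (tl xs :: 'a :: enc list) \<le> sz xs"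
  by (cases xs) auto

text \<open>For a list read as a unary number i, this is the range 0, ..., i - 1 in increasing
  order; maps and folds over it play the role of counting loops.\<close>

primrec below :: "'a list \<Rightarrow> 'a list list" where
  "below [] = []"
| "below (u # i) = below i @ [i]"

lemma ptime_below [ptime]:
  assumes "ptime i" shows "ptime (\<lambda>x. below (i x :: 'a :: enc list))"
proof -
  define step where "step = (\<lambda>(p :: 'a list \<times> 'a list list) (u :: 'a). (tl (fst p), tl (fst p) # snd p))"
  have below: "foldl step (i, acc) i = ([], below i @ acc)" for i acc
    by (induction i arbitrary: acc) (auto simp: step_def)
  have inv: "sz (fst (foldl step (i, []) us)) \<le> sz i \<and> (\<forall>e\<in>set (snd (foldl step (i, []) us)). sz e \<le> sz i)
      \<and> length (snd (foldl step (i, []) us)) = length us" for i us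
    by (induction us rule: rev_induct) (auto simp: step_def intro: order_trans[OF sz_tl])
  have "ptime (\<lambda>x. foldl step (i x, []) (i x))"
  proof (rule ptime_foldl)
    show "ptime (\<lambda>p. step (fst (snd p)) (snd (snd p)))" unfolding step_def by (intro ptime)
    show "ptime (\<lambda>x. (i x, [] :: 'a list list))" "ptime i" by (intro ptime assms)+
    show "pbounded (\<lambda>x. Suc (sz (i x) + Suc (sz (i x) * Suc (sz (i x)))))"
      by (intro ptime pbounded_sz_ptime assms)
    fix x us vs assume us: "i x = us @ vs"
    let ?s = "foldl step (i x, []) us"
    have "sz (snd ?s) \<le> Suc (length us * Suc (sz (i x)))"
      using sz_list_le[of "snd ?s" "sz (i x)"] inv[of "i x" us] by simp
    moreover have "length us * Suc (sz (i x)) \<le> sz (i x) * Suc (sz (i x))"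
      using length_le_sz[of "i x"] us by (intro mult_le_mono1) simp
    ultimately have "sz (snd ?s) \<le> Suc (sz (i x) * Suc (sz (i x)))" by linarith
    then show "sz ?s \<le> Suc (sz (i x) + Suc (sz (i x) * Suc (sz (i x))))"
      using inv[of "i x" us] by (simp add: enc_prod_def del: mult_Suc_right)
  qed
  from ptime_snd[OF this] show ?thesis by (simp add: below)
qed

section \<open>Natural numbers as bit lists\<close>

fun bits :: "nat \<Rightarrow> bool list" where
  "bits a = (if a = 0 then [] else odd a # bits (a div 2))"

declare bits.simps [simp del]

text \<open>Lists are coded by the same nesting of \<open>Bin\<close> as numbers, so on trees
  \<open>bits\<close> is the identity.\<close>

lemma enc_bits: "enc (bits a) = enc a"
proof (induction a rule: bits.induct)
  case (1 a)
  then show ?case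
    by (subst bits.simps, subst enc_nat_def, subst nat_code.simps)
      (auto simp: enc_nat_def enc_bool_def bool_code_def)
qed

lemma enc_nat_0 [simp]: "enc (0 :: nat) = Tip"
  by (simp add: enc_nat_def nat_code.simps)

lemma enc_nat_eq_Tip [simp]: "enc (a :: nat) = Tip \<longleftrightarrow> a = 0"
  by (simp add: enc_nat_def nat_code.simps)

lemma enc_nat_double: "b \<or> a \<noteq> 0 \<Longrightarrow> enc (of_bool b + 2 * a :: nat) = Bin (enc b) (enc a)"
  unfolding enc_nat_def enc_bool_def by (subst nat_code.simps) auto

lemma ptime_bits [ptime]: "ptime f \<Longrightarrow> ptime (\<lambda>x. bits (f x))"
  by (rule ptime_retype[of f]) (simp_all add: enc_bits)

lemma ptime_odd [ptime]:
  assumes "ptime f" shows "ptime (\<lambda>x. odd (f x :: nat))"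
proof -
  have "odd a = (if bits a = [] then False else hd (bits a))" for a :: nat by (simp add: bits.simps)
  then show ?thesis using assms by (simp only:) (intro ptime)
qed

lemma ptime_div2 [ptime]:
  assumes "ptime f" shows "ptime (\<lambda>x. f x div 2 :: nat)"
proof (rule ptime_retype)
  show "enc (f x div 2) = enc (tl (bits (f x)))" for x
    by (subst bits.simps) (simp add: enc_bits)
qed (intro ptime assms)

lemma ptime_eq_0 [ptime]:
  assumes "ptime a" shows "ptime (\<lambda>x. a x = (0 :: nat))"
proof -
  have "a = 0 \<longleftrightarrow> bits a = []" for a by (simp add: bits.simps)
  then show ?thesis using assms by (simp only:) (intro ptime)
qed

lemma ptime_double [ptime]:
  assumes "ptime b" "ptime f" shows "ptime (\<lambda>x. of_bool (b x) + 2 * f x :: nat)"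
proof -
  have "ptime (\<lambda>p. of_bool (fst p) + 2 * snd p :: nat)"
  proof -
    \<comment> \<open>The pair of bit and number already is the code of the result, except when both
      vanish: 0 has the empty code, without a leading zero.\<close>
    let ?P = "Cond GetLeft Ident (Cond GetRight Ident MkTip)"
    have "exec ?P (enc p) (enc (of_bool (fst p) + 2 * snd p))
        (sz p + sz p + (if enc (fst p) = Tip then sz p + sz p + (if enc (snd p) = Tip then sz p else sz p) else sz p))"
      for p :: "bool \<times> nat"
      using exec_Cond[OF exec.GetLeft[of "enc p"] exec.Ident exec_Cond[OF exec.GetRight[of "enc p"] exec.Ident exec.MkTip]]
        enc_nat_double[of "fst p" "snd p"]
      by (cases p; cases "fst p"; cases "snd p = 0") auto
    moreover have "pbounded (\<lambda>p :: bool \<times> nat. sz p + sz p + (if enc (fst p) = Tip then sz p + sz p + (if enc (snd p) = Tip then sz p else sz p) else sz p))"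
      by (rule pbounded_mono[of "\<lambda>p. 5 * sz p"]) (intro ptime, simp)
    ultimately show ?thesis by (rule ptimeI)
  qed
  from ptime_comp2[OF this assms] show ?thesis .
qed

lemma sz_nat_less: "a < 2 ^ sz (a :: nat)"
proof (induction a rule: bits.induct)
  case (1 a)
  show ?case
  proof (cases "a = 0")
    case False
    have a: "a = of_bool (odd a) + 2 * (a div 2)" by (cases "even a") auto
    have "enc a = Bin (enc (odd a)) (enc (a div 2))"
      using enc_nat_double[of "odd a" "a div 2"] a False by (metis add.commute add_cancel_right_right mult_0_right of_bool_eq(1))
    then have "sz a \<ge> Suc (sz (a div 2))" by simp
    then have "(2::nat) * 2 ^ sz (a div 2) \<le> 2 ^ sz a" using power_increasing[of "Suc (sz (a div 2))" "sz a" "2::nat"] by simp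
    moreover have "a < 2 * 2 ^ sz (a div 2)" using 1[OF False] by linarith
    ultimately show ?thesis by linarith
  qed simp
qed

text \<open>A binary digit takes one inner node and at most three for the bit, and the end of the
  code one more. Accumulators of arithmetic loops are bounded in size through their
  magnitude.\<close>

lemma sz_nat_le: "a < 2 ^ k \<Longrightarrow> sz (a :: nat) \<le> 4 * k + 1"
proof (induction k arbitrary: a)
  case (Suc k)
  show ?case
  proof (cases "a = 0")
    case False
    have a: "a = of_bool (odd a) + 2 * (a div 2)" by (cases "even a") auto
    have "enc a = Bin (enc (odd a)) (enc (a div 2))"
      using enc_nat_double[of "odd a" "a div 2"] a False by (metis add.commute add_cancel_right_right mult_0_right of_bool_eq(1))
    moreover have "sz (odd a) \<le> 3" by (cases "odd a") simp_all
    moreover have "sz (a div 2) \<le> 4 * k + 1" using Suc.prems by (intro Suc.IH) auto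
    ultimately show ?thesis by simp
  qed simp
qed simp

lemma nat_less_length_bits: "a < 2 ^ length (bits a)"
proof (induction a rule: bits.induct)
  case (1 a)
  show ?case
  proof (cases "a = 0")
    case False
    then have "a div 2 < 2 ^ length (bits (a div 2))" by (rule 1)
    then have "a < 2 * 2 ^ length (bits (a div 2))" by linarith
    then show ?thesis by (subst bits.simps) simp
  qed simp
qed

lemma length_bits: "length (bits a) \<le> sz a"
  using length_le_sz[of "bits a"] by (simp add: enc_bits)

section \<open>Arithmetic on binary codes\<close>

text \<open>The value of a bit list read with the most significant bit first. Evaluating the list
  also removes leading zeros, which the code of a number must not have.\<close>

definition msb :: "bool list \<Rightarrow> nat" where
  "msb = foldl (\<lambda>v c. of_bool c + 2 * v) 0"

lemma msb_Nil [simp]: "msb [] = 0"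
  by (simp add: msb_def)

lemma msb_snoc [simp]: "msb (cs @ [c]) = of_bool c + 2 * msb cs"
  by (simp add: msb_def)

lemma msb_Cons: "msb (c # cs) = of_bool c * 2 ^ length cs + msb cs"
  by (induction cs rule: rev_induct) (auto simp: msb_def)

lemma msb_less: "msb cs < 2 ^ length cs"
  by (induction cs rule: rev_induct) (auto simp: of_bool_def)

lemma msb_bits: "msb (rev (bits a)) = a"
proof (induction a rule: bits.induct)
  case (1 a)
  then show ?case by (cases "even a") (subst bits.simps; auto)+
qed

lemma ptime_msb [ptime]:
  assumes "ptime f" shows "ptime (\<lambda>x. msb (f x))"
  unfolding msb_def
proof (rule ptime_foldl[where step = "\<lambda>_ v c. of_bool c + 2 * v"])
  show "pbounded (\<lambda>x. Suc (4 * sz (f x)))" by (intro ptime pbounded_sz_ptime assms)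
  fix x us vs assume "f x = us @ vs"
  then have "length us \<le> sz (f x)" using length_le_sz[of "f x"] by simp
  moreover have "sz (msb us) \<le> 4 * length us + 1" by (intro sz_nat_le msb_less)
  ultimately show "sz (foldl (\<lambda>v c. of_bool c + 2 * v :: nat) 0 us) \<le> Suc (4 * sz (f x))"
    by (simp add: msb_def)
qed (intro ptime assms)+

text \<open>Serial arithmetic: a finite automaton reads two numbers bit by bit, least significant bit
  first, and writes the result.  One step more than the total number of bits flushes the carry.\<close>

definition tstep :: "(bool \<Rightarrow> bool \<Rightarrow> bool \<Rightarrow> bool \<times> bool) \<Rightarrow> bool \<times> nat \<times> nat \<times> bool list
    \<Rightarrow> bool \<times> nat \<times> nat \<times> bool list" where
  "tstep \<delta> s =
     (fst (\<delta> (fst s) (odd (fst (snd s))) (odd (fst (snd (snd s))))),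
      fst (snd s) div 2, fst (snd (snd s)) div 2,
      snd (\<delta> (fst s) (odd (fst (snd s))) (odd (fst (snd (snd s))))) # snd (snd (snd s)))"

definition transduce :: "(bool \<Rightarrow> bool \<Rightarrow> bool \<Rightarrow> bool \<times> bool) \<Rightarrow> nat \<Rightarrow> nat \<Rightarrow> bool \<times> nat" where
  "transduce \<delta> a b =
     (let s = foldl (\<lambda>s _. tstep \<delta> s) (False, a, b, []) (True # bits a @ bits b)
      in (fst s, msb (snd (snd (snd s)))))"

lemma ptime_bool_fun3:
  assumes "ptime a" "ptime b" "ptime c"
  shows "ptime (\<lambda>x. \<delta> (a x :: bool) (b x :: bool) (c x :: bool))"
proof (rule ptime_bool_fun[where f = "\<lambda>u x. \<delta> u (b x) (c x)"])
  fix u show "ptime (\<lambda>x. \<delta> u (b x) (c x))"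
  proof (rule ptime_bool_fun[where f = "\<lambda>v x. \<delta> u v (c x)"])
    fix v show "ptime (\<lambda>x. \<delta> u v (c x))"
      by (rule ptime_bool_fun[where f = "\<lambda>w x. \<delta> u v w"]) (rule assms ptime_const)+
  qed (rule assms)
qed (rule assms)

lemma sz_div2: "sz (a div 2 :: nat) \<le> sz a"
proof -
  have "tl (bits a) = bits (a div 2)" by (simp add: bits.simps[of a] bits.simps[of 0])
  then show ?thesis using sz_tl[of "bits a"] by (simp add: enc_bits)
qed

lemma sz_bool: "sz (c :: bool) \<le> 3"
  by (cases c) auto

lemma ptime_transduce:
  assumes "ptime a" "ptime b" shows "ptime (\<lambda>x. transduce \<delta> (a x) (b x))"
proof -
  define run where "run = (\<lambda>a b. foldl (\<lambda>s (_::bool). tstep \<delta> s) (False, a, b, []))"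
  have inv: "sz (fst (snd (run a b us))) \<le> sz a \<and> sz (fst (snd (snd (run a b us)))) \<le> sz b
     \<and> length (snd (snd (snd (run a b us)))) = length us" for a b us
    by (induction us rule: rev_induct) (auto simp: run_def tstep_def intro: order_trans[OF sz_div2])
  have "ptime (\<lambda>x. run (a x) (b x) (True # bits (a x) @ bits (b x)))"
    unfolding run_def
  proof (rule ptime_foldl[where step = "\<lambda>_ s _. tstep \<delta> s"])
    show "ptime (\<lambda>p. tstep \<delta> (fst (snd p)))" unfolding tstep_def
      by (intro ptime ptime_bool_fun3[where \<delta> = \<delta>])
    show "ptime (\<lambda>x. (False, a x, b x, [] :: bool list))" "ptime (\<lambda>x. True # bits (a x) @ bits (b x))"
      by (intro ptime assms)+
    show "pbounded (\<lambda>x. sz (a x) + sz (b x) + (Suc (4 * Suc (sz (a x) + sz (b x))) + 6))"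
      by (intro ptime pbounded_sz_ptime assms)
    fix x us vs assume us: "True # bits (a x) @ bits (b x) = us @ vs"
    let ?s = "run (a x) (b x) us"
    have "length us \<le> Suc (sz (a x) + sz (b x))"
      using arg_cong[OF us, of length] length_bits[of "a x"] length_bits[of "b x"] by simp
    moreover have "sz (snd (snd (snd ?s))) \<le> Suc (length (snd (snd (snd ?s))) * Suc 3)"
      by (intro sz_list_le sz_bool)
    ultimately have "sz (snd (snd (snd ?s))) \<le> Suc (4 * Suc (sz (a x) + sz (b x)))"
      using inv[of "a x" "b x" us] by simp
    then show "sz (foldl (\<lambda>s _. tstep \<delta> s) (False, a x, b x, []) us)
        \<le> sz (a x) + sz (b x) + (Suc (4 * Suc (sz (a x) + sz (b x))) + 6)"
      using inv[of "a x" "b x" us] sz_bool[of "fst ?s"] unfolding run_def by (simp add: enc_prod_def)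
  qed
  then show ?thesis unfolding transduce_def Let_def run_def by (intro ptime)
qed

text \<open>\<open>w c\<close> is the signed weight of carry \<open>c\<close>, and \<open>e\<close>
  is 1 for sums and -1 for differences. Invariant: the value sought is the output so far plus 2^i
  times the unread parts together with the carry; after all steps the unread parts are 0. Output
  bits are consed, so each new one is the leading bit for \<open>msb\<close>.\<close>

lemma transduce_correct:
  assumes \<delta>: "\<And>c x y. of_bool x + e * of_bool y + w c = of_bool (snd (\<delta> c x y)) + 2 * (w (fst (\<delta> c x y)) :: int)"
    and w: "w False = 0"
  shows "\<exists>i. int a + e * int b = int (snd (transduce \<delta> a b)) + 2 ^ i * w (fst (transduce \<delta> a b))
     \<and> snd (transduce \<delta> a b) < 2 ^ i \<and> a + b < 2 ^ i"
proof -
  define run where "run = foldl (\<lambda>s (_::bool). tstep \<delta> s) (False, a, b, [])"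
  have "int a + e * int b = int (msb (snd (snd (snd (run us))))) + 2 ^ length us *
       (int (fst (snd (run us))) + e * int (fst (snd (snd (run us)))) + w (fst (run us)))
     \<and> fst (snd (run us)) = a div 2 ^ length us \<and> fst (snd (snd (run us))) = b div 2 ^ length us
     \<and> length (snd (snd (snd (run us)))) = length us" for us
  proof (induction us rule: rev_induct)
    case Nil then show ?case by (simp add: run_def w)
  next
    case (snoc u us)
    obtain c a' b' out where r: "run us = (c, a', b', out)" by (cases "run us") auto
    have r': "run (us @ [u]) = (fst (\<delta> c (odd a') (odd b')), a' div 2, b' div 2, snd (\<delta> c (odd a') (odd b')) # out)"
      using r by (simp add: run_def tstep_def)
    have half: "int k = of_bool (odd k) + 2 * int (k div 2)" for k
      by (cases "even k") (auto elim!: evenE oddE)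
    have "int a' + e * int b' + w c = (of_bool (odd a') + e * of_bool (odd b') + w c)
       + 2 * (int (a' div 2) + e * int (b' div 2))"
      using half[of a'] half[of b'] by (simp add: algebra_simps)
    also have "\<dots> = of_bool (snd (\<delta> c (odd a') (odd b')))
       + 2 * (int (a' div 2) + e * int (b' div 2) + w (fst (\<delta> c (odd a') (odd b'))))"
      unfolding \<delta> by simp
    finally have step: "int a' + e * int b' + w c = \<dots>" .
    have "int a + e * int b = int (msb out) + 2 ^ length us * (int a' + e * int b' + w c)"
      using snoc.IH r by simp
    moreover have "k div 2 ^ length us div 2 = k div 2 ^ length (us @ [u])" for k :: nat
      by (simp only: length_append list.size add_0 add_Suc_right add_0_right power_Suc2 div_mult2_eq)
    moreover have "a' = a div 2 ^ length us" "b' = b div 2 ^ length us" "length out = length us"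
      using snoc.IH r by simp_all
    ultimately show ?case
      unfolding step r' by (simp add: msb_Cons algebra_simps)
  qed
  note inv = this[of "True # bits a @ bits b"]
  let ?i = "length (True # bits a @ bits b)"
  have t: "fst (transduce \<delta> a b) = fst (run (True # bits a @ bits b))"
    "snd (transduce \<delta> a b) = msb (snd (snd (snd (run (True # bits a @ bits b)))))"
    by (simp_all add: transduce_def run_def Let_def)
  have "a < 2 ^ length (bits a @ bits b)" "b < 2 ^ length (bits a @ bits b)"
    using nat_less_length_bits[of a] nat_less_length_bits[of b]
    by (auto intro: less_le_trans[OF _ power_increasing])
  then have ab: "a + b < 2 ^ ?i" by simp
  then have "a div 2 ^ ?i = 0" "b div 2 ^ ?i = 0" by simp_all
  then have "int a + e * int b = int (snd (transduce \<delta> a b)) + 2 ^ ?i * w (fst (transduce \<delta> a b))"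
    using inv unfolding t by simp
  moreover have "snd (transduce \<delta> a b) < 2 ^ ?i"
    using msb_less inv unfolding t by metis
  ultimately show ?thesis using ab by blast
qed

section \<open>Addition, subtraction and comparison\<close>

definition adder :: "bool \<Rightarrow> bool \<Rightarrow> bool \<Rightarrow> bool \<times> bool" where
  "adder c x y = (c \<and> x \<or> c \<and> y \<or> x \<and> y, (c \<noteq> x) \<noteq> y)"

definition subtractor :: "bool \<Rightarrow> bool \<Rightarrow> bool \<Rightarrow> bool \<times> bool" where
  "subtractor c x y = (\<not> x \<and> y \<or> c \<and> (\<not> x \<or> y), (c \<noteq> x) \<noteq> y)"

text \<open>The final carry is discarded by \<open>snd\<close>; it is 0 because a + b < 2^i.\<close>

lemma transduce_adder: "snd (transduce adder a b) = a + b"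
proof -
  have \<delta>: "of_bool x + 1 * of_bool y + of_bool c = of_bool (snd (adder c x y)) + 2 * (of_bool (fst (adder c x y)) :: int)"
    for c x y by (cases c; cases x; cases y) (simp_all add: adder_def)
  obtain i where i: "int a + 1 * int b = int (snd (transduce adder a b)) + 2 ^ i * of_bool (fst (transduce adder a b))"
     "a + b < 2 ^ i"
    using transduce_correct[of 1 of_bool adder, OF \<delta> of_bool_eq(1)] by blast
  have "int (a + b) < int (2 ^ i)" using i(2) by (simp only: of_nat_less_iff)
  then have "int a + int b < 2 ^ i" by simp
  then have "\<not> fst (transduce adder a b)" using i(1) by (cases "fst (transduce adder a b)") simp_all
  then show ?thesis using i(1) by simp
qed

text \<open>The output lies in [0, 2^i), so the final borrow is set exactly when the difference is
  negative; the subtractor thereby also decides the order.\<close>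

lemma transduce_subtractor:
  "fst (transduce subtractor a b) \<longleftrightarrow> a < b" "b \<le> a \<Longrightarrow> snd (transduce subtractor a b) = a - b"
proof -
  have \<delta>: "of_bool x + (-1) * of_bool y + - of_bool c
      = of_bool (snd (subtractor c x y)) + 2 * (- of_bool (fst (subtractor c x y)) :: int)"
    for c x y by (cases c; cases x; cases y) (simp_all add: subtractor_def)
  obtain i where i: "int a + (-1) * int b = int (snd (transduce subtractor a b)) + 2 ^ i * - of_bool (fst (transduce subtractor a b))"
     "snd (transduce subtractor a b) < 2 ^ i"
    using transduce_correct[of "-1" "\<lambda>c. - of_bool c" subtractor, OF \<delta>] by (auto simp only: of_bool_eq minus_zero)
  define N :: int where "N = 2 ^ i"
  have "int (snd (transduce subtractor a b)) < int (2 ^ i)" using i(2) by (simp only: of_nat_less_iff)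
  then have "int (snd (transduce subtractor a b)) < N" by (simp add: N_def)
  moreover have "int a - int b = int (snd (transduce subtractor a b)) - (if fst (transduce subtractor a b) then N else 0)"
    using i(1) by (simp add: N_def)
  ultimately show "fst (transduce subtractor a b) \<longleftrightarrow> a < b" "b \<le> a \<Longrightarrow> snd (transduce subtractor a b) = a - b"
    by (simp_all split: if_splits)
qed

lemma ptime_nat_add [ptime]:
  assumes "ptime a" "ptime b" shows "ptime (\<lambda>x. a x + b x :: nat)"
  using ptime_snd[OF ptime_transduce[OF assms]] by (simp flip: transduce_adder)

lemma ptime_nat_less [ptime]:
  assumes "ptime a" "ptime b" shows "ptime (\<lambda>x. a x < (b x :: nat))"
  using ptime_fst[OF ptime_transduce[OF assms]] by (simp flip: transduce_subtractor(1))

lemma ptime_nat_diff [ptime]: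
  assumes "ptime a" "ptime b" shows "ptime (\<lambda>x. a x - b x :: nat)"
proof -
  have "a - b = (if a < b then 0 else snd (transduce subtractor a b))" for a b
    by (simp add: transduce_subtractor)
  then show ?thesis by (simp only:) (intro ptime ptime_transduce assms)
qed

lemma ptime_nat_mult [ptime]:
  assumes "ptime a" "ptime b" shows "ptime (\<lambda>x. a x * b x :: nat)"
proof -
  \<comment> \<open>Horner's rule over the bits of the first factor, leading bit first: every
    intermediate value is a prefix of that factor times \<open>b\<close>, which bounds its
    size.\<close>
  define h where "h = (\<lambda>b. foldl (\<lambda>v c. v + v + (if c then b else 0 :: nat)) 0)"
  have h: "h b cs = msb cs * b" for b cs
    by (induction cs rule: rev_induct) (auto simp: h_def algebra_simps)
  have "ptime (\<lambda>x. h (b x) (rev (bits (a x))))"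
    unfolding h_def
  proof (rule ptime_foldl[where step = "\<lambda>x v c. v + v + (if c then b x else 0 :: nat)"])
    show "pbounded (\<lambda>x. Suc (4 * (sz (a x) + sz (b x))))" by (intro ptime pbounded_sz_ptime assms)
    fix x us vs assume us: "rev (bits (a x)) = us @ vs"
    have "length us \<le> sz (a x)" using arg_cong[OF us, of length] length_bits[of "a x"] by simp
    then have "msb us < 2 ^ sz (a x)"
      by (intro less_le_trans[OF msb_less power_increasing]) auto
    then have "msb us * b x < 2 ^ (sz (a x) + sz (b x))"
      unfolding power_add using sz_nat_less[of "b x"] by (intro mult_strict_mono) auto
    from sz_nat_le[OF this] show "sz (foldl (\<lambda>v c. v + v + (if c then b x else 0 :: nat)) 0 us) \<le> Suc (4 * (sz (a x) + sz (b x)))"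
      using h[of "b x" us] by (simp add: h_def)
  qed (intro ptime assms ptime_comp[OF assms(2)])+
  then show ?thesis by (simp add: h msb_bits)
qed

section \<open>Integers as sign and magnitude\<close>

definition signed :: "bool \<Rightarrow> nat \<Rightarrow> int" where
  "signed c a = (if c then - int a else int a)"

lemma enc_int: "enc i = Bin (enc (i < 0)) (enc (nat \<bar>i\<bar>))"
  by (simp add: enc_int_def int_code_def enc_bool_def enc_nat_def)

lemma ptime_signed [ptime]:
  assumes "ptime c" "ptime a" shows "ptime (\<lambda>x. signed (c x) (a x))"
proof (rule ptime_retype)
  \<comment> \<open>Zero is coded with the nonnegative sign only, so the sign bit must be
    normalized.\<close>
  show "enc (signed (c x) (a x)) = enc (if a x = 0 then (False, 0) else (c x, a x))" for x
    by (auto simp: enc_int signed_def)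
qed (intro ptime assms)

lemma ptime_neg [ptime]:
  assumes "ptime f" shows "ptime (\<lambda>x. f x < (0 :: int))"
proof -
  have "ptime (\<lambda>i :: int. (i < 0, nat \<bar>i\<bar>))"
    by (rule ptime_retype[OF ptime_id]) (simp add: enc_int)
  from ptime_fst[OF ptime_comp[OF this assms]] show ?thesis by simp
qed

lemma ptime_abs [ptime]:
  assumes "ptime f" shows "ptime (\<lambda>x. nat \<bar>f x :: int\<bar>)"
proof -
  have "ptime (\<lambda>i :: int. (i < 0, nat \<bar>i\<bar>))"
    by (rule ptime_retype[OF ptime_id]) (simp add: enc_int)
  from ptime_snd[OF ptime_comp[OF this assms]] show ?thesis by simp
qed

lemma ptime_uminus [ptime]:
  assumes "ptime f" shows "ptime (\<lambda>x. - f x :: int)"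
proof -
  have "- i = signed (\<not> i < 0) (nat \<bar>i\<bar>)" for i :: int by (auto simp: signed_def)
  then show ?thesis by (simp only:) (intro ptime assms)
qed

lemma ptime_add [ptime]:
  assumes "ptime f" "ptime g" shows "ptime (\<lambda>x. f x + g x :: int)"
proof -
  have "i + j = (if (i < 0) = (j < 0) then signed (i < 0) (nat \<bar>i\<bar> + nat \<bar>j\<bar>)
      else if nat \<bar>i\<bar> < nat \<bar>j\<bar> then signed (j < 0) (nat \<bar>j\<bar> - nat \<bar>i\<bar>)
      else signed (i < 0) (nat \<bar>i\<bar> - nat \<bar>j\<bar>))" for i j :: int
    by (auto simp: signed_def)
  then show ?thesis by (simp only:) (intro ptime assms)
qed

lemma ptime_diff [ptime]:
  assumes "ptime f" "ptime g" shows "ptime (\<lambda>x. f x - g x :: int)"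
  unfolding diff_conv_add_uminus by (intro ptime assms)

lemma ptime_mult [ptime]:
  assumes "ptime f" "ptime g" shows "ptime (\<lambda>x. f x * g x :: int)"
proof -
  have "i * j = signed ((i < 0) \<noteq> (j < 0)) (nat \<bar>i\<bar> * nat \<bar>j\<bar>)" for i j :: int
    by (cases "i < 0"; cases "j < 0") (simp_all add: signed_def)
  then show ?thesis by (simp only:) (intro ptime assms)
qed

lemma ptime_less [ptime]:
  assumes "ptime f" "ptime g" shows "ptime (\<lambda>x. f x < (g x :: int))"
proof -
  have "(\<lambda>x. f x < g x) = (\<lambda>x. f x - g x < 0)" by auto
  then show ?thesis using ptime_neg[OF ptime_diff[OF assms]] by simp
qed

lemma sz_int_less: "\<bar>i\<bar> < 2 ^ sz (i :: int)"
proof -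
  have "nat \<bar>i\<bar> < 2 ^ sz (nat \<bar>i\<bar>)" by (rule sz_nat_less)
  also have "\<dots> \<le> 2 ^ sz i" by (intro power_increasing) (auto simp: enc_int)
  finally show ?thesis by (simp add: nat_less_iff)
qed

lemma sz_int_le: "\<bar>i\<bar> < 2 ^ k \<Longrightarrow> sz (i :: int) \<le> 4 * k + 5"
  using sz_nat_le[of "nat \<bar>i\<bar>" k] sz_bool[of "i < 0"] by (simp add: enc_int nat_less_iff)

section \<open>Computing the chain\<close>

type_synonym frac = "int \<times> int"

section \<open>Unreduced fractions\<close>

definition fadd :: "frac \<Rightarrow> frac \<Rightarrow> frac" where
  "fadd x y = (fst x * snd y + fst y * snd x, snd x * snd y)"

definition fsub :: "frac \<Rightarrow> frac \<Rightarrow> frac" where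
  "fsub x y = (fst x * snd y - fst y * snd x, snd x * snd y)"

definition fmul :: "frac \<Rightarrow> frac \<Rightarrow> frac" where
  "fmul x y = (fst x * fst y, snd x * snd y)"

text \<open>The denominator of the quotient is positive only for a positive divisor; the divisors
  are masses of sellers.\<close>

definition fdiv :: "frac \<Rightarrow> frac \<Rightarrow> frac" where
  "fdiv x y = (fst x * snd y, snd x * fst y)"

definition fsum :: "frac list \<Rightarrow> frac" where
  "fsum = foldl fadd (0, 1)"

definition fclamp :: "frac \<Rightarrow> frac" where
  "fclamp x = (if fst x < 0 then (0, 1) else if snd x < fst x then (1, 1) else x)"

lemma ptime_frac [ptime]:
  assumes "ptime f" "ptime g"
  shows "ptime (\<lambda>x. fadd (f x) (g x))" "ptime (\<lambda>x. fsub (f x) (g x))"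
    "ptime (\<lambda>x. fmul (f x) (g x))" "ptime (\<lambda>x. fdiv (f x) (g x))"
  unfolding fadd_def fsub_def fmul_def fdiv_def by (intro ptime assms)+

lemma ptime_fclamp [ptime]: "ptime f \<Longrightarrow> ptime (\<lambda>x. fclamp (f x))"
  unfolding fclamp_def by (intro ptime)

lemma abs_mult_less: "\<bar>i\<bar> < 2 ^ a \<Longrightarrow> \<bar>j\<bar> < 2 ^ b \<Longrightarrow> a + b \<le> c \<Longrightarrow> \<bar>i * j\<bar> < 2 ^ c" for i j :: int
proof -
  assume "\<bar>i\<bar> < 2 ^ a" "\<bar>j\<bar> < 2 ^ b" "a + b \<le> c"
  then have "\<bar>i * j\<bar> < 2 ^ a * 2 ^ b" unfolding abs_mult by (intro mult_strict_mono) auto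
  also have "\<dots> \<le> 2 ^ c" unfolding power_add[symmetric] using \<open>a + b \<le> c\<close> by (intro power_increasing) auto
  finally show ?thesis .
qed

lemma abs_add_less: "\<bar>i\<bar> < 2 ^ a \<Longrightarrow> \<bar>j\<bar> < 2 ^ a \<Longrightarrow> Suc a \<le> c \<Longrightarrow> \<bar>i + j\<bar> < 2 ^ c" for i j :: int
proof -
  assume "\<bar>i\<bar> < 2 ^ a" "\<bar>j\<bar> < 2 ^ a" "Suc a \<le> c"
  then have "\<bar>i + j\<bar> < 2 ^ Suc a" by simp
  also have "\<dots> \<le> 2 ^ c" using \<open>Suc a \<le> c\<close> by (intro power_increasing) auto
  finally show ?thesis .
qed

lemma abs_less_mono: "\<bar>i\<bar> < 2 ^ a \<Longrightarrow> a \<le> c \<Longrightarrow> \<bar>i\<bar> < (2 :: int) ^ c"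
  by (rule less_le_trans[OF _ power_increasing]) auto

definition fbits :: "nat \<Rightarrow> frac \<Rightarrow> bool" where
  "fbits k x \<longleftrightarrow> \<bar>fst x\<bar> < 2 ^ k \<and> \<bar>snd x\<bar> < 2 ^ k"

lemma fbits_sz: "sz x \<le> k \<Longrightarrow> fbits k x"
  unfolding fbits_def
  by (auto intro!: abs_less_mono[OF sz_int_less] simp: enc_prod_def)

lemma sz_fbits: "fbits k x \<Longrightarrow> sz x \<le> 8 * k + 11"
  using sz_int_le[of "fst x" k] sz_int_le[of "snd x" k] by (simp add: fbits_def enc_prod_def)

lemma fbits_fadd:
  assumes "fbits a x" "fbits b y" shows "fbits (Suc (a + b)) (fadd x y)"
  using assms unfolding fadd_def fbits_def fst_conv snd_conv
  by (intro conjI abs_add_less[of _ "a + b"] abs_mult_less[of _ a _ b] abs_mult_less[of _ b _ a]) auto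

text \<open>Unreduced denominators multiply, but every summand is part of the given list, so bit
  lengths merely add up to at most quadratic length.\<close>

lemma ptime_fsum [ptime]:
  assumes "ptime xs" shows "ptime (\<lambda>x. fsum (xs x))"
  unfolding fsum_def
proof (rule ptime_foldl)
  show "pbounded (\<lambda>x. 8 * Suc (sz (xs x) * Suc (sz (xs x))) + 11)"
    by (intro ptime pbounded_sz_ptime assms)
  fix x us vs assume us: "xs x = us @ vs"
  have "fbits (Suc (length us * Suc (sz (xs x)))) (foldl fadd (0, 1) us)"
    if "\<forall>y\<in>set us. fbits (sz (xs x)) y" for us
    using that
  proof (induction us rule: rev_induct)
    case Nil then show ?case by (simp add: fbits_def)
  next
    case (snoc y us)
    then have "fbits (Suc (Suc (length us * Suc (sz (xs x))) + sz (xs x))) (fadd (foldl fadd (0, 1) us) y)"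
      by (intro fbits_fadd) auto
    then show ?case by (simp add: algebra_simps)
  qed
  moreover have "\<forall>y\<in>set us. fbits (sz (xs x)) y"
    using us sz_mem[of _ "xs x"] by (auto intro!: fbits_sz less_imp_le)
  ultimately have "sz (foldl fadd (0, 1) us) \<le> 8 * Suc (length us * Suc (sz (xs x))) + 11"
    by (intro sz_fbits) auto
  also have "\<dots> \<le> 8 * Suc (sz (xs x) * Suc (sz (xs x))) + 11"
    using length_le_sz[of "xs x"] us by (intro add_mono mult_le_mono Suc_leI le_imp_less_Suc order_refl) simp
  finally show "sz (foldl fadd (0, 1) us) \<le> 8 * Suc (sz (xs x) * Suc (sz (xs x))) + 11" .
qed (intro ptime assms)+

lemma ptime_Let [ptime]:
  assumes "ptime (\<lambda>p. g (fst p) (snd p))" "ptime f"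
  shows "ptime (\<lambda>x. let y = f x in g x y)"
  unfolding Let_def by (rule ptime_comp2[OF assms(1) ptime_id assms(2)])

definition fbest :: "frac \<Rightarrow> frac list \<Rightarrow> frac" where
  "fbest = foldl (\<lambda>x y. if fst x * snd y < fst y * snd x then y else x)"

text \<open>The maximum is selected among the given fractions rather than recomputed, so its size is
  bounded by the input.\<close>

lemma fbest_mem: "fbest x ys = x \<or> fbest x ys \<in> set ys"
  by (induction ys rule: rev_induct) (auto simp: fbest_def)

lemma ptime_fbest [ptime]:
  assumes "ptime f" "ptime g" shows "ptime (\<lambda>x. fbest (f x) (g x))"
  unfolding fbest_def
proof (rule ptime_foldl)
  show "pbounded (\<lambda>x. sz (f x) + sz (g x))" by (intro ptime pbounded_sz_ptime assms)
  fix x us vs assume us: "g x = us @ vs"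
  show "sz (foldl (\<lambda>x y. if fst x * snd y < fst y * snd x then y else x) (f x) us) \<le> sz (f x) + sz (g x)"
    using fbest_mem[of "f x" us] sz_mem[of "fbest (f x) us" "g x"] us by (auto simp: fbest_def)
qed (intro ptime assms)+

type_synonym instance_code = "frac \<times> frac list \<times> frac list \<times> frac list \<times> frac list list"

text \<open>Positions in lists are unary numbers \<open>i :: unit list\<close> counted from \<open>0\<close>, so position \<open>i\<close>
  holds the type with index \<open>length i + 1\<close>; \<open>tl i\<close> is the preceding position.\<close>

definition item :: "'a list \<Rightarrow> unit list \<Rightarrow> 'a" where
  "item xs i = hd (drop (length i) xs)"

lemma ptime_item [ptime]: "ptime f \<Longrightarrow> ptime g \<Longrightarrow> ptime (\<lambda>x. item (f x :: 'a :: enc list) (g x))"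
  unfolding item_def by (intro ptime ptime_drop)

section \<open>Coefficients of the recursion\<close>

definition cb :: "instance_code \<Rightarrow> unit list \<Rightarrow> frac" where "cb e i = item (fst (snd e)) i"
definition cs :: "instance_code \<Rightarrow> unit list \<Rightarrow> frac" where "cs e i = item (fst (snd (snd e))) i"
definition cf :: "instance_code \<Rightarrow> unit list \<Rightarrow> frac" where "cf e i = item (fst (snd (snd (snd e)))) i"
text \<open>The rows of targets start at level 0, so position r holds level r without the shift by
  one that applies to types.\<close>

definition cC :: "instance_code \<Rightarrow> unit list \<Rightarrow> unit list \<Rightarrow> frac" where
  "cC e r i = item (item (snd (snd (snd (snd e)))) r) i"

definition ccum :: "instance_code \<Rightarrow> unit list \<Rightarrow> frac" where
  "ccum e i = fsum (map (cf e) (below i))"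

text \<open>At position 0, \<open>tl []\<close> is \<open>[]\<close> and the difference of costs
  vanishes; the exceptional first virtual cost needs no branch.\<close>

definition cscore :: "instance_code \<Rightarrow> unit list \<Rightarrow> frac" where
  "cscore e i = fadd (cs e i) (fmul (fst e)
     (fadd (cs e i) (fdiv (fmul (fsub (cs e i) (cs e (tl i))) (ccum e i)) (cf e i))))"

definition cexcess :: "instance_code \<Rightarrow> unit list \<Rightarrow> frac" where
  "cexcess e i = fsum (map (\<lambda>j. fmul (cf e j) (fsub (cscore e i) (cscore e j))) (below i))"

definition cslope :: "instance_code \<Rightarrow> unit list \<Rightarrow> unit list \<Rightarrow> frac" where
  "cslope e l j = fsub (fmul (fadd (1, 1) (fst e)) (cb e l)) (cscore e j)"

definition cgap :: "instance_code \<Rightarrow> unit list \<Rightarrow> unit list \<Rightarrow> unit list \<Rightarrow> frac" where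
  "cgap e r l j = fsub (cC e r l) (cexcess e j)"

text \<open>At position 0 the difference is 0, matching the dummy stage of \<open>chain\<close>,
  whose increment is multiplied by level 0.\<close>

definition cincr :: "instance_code \<Rightarrow> unit list \<Rightarrow> frac" where
  "cincr e l = fmul (fst e) (fsub (cb e l) (cb e (tl l)))"

lemma ptime_c1 [ptime]:
  assumes "ptime f" "ptime g"
  shows "ptime (\<lambda>x. cb (f x) (g x))" "ptime (\<lambda>x. cs (f x) (g x))" "ptime (\<lambda>x. cf (f x) (g x))"
  unfolding cb_def cs_def cf_def by (intro ptime assms)+

lemma ptime_cC [ptime]:
  assumes "ptime f" "ptime g" "ptime h" shows "ptime (\<lambda>x. cC (f x) (g x) (h x))"
  unfolding cC_def by (intro ptime assms)

lemma ptime_ccum [ptime]: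
  assumes "ptime f" "ptime g" shows "ptime (\<lambda>x. ccum (f x) (g x))"
proof -
  have "ptime (\<lambda>p. ccum (fst p) (snd p))" unfolding ccum_def by (intro ptime)
  from ptime_comp2[OF this assms] show ?thesis .
qed

lemma ptime_c2 [ptime]:
  assumes "ptime f" "ptime g"
  shows "ptime (\<lambda>x. cscore (f x) (g x))" "ptime (\<lambda>x. cincr (f x) (g x))"
  unfolding cscore_def cincr_def by (intro ptime assms)+

lemma ptime_cexcess [ptime]:
  assumes "ptime f" "ptime g" shows "ptime (\<lambda>x. cexcess (f x) (g x))"
proof -
  have "ptime (\<lambda>p. cexcess (fst p) (snd p))" unfolding cexcess_def by (intro ptime)
  from ptime_comp2[OF this assms] show ?thesis .
qed

lemma ptime_cslope [ptime]:
  assumes "ptime f" "ptime g" "ptime h" shows "ptime (\<lambda>x. cslope (f x) (g x) (h x))"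
  unfolding cslope_def by (intro ptime assms)

lemma ptime_cgap [ptime]:
  assumes "ptime f" "ptime g" "ptime h" "ptime k" shows "ptime (\<lambda>x. cgap (f x) (g x) (h x) (k x))"
  unfolding cgap_def by (intro ptime assms)

text \<open>The state \<open>(P, A, Q)\<close> of the recursion represents the accumulated rent \<open>P / Q\<close> and the
  current level \<open>A / Q\<close>.  Unreduced sums would square the denominator in every step; over a
  common denominator its length only grows by the length of the new coefficients.\<close>

definition ccandidate :: "instance_code \<Rightarrow> unit list \<Rightarrow> unit list \<Rightarrow> int \<times> int \<times> int \<Rightarrow> unit list \<Rightarrow> frac" where
  "ccandidate e r l s j =
     (if 0 < fst (cslope e l j)
      then ((fst (cgap e r l j) * snd (snd s) + snd (cgap e r l j) * fst s) * snd (cslope e l j),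
            snd (cgap e r l j) * fst (cslope e l j))
      else (fst (snd s), 1))"

text \<open>Adds the rent due to the current level and brings all three entries over the denominator
  extended by that of the increment.\<close>

definition cscale :: "instance_code \<Rightarrow> unit list \<Rightarrow> int \<times> int \<times> int \<Rightarrow> int \<times> int \<times> int" where
  "cscale e l s = (fst s * snd (cincr e l) + fst (cincr e l) * fst (snd s),
     fst (snd s) * snd (cincr e l), snd (snd s) * snd (cincr e l))"

text \<open>Candidates are measured in units of 1 / Q, so the current level enters as
  \<open>A / 1\<close>. Sellers of nonpositive slope also contribute \<open>A\<close>, which leaves
  the maximum unchanged.\<close>

definition cbest :: "instance_code \<Rightarrow> unit list \<Rightarrow> unit list \<Rightarrow> int \<times> int \<times> int \<Rightarrow> frac" where
  "cbest e r l s = fbest (fst (snd s), 1) (map (ccandidate e r l s) (below r))"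

definition cstep :: "instance_code \<Rightarrow> unit list \<Rightarrow> int \<times> int \<times> int \<Rightarrow> unit list \<Rightarrow> int \<times> int \<times> int" where
  "cstep e r s l = (let s' = cscale e l s; u = cbest e r l s'
     in (fst s' * snd u, fst u, snd (snd s') * snd u))"

definition cchain :: "instance_code \<Rightarrow> unit list \<Rightarrow> unit list \<Rightarrow> int \<times> int \<times> int" where
  "cchain e r l = foldl (cstep e r) (0, 0, 1) (below l)"

lemma ptime_cscale:
  assumes "ptime f" "ptime g" "ptime h" shows "ptime (\<lambda>x. cscale (f x) (g x) (h x))"
  unfolding cscale_def by (intro ptime assms)

lemma ptime_cbest:
  assumes "ptime f" "ptime g" "ptime h" "ptime k" shows "ptime (\<lambda>x. cbest (f x) (g x) (h x) (k x))"
proof -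
  have "ptime (\<lambda>p. cbest (fst p) (fst (snd p)) (fst (snd (snd p))) (snd (snd (snd p))))"
    unfolding cbest_def ccandidate_def by (intro ptime)
  from ptime_comp[OF this ptime_Pair[OF assms(1) ptime_Pair[OF assms(2) ptime_Pair[OF assms(3,4)]]]]
  show ?thesis by simp
qed

lemma ptime_cstep:
  assumes "ptime f" "ptime g" "ptime h" "ptime k" shows "ptime (\<lambda>x. cstep (f x) (g x) (h x) (k x))"
proof -
  have "ptime (\<lambda>p. cstep (fst p) (fst (snd p)) (fst (snd (snd p))) (snd (snd (snd p))))"
    unfolding cstep_def by (intro ptime ptime_cscale ptime_cbest)
  from ptime_comp[OF this ptime_Pair[OF assms(1) ptime_Pair[OF assms(2) ptime_Pair[OF assms(3,4)]]]]
  show ?thesis by simp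
qed

section \<open>Length of the integers in the recursion\<close>

definition sbits :: "nat \<Rightarrow> int \<times> int \<times> int \<Rightarrow> bool" where
  "sbits k s \<longleftrightarrow> \<bar>fst s\<bar> < 2 ^ k \<and> \<bar>fst (snd s)\<bar> < 2 ^ k \<and> \<bar>snd (snd s)\<bar> < 2 ^ k"

lemma sz_sbits: "sbits k s \<Longrightarrow> sz s \<le> 12 * k + 17"
  using sz_int_le[of "fst s" k] sz_int_le[of "fst (snd s)" k] sz_int_le[of "snd (snd s)" k]
  by (simp add: sbits_def enc_prod_def)

text \<open>The growth 3 M + 2 does not depend on the present length k, so lengths increase linearly
  in the number of steps. It is reached by a candidate numerator: scaling, the gap and the
  denominator of the slope cost M bits each, and two additions one bit each.\<close>

lemma sbits_cstep:
  assumes s: "sbits k s" and u: "fbits M (cincr e l)"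
    and j: "\<And>j. j \<in> set (below r) \<Longrightarrow> fbits M (cslope e l j) \<and> fbits M (cgap e r l j)"
  shows "sbits (k + (3 * M + 2)) (cstep e r s l)"
proof -
  define s' where "s' = cscale e l s"
  have s': "\<bar>fst s'\<bar> < 2 ^ (Suc (k + M))" "\<bar>fst (snd s')\<bar> < 2 ^ (k + M)" "\<bar>snd (snd s')\<bar> < 2 ^ (k + M)"
  proof -
    have b: "\<bar>fst s\<bar> < 2 ^ k" "\<bar>fst (snd s)\<bar> < 2 ^ k" "\<bar>snd (snd s)\<bar> < 2 ^ k"
      "\<bar>fst (cincr e l)\<bar> < 2 ^ M" "\<bar>snd (cincr e l)\<bar> < 2 ^ M"
      using s u by (auto simp: sbits_def fbits_def)
    show "\<bar>fst s'\<bar> < 2 ^ (Suc (k + M))" unfolding s'_def cscale_def fst_conv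
      by (rule abs_add_less[OF abs_mult_less[OF b(1,5)] abs_mult_less[OF b(4,2)]]) auto
    show "\<bar>fst (snd s')\<bar> < 2 ^ (k + M)" "\<bar>snd (snd s')\<bar> < 2 ^ (k + M)"
      unfolding s'_def cscale_def fst_conv snd_conv
      by (rule abs_mult_less[OF b(2,5)], simp, rule abs_mult_less[OF b(3,5)], simp)
  qed
  \<comment> \<open>The exponent 2 M + 1 instead of 2 M keeps the bound on the denominator 1 strict
    when M = 0.\<close>
  have triv: "\<bar>fst (snd s')\<bar> < 2 ^ (k + (3 * M + 2))" "(1 :: int) < 2 ^ (2 * M + 1)"
    by (rule abs_less_mono[OF s'(2)], simp, rule one_less_power) auto
  have "\<bar>fst u\<bar> < 2 ^ (k + (3 * M + 2)) \<and> \<bar>snd u\<bar> < 2 ^ (2 * M + 1)"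
    if "u = (fst (snd s'), 1) \<or> u \<in> set (map (ccandidate e r l s') (below r))" for u
    using that
  proof
    assume "u = (fst (snd s'), 1)"
    then show ?thesis using triv by simp
  next
    assume "u \<in> set (map (ccandidate e r l s') (below r))"
    then obtain i where i: "i \<in> set (below r)" "u = ccandidate e r l s' i" by auto
    show ?thesis
    proof (cases "0 < fst (cslope e l i)")
      case True
      have "\<bar>(fst (cgap e r l i) * snd (snd s') + snd (cgap e r l i) * fst s') * snd (cslope e l i)\<bar>
          < 2 ^ (k + (3 * M + 2))"
        using j[OF i(1)] s' unfolding fbits_def
        by (intro abs_mult_less[of _ "k + 2 * M + 2" _ M] abs_add_less[of _ "k + 2 * M + 1"]
             abs_mult_less[of _ M _ "k + M"] abs_mult_less[of _ M _ "Suc (k + M)"]) auto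
      moreover have "\<bar>snd (cgap e r l i) * fst (cslope e l i)\<bar> < 2 ^ (2 * M + 1)"
        using j[OF i(1)] unfolding fbits_def by (intro abs_mult_less[of _ M _ M]) auto
      ultimately show ?thesis using True i(2) by (simp add: ccandidate_def)
    next
      case False
      then show ?thesis using i(2) triv by (simp add: ccandidate_def)
    qed
  qed
  then have u: "\<bar>fst (cbest e r l s')\<bar> < 2 ^ (k + (3 * M + 2)) \<and> \<bar>snd (cbest e r l s')\<bar> < 2 ^ (2 * M + 1)"
    unfolding cbest_def using fbest_mem by blast
  show ?thesis
    unfolding cstep_def Let_def s'_def[symmetric] sbits_def fst_conv snd_conv
    by (intro conjI conjunct1[OF u] abs_mult_less[OF s'(1) conjunct2[OF u]]
        abs_mult_less[OF s'(3) conjunct2[OF u]]) auto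
qed

lemma sz_below: "j \<in> set (below r) \<Longrightarrow> sz j \<le> sz (r :: 'a :: enc list)"
  by (induction r) auto

text \<open>The coefficients are polynomial time functions, hence of polynomial size, uniformly in
  all positions visited. This supplies one M for every step and thereby the bound required of a
  fold.\<close>

lemma ptime_cchain [ptime]:
  assumes "ptime f" "ptime g" "ptime h" shows "ptime (\<lambda>x. cchain (f x) (g x) (h x))"
proof -
  have "pbounded (\<lambda>p :: instance_code \<times> unit list. sz (cincr (fst p) (snd p)))"
    by (intro pbounded_sz_ptime ptime)
  then obtain p1 where p1: "\<And>p :: instance_code \<times> unit list. sz (cincr (fst p) (snd p)) \<le> poly p1 (sz p)"
    unfolding pbounded_def by metis
  have "pbounded (\<lambda>p :: instance_code \<times> unit list \<times> unit list. sz (cslope (fst p) (fst (snd p)) (snd (snd p))))"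
    by (intro pbounded_sz_ptime ptime)
  then obtain p2 where p2: "\<And>p :: instance_code \<times> unit list \<times> unit list.
      sz (cslope (fst p) (fst (snd p)) (snd (snd p))) \<le> poly p2 (sz p)"
    unfolding pbounded_def by metis
  have "pbounded (\<lambda>p :: instance_code \<times> unit list \<times> unit list \<times> unit list.
      sz (cgap (fst p) (fst (snd p)) (fst (snd (snd p))) (snd (snd (snd p)))))"
    by (intro pbounded_sz_ptime ptime)
  then obtain p3 where p3: "\<And>p :: instance_code \<times> unit list \<times> unit list \<times> unit list.
      sz (cgap (fst p) (fst (snd p)) (fst (snd (snd p))) (snd (snd (snd p)))) \<le> poly p3 (sz p)"
    unfolding pbounded_def by metis
  \<comment> \<open>W dominates the size of every argument tuple of a coefficient. The unary number
    r counts twice, once for itself and once for the position j below it; 3 is for the pairing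
    nodes.\<close>
  define W where "W = (\<lambda>x :: instance_code \<times> unit list \<times> unit list.
     sz (fst x) + 2 * sz (fst (snd x)) + sz (snd (snd x)) + 3)"
  define M where "M = (\<lambda>x. poly p1 (W x) + poly p2 (W x) + poly p3 (W x))"
  define B where "B = (\<lambda>x :: instance_code \<times> unit list \<times> unit list.
     12 * (1 + sz (snd (snd x)) * (3 * M x + 2)) + 17)"
  have "pbounded W" unfolding W_def by (intro ptime pbounded_sz_ptime)
  then have "pbounded M" unfolding M_def by (intro ptime pbounded_poly)
  then have B: "pbounded B" unfolding B_def by (intro ptime pbounded_sz_ptime)
  have bits: "fbits (M x) (cincr (fst x) l)"
    "j \<in> set (below (fst (snd x))) \<Longrightarrow> fbits (M x) (cslope (fst x) l j)"
    "j \<in> set (below (fst (snd x))) \<Longrightarrow> fbits (M x) (cgap (fst x) (fst (snd x)) l j)"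
    if l: "l \<in> set (below (snd (snd x)))" for x l j
  proof -
    have lx: "sz l \<le> sz (snd (snd x))" using sz_below[OF l] .
    have "sz (cincr (fst x) l) \<le> poly p1 (sz (fst x, l))" using p1[of "(fst x, l)"] by simp
    also have "\<dots> \<le> poly p1 (W x)" using lx by (intro poly_nat_mono) (simp add: W_def)
    finally show "fbits (M x) (cincr (fst x) l)" by (intro fbits_sz) (simp add: M_def)
    assume j: "j \<in> set (below (fst (snd x)))"
    then have jx: "sz j \<le> sz (fst (snd x))" by (rule sz_below)
    have "sz (cslope (fst x) l j) \<le> poly p2 (sz (fst x, l, j))" using p2[of "(fst x, l, j)"] by simp
    also have "\<dots> \<le> poly p2 (W x)" using lx jx by (intro poly_nat_mono) (simp add: W_def)
    finally show "fbits (M x) (cslope (fst x) l j)" by (intro fbits_sz) (simp add: M_def)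
    have "sz (cgap (fst x) (fst (snd x)) l j) \<le> poly p3 (sz (fst x, fst (snd x), l, j))"
      using p3[of "(fst x, fst (snd x), l, j)"] by simp
    also have "\<dots> \<le> poly p3 (W x)" using lx jx by (intro poly_nat_mono) (simp add: W_def)
    finally show "fbits (M x) (cgap (fst x) (fst (snd x)) l j)" by (intro fbits_sz) (simp add: M_def)
  qed
  have "ptime (\<lambda>x :: instance_code \<times> unit list \<times> unit list. cchain (fst x) (fst (snd x)) (snd (snd x)))"
    unfolding cchain_def
  proof (rule ptime_foldl[where step = "\<lambda>x. cstep (fst x) (fst (snd x))" and B = B])
    fix x :: "instance_code \<times> unit list \<times> unit list" and us vs
    assume us: "below (snd (snd x)) = us @ vs"
    have "sbits (1 + length us * (3 * M x + 2)) (foldl (cstep (fst x) (fst (snd x))) (0, 0, 1) us)"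
      if "set us \<subseteq> set (below (snd (snd x)))" for us
      using that
    proof (induction us rule: rev_induct)
      case Nil then show ?case by (simp add: sbits_def)
    next
      case (snoc l us)
      then have "sbits (1 + length us * (3 * M x + 2) + (3 * M x + 2))
         (cstep (fst x) (fst (snd x)) (foldl (cstep (fst x) (fst (snd x))) (0, 0, 1) us) l)"
        using bits[of l x] by (intro sbits_cstep) auto
      then show ?case by (simp add: algebra_simps)
    qed
    then have "sbits (1 + length us * (3 * M x + 2)) (foldl (cstep (fst x) (fst (snd x))) (0, 0, 1) us)"
      using us by auto
    from sz_sbits[OF this]
    have "sz (foldl (cstep (fst x) (fst (snd x))) (0, 0, 1) us) \<le> 12 * (1 + length us * (3 * M x + 2)) + 17" .
    also have "length (below i) = length i" for i :: "unit list" by (induction i) auto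
    then have "length us \<le> sz (snd (snd x))"
      using arg_cong[OF us, of length] length_le_sz[of "snd (snd x)"] by simp
    then have "12 * (1 + length us * (3 * M x + 2)) + 17 \<le> B x"
      unfolding B_def by (intro add_mono mult_le_mono order_refl)
    finally show "sz (foldl (cstep (fst x) (fst (snd x))) (0, 0, 1) us) \<le> B x" .
  qed (intro ptime B ptime_cstep)+
  from ptime_comp[OF this ptime_Pair[OF assms(1) ptime_Pair[OF assms(2,3)]]] show ?thesis by simp
qed

text \<open>Position k is seller k + 1, so \<open>ccum e k\<close> is the mass strictly before that
  seller.\<close>

definition cfill :: "instance_code \<Rightarrow> unit list \<Rightarrow> frac \<Rightarrow> frac" where
  "cfill e k q = fclamp (fdiv (fsub q (ccum e k)) (cf e k))"

definition units :: "'a list \<Rightarrow> unit list" where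
  "units xs = map (\<lambda>_. ()) xs"

text \<open>\<open>() # r\<close> and \<open>() # l\<close> convert positions into levels and
  stages. From the state (P, A, Q), \<open>snd\<close> extracts the fraction A / Q.\<close>

definition csolve :: "instance_code \<Rightarrow> frac list list list" where
  "csolve e = map (\<lambda>r. map (\<lambda>k. map (\<lambda>l. cfill e k (snd (cchain e (() # r) (() # l))))
       (below (units (fst (snd e))))) (below (() # r))) (below (units (fst (snd (snd e)))))"

lemma ptime_csolve: "ptime csolve"
proof -
  have "ptime (\<lambda>e. csolve e)"
    unfolding csolve_def cfill_def units_def by (intro ptime)
  then show ?thesis by simp
qed

section \<open>Correctness of the computation\<close>

definition represents :: "frac \<Rightarrow> real \<Rightarrow> bool" where
  "represents x a \<longleftrightarrow> 0 < snd x \<and> a = of_int (fst x) / of_int (snd x)"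

lemma represents_arith:
  assumes "represents x a" "represents y c"
  shows "represents (fadd x y) (a + c)" "represents (fsub x y) (a - c)" "represents (fmul x y) (a * c)"
    "0 < c \<Longrightarrow> represents (fdiv x y) (a / c)"
  using assms
  by (auto simp: represents_def fadd_def fsub_def fmul_def fdiv_def field_simps zero_less_divide_iff)

lemma represents_fclamp: "represents x a \<Longrightarrow> represents (fclamp x) (min 1 (max 0 a))"
  by (auto simp: represents_def fclamp_def min_def max_def field_simps divide_less_0_iff zero_le_divide_iff)

abbreviation ix :: "nat \<Rightarrow> unit list" where
  "ix k \<equiv> replicate k ()"

lemma below_ix: "below (ix k) = map ix [0..<k]"
  by (induction k) auto

lemma represents_fsum:
  assumes "\<And>j. j < i \<Longrightarrow> represents (g (ix j)) (h (Suc j))"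
  shows "represents (fsum (map g (below (ix i)))) (\<Sum>k=1..i. h k)"
  using assms
proof (induction i)
  case 0 then show ?case by (simp add: fsum_def represents_def)
next
  case (Suc i)
  have snoc: "fsum (xs @ [x]) = fadd (fsum xs) x" for xs x by (simp add: fsum_def)
  show ?case using Suc by (auto simp: snoc intro!: represents_arith)
qed

lemma fbest_max:
  fixes v :: "frac \<Rightarrow> real"
  defines "v \<equiv> \<lambda>x. of_int (fst x) / of_int (snd x)"
  assumes "0 < snd x" "\<And>y. y \<in> set ys \<Longrightarrow> 0 < snd y"
  shows "0 < snd (fbest x ys) \<and> v x \<le> v (fbest x ys) \<and> (\<forall>y\<in>set ys. v y \<le> v (fbest x ys))"
  using assms(3)
proof (induction ys rule: rev_induct)
  case Nil then show ?case using assms(2) by (simp add: fbest_def)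
next
  case (snoc y ys)
  define w where "w = fbest x ys"
  have w: "0 < snd w" "v x \<le> v w" "\<forall>y\<in>set ys. v y \<le> v w" using snoc by (auto simp: w_def)
  have y: "0 < snd y" using snoc by simp
  have less: "fst w * snd y < fst y * snd w \<longleftrightarrow> v w < v y"
  proof -
    have "v w < v y \<longleftrightarrow> real_of_int (fst w * snd y) < real_of_int (fst y * snd w)"
      using w(1) y by (simp add: v_def field_simps)
    then show ?thesis by (simp only: of_int_less_iff)
  qed
  have "fbest x (ys @ [y]) = (if v w < v y then y else w)"
    unfolding less[symmetric] by (simp add: fbest_def w_def)
  then show ?case using w y by auto
qed

section \<open>Agreement of the computed and the real chain\<close>

locale coded_trade = trade +
  fixes C :: "nat \<Rightarrow> nat \<Rightarrow> real" and e :: instance_code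
  assumes rep_alpha: "represents (fst e) \<alpha>"
    and rep_b: "\<And>i. i < n \<Longrightarrow> represents (cb e (ix i)) (b (Suc i))"
    and rep_s: "\<And>i. i < m \<Longrightarrow> represents (cs e (ix i)) (s (Suc i))"
    and rep_f: "\<And>i. i < m \<Longrightarrow> represents (cf e (ix i)) (f (Suc i))"
    and rep_C: "\<And>r i. r \<le> m \<Longrightarrow> i < n \<Longrightarrow> represents (cC e (ix r) (ix i)) (C r (Suc i))"
    and length_b: "length (fst (snd e)) = n"
    and length_s: "length (fst (snd (snd e))) = m"
begin

lemma rep_cum: "i \<le> m \<Longrightarrow> represents (ccum e (ix i)) (F i)"
  unfolding ccum_def cum_def by (intro represents_fsum rep_f) simp

lemma rep_score:
  assumes "i < m" shows "represents (cscore e (ix i)) (d (Suc i))"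
proof -
  have f: "0 < f (Suc i)" using f_pos[of "Suc i"] assms by simp
  have "represents (fdiv (fmul (fsub (cs e (ix i)) (cs e (tl (ix i)))) (ccum e (ix i))) (cf e (ix i)))
      ((s (Suc i) - s i) * F i / f (Suc i))"
  proof (cases i)
    case 0
    have "represents (fdiv (fmul (fsub (cs e (ix i)) (cs e (tl (ix i)))) (ccum e (ix i))) (cf e (ix i)))
      ((s (Suc i) - s (Suc i)) * F i / f (Suc i))"
      using assms f 0 rep_s[of 0] by (intro represents_arith rep_s rep_f rep_cum) auto
    then show ?thesis using 0 by simp
  next
    case (Suc i')
    have "represents (cs e (tl (ix i))) (s i)" using rep_s[of i'] Suc assms by simp
    then show ?thesis using assms f by (intro represents_arith rep_s rep_f rep_cum) auto
  qed
  then have "represents (cscore e (ix i))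
      (s (Suc i) + \<alpha> * (s (Suc i) + (s (Suc i) - s i) * F i / f (Suc i)))"
    unfolding cscore_def using assms by (intro represents_arith(1,3) rep_s rep_alpha)
  moreover have "virtual_cost s f (Suc i) = s (Suc i) + (s (Suc i) - s i) * F i / f (Suc i)"
    by (cases "i = 0") (auto simp: virtual_cost_def)
  ultimately show ?thesis by (simp add: score_def)
qed

lemma rep_excess:
  assumes "i < m" shows "represents (cexcess e (ix i)) (K (Suc i))"
  unfolding cexcess_def excess_def atLeastLessThanSuc_atLeastAtMost
  using assms by (intro represents_fsum represents_arith rep_f rep_score) auto

lemma rep_slope:
  assumes "l < n" "j < m" shows "represents (cslope e (ix l) (ix j)) (\<beta> (Suc l) - d (Suc j))"
proof -
  have "represents (1, 1) 1" by (simp add: represents_def)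
  then show ?thesis
    unfolding cslope_def using assms by (intro represents_arith rep_b rep_score rep_alpha) auto
qed

lemma rep_gap:
  assumes "l < n" "j < m" "r \<le> m"
  shows "represents (cgap e (ix r) (ix l) (ix j)) (C r (Suc l) - K (Suc j))"
  unfolding cgap_def using assms by (intro represents_arith rep_C rep_excess)

lemma rep_incr:
  assumes "l < n"
  shows "represents (cincr e (ix l)) (if l = 0 then 0 else \<alpha> * (b (Suc l) - b l))"
proof (cases l)
  case 0
  have "represents (cincr e (ix l)) (\<alpha> * (b (Suc l) - b (Suc l)))"
    unfolding cincr_def using assms 0 rep_b[of 0] by (intro represents_arith rep_b rep_alpha) auto
  then show ?thesis using 0 by simp
next
  case (Suc l')
  have "represents (cb e (tl (ix l))) (b l)" using rep_b[of l'] Suc assms by simp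
  then have "represents (cincr e (ix l)) (\<alpha> * (b (Suc l) - b l))"
    unfolding cincr_def using assms by (intro represents_arith rep_b rep_alpha) auto
  then show ?thesis using Suc by simp
qed

text \<open>Dividing the candidates by the positive common denominator Q gives the real lower
  bounds, or the present level for sellers of nonpositive slope. Both maxima therefore range over
  the same values once the present level is included.\<close>

lemma rep_step:
  assumes r: "r \<in> {1..m}" and l: "l < n"
    and P: "represents (fst t, snd (snd t)) (fst (chain r (C r) l))"
    and A: "represents (snd t) (level r (C r) l)"
  shows "represents (fst (cstep e (ix r) t (ix l)), snd (snd (cstep e (ix r) t (ix l)))) (fst (chain r (C r) (Suc l)))
     \<and> represents (snd (cstep e (ix r) t (ix l))) (level r (C r) (Suc l))"
proof -
  define t' where "t' = cscale e (ix l) t"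
  define Q where "Q = snd (snd t')"
  define S where "S = fst (chain r (C r) l) + \<alpha> * ((b (Suc l) - b l) * level r (C r) l)"
  note u = rep_incr[OF l]
  have Q: "0 < Q"
    using P u by (simp add: Q_def t'_def cscale_def represents_def)
  have A': "level r (C r) l = of_int (fst (snd t')) / of_int Q"
    using P A u by (simp add: Q_def t'_def cscale_def represents_def)
  have P': "S = of_int (fst t') / of_int Q"
  proof -
    define v where "v = (if l = 0 then 0 else \<alpha> * (b (Suc l) - b l))"
    \<comment> \<open>At l = 0 the coded increment is 0 and the real one is arbitrary, but the dummy
      level 0 makes both products vanish.\<close>
    have "v * level r (C r) l = \<alpha> * ((b (Suc l) - b l) * level r (C r) l)"
      by (simp add: v_def)
    then have "S = fst (chain r (C r) l) + v * level r (C r) l" by (simp only: S_def)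
    also have "\<dots> = of_int (fst t') / of_int Q"
      using P A u unfolding v_def[symmetric]
      by (simp add: Q_def t'_def cscale_def represents_def field_simps)
    finally show ?thesis .
  qed
  define val where "val = (\<lambda>x :: frac. real_of_int (fst x) / of_int (snd x))"
  define cand where "cand = ccandidate e (ix r) (ix l) t'"
  define bound where "bound = (\<lambda>j. (C r (Suc l) - K j + S) / (\<beta> (Suc l) - d j))"
  have cand: "0 < snd (cand (ix j)) \<and> val (cand (ix j)) / of_int Q
       = (if d (Suc j) < \<beta> (Suc l) then bound (Suc j) else level r (C r) l)" if "j < r" for j
  proof -
    have slope: "represents (cslope e (ix l) (ix j)) (\<beta> (Suc l) - d (Suc j))"
      and gap: "represents (cgap e (ix r) (ix l) (ix j)) (C r (Suc l) - K (Suc j))"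
      using r l that by (auto intro: rep_slope rep_gap)
    have pos: "0 < fst (cslope e (ix l) (ix j)) \<longleftrightarrow> d (Suc j) < \<beta> (Suc l)"
    proof -
      have "0 < fst (cslope e (ix l) (ix j)) \<longleftrightarrow> 0 < \<beta> (Suc l) - d (Suc j)"
        using slope unfolding represents_def by (simp add: zero_less_divide_iff)
      then show ?thesis by simp
    qed
    show ?thesis
    proof (cases "d (Suc j) < \<beta> (Suc l)")
      case True
      obtain gn gd sn sd where c: "cgap e (ix r) (ix l) (ix j) = (gn, gd)" "cslope e (ix l) (ix j) = (sn, sd)"
        by (metis surj_pair)
      have p: "0 < gd" "0 < sn" "0 < sd" using gap slope pos True by (auto simp: represents_def c)
      have "bound (Suc j) = (of_int gn / of_int gd + of_int (fst t') / of_int Q) / (of_int sn / of_int sd)"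
        using gap slope by (simp add: bound_def P' represents_def c)
      also have "\<dots> = val (cand (ix j)) / of_int Q"
        using p Q by (simp add: val_def cand_def ccandidate_def c Q_def[symmetric] field_simps)
      finally show ?thesis using True p by (simp add: cand_def ccandidate_def c)
    next
      case False
      then show ?thesis using pos A' by (simp add: cand_def ccandidate_def val_def)
    qed
  qed
  define u where "u = cbest e (ix r) (ix l) t'"
  have u_def': "u = fbest (fst (snd t'), 1) (map cand (below (ix r)))"
    by (simp add: u_def cbest_def cand_def)
  have best: "0 < snd u" "val (fst (snd t'), 1) \<le> val u" "\<And>j. j < r \<Longrightarrow> val (cand (ix j)) \<le> val u"
  proof -
    have "0 < snd y" if "y \<in> set (map cand (below (ix r)))" for y
    proof -
      have "y \<in> (\<lambda>j. cand (ix j)) ` {0..<r}" using that by (simp add: below_ix)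
      then obtain j where "j < r" "y = cand (ix j)" by (elim imageE) auto
      then show ?thesis using cand by blast
    qed
    then have "0 < snd u \<and> val (fst (snd t'), 1) \<le> val u \<and> (\<forall>y\<in>set (map cand (below (ix r))). val y \<le> val u)"
      using fbest_max[of "(fst (snd t'), 1)" "map cand (below (ix r))"] unfolding u_def' val_def by simp
    then show "0 < snd u" "val (fst (snd t'), 1) \<le> val u" "\<And>j. j < r \<Longrightarrow> val (cand (ix j)) \<le> val u"
      by (simp_all add: below_ix)
  qed
  have mem: "u = (fst (snd t'), 1) \<or> (\<exists>j<r. u = cand (ix j))"
    using fbest_mem[of "(fst (snd t'), 1)" "map cand (below (ix r))"]
    unfolding u_def'[symmetric] by (auto simp: below_ix)
  have lb: "lower_bounds r (C r) S (Suc l) = bound ` {j \<in> {1..r}. d j < \<beta> (Suc l)}"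
    by (simp add: lower_bounds_def bound_def)
  have "Max (insert (level r (C r) l) (lower_bounds r (C r) S (Suc l))) = val u / of_int Q"
  proof (rule Max_eqI)
    show "finite (insert (level r (C r) l) (lower_bounds r (C r) S (Suc l)))" by simp
    have A'': "level r (C r) l = val (fst (snd t'), 1) / of_int Q" using A' by (simp add: val_def)
    fix y assume "y \<in> insert (level r (C r) l) (lower_bounds r (C r) S (Suc l))"
    then consider "y = val (fst (snd t'), 1) / of_int Q" | j where "j < r" "y = val (cand (ix j)) / of_int Q"
    proof (cases "y = level r (C r) l")
      case True then show ?thesis using that(1) A'' by simp
    next
      case False
      then obtain j where "j \<in> {1..r}" "d j < \<beta> (Suc l)" "y = bound j"
        using \<open>y \<in> _\<close> unfolding lb by auto
      then show ?thesis using that(2)[of "j - 1"] cand[of "j - 1"] by auto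
    qed
    then show "y \<le> val u / of_int Q"
      using best Q by cases (auto intro: divide_right_mono)
  next
    show "val u / of_int Q \<in> insert (level r (C r) l) (lower_bounds r (C r) S (Suc l))"
      using mem
    proof
      assume "u = (fst (snd t'), 1)"
      then show ?thesis using A' by (simp add: val_def)
    next
      assume "\<exists>j<r. u = cand (ix j)"
      then obtain j where j: "j < r" "u = cand (ix j)" by blast
      show ?thesis
      proof (cases "d (Suc j) < \<beta> (Suc l)")
        case True
        then have "val u / of_int Q = bound (Suc j)" using cand[OF j(1)] j(2) by simp
        then show ?thesis unfolding lb using j(1) True by auto
      next
        case False
        then show ?thesis using cand[OF j(1)] j(2) by simp
      qed
    qed
  qed
  then have "level r (C r) (Suc l) = val u / of_int Q" "fst (chain r (C r) (Suc l)) = S"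
    by (simp_all add: chain.simps(2) Let_def S_def)
  moreover have "cstep e (ix r) t (ix l) = (fst t' * snd u, fst u, Q * snd u)"
    by (simp add: cstep_def Let_def t'_def[symmetric] u_def[symmetric] Q_def)
  ultimately show ?thesis
    using best(1) Q P' by (simp add: represents_def val_def)
qed

lemma rep_chain:
  assumes "r \<in> {1..m}" "l \<le> n"
  shows "represents (fst (cchain e (ix r) (ix l)), snd (snd (cchain e (ix r) (ix l)))) (fst (chain r (C r) l))
     \<and> represents (snd (cchain e (ix r) (ix l))) (level r (C r) l)"
  using assms(2)
proof (induction l)
  case 0
  show ?case by (simp add: cchain_def represents_def)
next
  case (Suc l)
  have "cchain e (ix r) (ix (Suc l)) = cstep e (ix r) (cchain e (ix r) (ix l)) (ix l)"
    by (simp add: cchain_def)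
  then show ?case using rep_step[OF assms(1), of l "cchain e (ix r) (ix l)"] Suc by simp
qed

lemma rep_fill:
  assumes "k < m" "represents q a" shows "represents (cfill e (ix k) q) (fill f a (Suc k))"
  unfolding cfill_def fill_def
  using assms f_pos[of "Suc k"]
  by (intro represents_fclamp represents_arith) (auto intro!: rep_f rep_cum)

end

section \<open>From codes to data and back\<close>

lemma codes_list_enc:
  "list_all2 (\<lambda>x y. R x (enc y)) xs (ys :: 'a :: enc list) \<Longrightarrow> codes_list R xs (enc ys)"
  by (induction xs ys rule: list_all2_induct) auto

lemma codes_list_decode:
  assumes "codes_list R xs t" "\<And>x u. R x u \<Longrightarrow> \<exists>y. S x y \<and> u = enc y"
  shows "\<exists>ys :: 'a :: enc list. list_all2 S xs ys \<and> t = enc ys"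
  using assms(1)
proof (induction xs arbitrary: t)
  case Nil
  then show ?case by (intro exI[of _ "[]"]) simp
next
  case (Cons x xs)
  then obtain u v where t: "t = Bin u v" "R x u" "codes_list R xs v" by auto
  obtain ys :: "'a list" where ys: "list_all2 S xs ys" "v = enc ys" using Cons.IH[OF t(3)] by blast
  obtain y :: 'a where y: "S x y" "u = enc y" using assms(2)[OF t(2)] by blast
  then show ?case using ys t by (intro exI[of _ "y # ys"]) simp
qed

lemma codes_rat_iff: "codes_rat q t \<longleftrightarrow> (\<exists>x. represents x q \<and> t = enc x)"
  by (auto simp: codes_rat_def represents_def enc_int_def enc_prod_def)

lemma codes_vector_decode:
  assumes "codes_vector n x t"
  shows "\<exists>ys. list_all2 (\<lambda>a y. represents y a) (map x [1..<Suc n]) ys \<and> t = enc ys"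
  using assms unfolding codes_vector_def by (rule codes_list_decode) (auto simp: codes_rat_iff)

lemma codes_vector_item:
  assumes "list_all2 (\<lambda>a y. represents y a) (map x [1..<Suc n]) ys" "i < n"
  shows "represents (item ys (ix i)) (x (Suc i))"
  using assms by (auto simp: list_all2_conv_all_nth item_def hd_drop_conv_nth simp del: upt_Suc)

text \<open>The coding relation admits unreduced fractions, so a coded input determines not just
  real data but a particular tuple of integer pairs. That tuple is the argument on which the program
  is known to run.\<close>

lemma codes_input_decode:
  assumes "codes_input \<alpha> n b m s f C t" "market \<alpha> n b m s f"
  shows "\<exists>e. t = enc e \<and> coded_trade \<alpha> n b m s f C e"
proof -
  obtain ta tb ts tf tC where t: "t = Bin ta (Bin tb (Bin ts (Bin tf tC)))" "codes_rat \<alpha> ta"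
    "codes_vector n b tb" "codes_vector m s ts" "codes_vector m f tf"
    "codes_list (codes_vector n) (map C [0..<Suc m]) tC"
    using assms(1) by (auto simp: codes_input_def)
  obtain a where a: "represents a \<alpha>" "ta = enc a" using t(2) by (auto simp: codes_rat_iff)
  obtain bs where bs: "list_all2 (\<lambda>a y. represents y a) (map b [1..<Suc n]) bs" "tb = enc bs"
    using codes_vector_decode[OF t(3)] by blast
  obtain ss where ss: "list_all2 (\<lambda>a y. represents y a) (map s [1..<Suc m]) ss" "ts = enc ss"
    using codes_vector_decode[OF t(4)] by blast
  obtain fs where fs: "list_all2 (\<lambda>a y. represents y a) (map f [1..<Suc m]) fs" "tf = enc fs"
    using codes_vector_decode[OF t(5)] by blast
  obtain Cs where Cs: "list_all2 (\<lambda>x ys. list_all2 (\<lambda>a y. represents y a) (map x [1..<Suc n]) ys)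
      (map C [0..<Suc m]) Cs" "tC = enc Cs"
    using codes_list_decode[OF t(6), of "\<lambda>x ys. list_all2 (\<lambda>a y. represents y a) (map x [1..<Suc n]) ys",
        OF codes_vector_decode] by blast
  define e where "e = (a, bs, ss, fs, Cs)"
  have "coded_trade \<alpha> n b m s f C e"
  proof
    show "market \<alpha> n b m s f" by fact
    show "represents (fst e) \<alpha>" using a by (simp add: e_def)
    show "represents (cb e (ix i)) (b (Suc i))" if "i < n" for i
      using codes_vector_item[OF bs(1) that] by (simp add: e_def cb_def)
    show "represents (cs e (ix i)) (s (Suc i))" if "i < m" for i
      using codes_vector_item[OF ss(1) that] by (simp add: e_def cs_def)
    show "represents (cf e (ix i)) (f (Suc i))" if "i < m" for i
      using codes_vector_item[OF fs(1) that] by (simp add: e_def cf_def)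
    show "represents (cC e (ix r) (ix i)) (C r (Suc i))" if "r \<le> m" "i < n" for r i
    proof -
      have "list_all2 (\<lambda>a y. represents y a) (map (C r) [1..<Suc n]) (item Cs (ix r))"
        using Cs(1) that(1) by (auto simp: list_all2_conv_all_nth[of _ _ Cs] item_def hd_drop_conv_nth simp del: upt_Suc)
      from codes_vector_item[OF this that(2)] show ?thesis by (simp add: e_def cC_def)
    qed
    show "length (fst (snd e)) = n" "length (fst (snd (snd e))) = m"
      using list_all2_lengthD[OF bs(1)] list_all2_lengthD[OF ss(1)] by (auto simp: e_def simp del: upt_Suc)
  qed
  moreover have "t = enc e" using t(1) a bs ss fs Cs by (simp add: e_def)
  ultimately show ?thesis by blast
qed

context coded_trade
begin

lemma codes_family_csolve:
  "codes_family n m (\<lambda>r. fill_array r (level r (C r))) (enc (csolve e))"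
proof -
  have units: "below (units xs) = map ix [0..<length xs]" for xs :: "frac list"
    by (simp add: units_def map_replicate_const below_ix)
  have row: "codes_vector n (fill_array r (level r (C r)) (Suc k))
       (enc (map (\<lambda>l. cfill e (ix k) (snd (cchain e (ix r) (ix (Suc l))))) [0..<n]))"
    if "r \<in> {1..m}" "k < r" for r k
    unfolding codes_vector_def
  proof (rule codes_list_enc)
    have "codes_rat (fill_array r (level r (C r)) (Suc k) (Suc l))
        (enc (cfill e (ix k) (snd (cchain e (ix r) (ix (Suc l))))))" if "l < n" for l
    proof -
      have "represents (cfill e (ix k) (snd (cchain e (ix r) (ix (Suc l)))))
          (fill f (level r (C r) (Suc l)) (Suc k))"
        using rep_chain[of r "Suc l"] \<open>r \<in> {1..m}\<close> \<open>k < r\<close> that by (intro rep_fill) auto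
      then have "codes_rat (fill f (level r (C r) (Suc l)) (Suc k))
          (enc (cfill e (ix k) (snd (cchain e (ix r) (ix (Suc l))))))"
        unfolding codes_rat_iff by blast
      then show ?thesis using \<open>k < r\<close> by (simp add: fill_array_def)
    qed
    then show "list_all2 (\<lambda>x y. codes_rat x (enc y)) (map (fill_array r (level r (C r)) (Suc k)) [1..<Suc n])
        (map (\<lambda>l. cfill e (ix k) (snd (cchain e (ix r) (ix (Suc l))))) [0..<n])"
      by (auto simp: list_all2_conv_all_nth simp del: upt_Suc replicate_Suc)
  qed
  have layer: "codes_list (codes_vector n) (map (fill_array r (level r (C r))) [1..<Suc r])
       (enc (map (\<lambda>k. map (\<lambda>l. cfill e (ix k) (snd (cchain e (ix r) (ix (Suc l))))) [0..<n]) [0..<r]))"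
    if "r \<in> {1..m}" for r
    by (rule codes_list_enc)
      (use row[OF that] in \<open>auto simp: list_all2_conv_all_nth simp del: upt_Suc replicate_Suc\<close>)
  have "csolve e = map (\<lambda>r. map (\<lambda>k. map (\<lambda>l. cfill e (ix k) (snd (cchain e (ix (Suc r)) (ix (Suc l))))) [0..<n])
      [0..<Suc r]) [0..<m]"
    unfolding csolve_def units length_b length_s replicate_Suc[symmetric] map_map o_def below_ix
    by (simp only: replicate_Suc[symmetric] below_ix map_map o_def)
  note csolve = this
  show ?thesis
    unfolding codes_family_def csolve
    by (rule codes_list_enc) (auto simp: list_all2_conv_all_nth layer[unfolded One_nat_def] simp del: upt_Suc replicate_Suc)
qed

end

theorem theorem3p3:
  "(\<forall>\<alpha> n b m s f C. market \<alpha> n b m s f \<and> targets n m C \<longrightarrow>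
      (value_condition \<alpha> n b m s f C \<longleftrightarrow> (\<exists>z. nested_family \<alpha> n b m s f C z))) \<and>
   (\<exists>(P :: prog) (p :: nat poly).
      \<forall>\<alpha> n b m s f C t.
        market \<alpha> n b m s f \<and> targets n m C \<and> value_condition \<alpha> n b m s f C \<and>
        codes_input \<alpha> n b m s f C t \<longrightarrow>
        (\<exists>z u T. exec P t u T \<and> T \<le> poly p (nodes t) \<and>
           codes_family n m z u \<and> nested_family \<alpha> n b m s f C z))"
proof (intro conjI allI impI)
  fix \<alpha> n b m s f C assume *: "market \<alpha> n b m s f \<and> targets n m C"
  then interpret trade \<alpha> n b m s f by unfold_locales blast
  show "value_condition \<alpha> n b m s f C \<longleftrightarrow> (\<exists>z. nested_family \<alpha> n b m s f C z)"
    using * value_condition_imp_nested_family nested_family_imp_value_condition by blast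
next
  \<comment> \<open>Program and polynomial are fixed before any instance; the time bound holds for
    all tuples of fractions, and the conditions on the instance enter through correctness of the
    result.\<close>
  obtain P p where P: "\<And>e. \<exists>T. exec P (enc e) (enc (csolve e)) T \<and> T \<le> poly p (sz e)"
    using ptime_csolve unfolding ptime_def by blast
  show "\<exists>(P :: prog) (p :: nat poly).
      \<forall>\<alpha> n b m s f C t.
        market \<alpha> n b m s f \<and> targets n m C \<and> value_condition \<alpha> n b m s f C \<and>
        codes_input \<alpha> n b m s f C t \<longrightarrow>
        (\<exists>z u T. exec P t u T \<and> T \<le> poly p (nodes t) \<and>
           codes_family n m z u \<and> nested_family \<alpha> n b m s f C z)"
  proof (intro exI[of _ P] exI[of _ p] allI impI)
    fix \<alpha> n b m s f C t
    assume *: "market \<alpha> n b m s f \<and> targets n m C \<and> value_condition \<alpha> n b m s f C \<and>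
        codes_input \<alpha> n b m s f C t"
    then obtain e where e: "t = enc e" "coded_trade \<alpha> n b m s f C e"
      using codes_input_decode by blast
    interpret coded_trade \<alpha> n b m s f C e by (rule e(2))
    obtain T where "exec P t (enc (csolve e)) T" "T \<le> poly p (nodes t)"
      using P[of e] e(1) by blast
    then show "\<exists>z u T. exec P t u T \<and> T \<le> poly p (nodes t) \<and>
           codes_family n m z u \<and> nested_family \<alpha> n b m s f C z"
      using * value_condition_imp_nested_family codes_family_csolve by blast
  qed
qed

end
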